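(* Let $d\ge 1$ be an integer, let $\mathcal I$ be a countable (finite or countably infinite) index set, and let $0<r<1$. Suppose there is a complex Euclidean ball $B\subset\mathbb C^d$ such that each $w_i:B\to\mathbb C$ ($i\in\mathcal I$) is holomorphic with $\sum_{i\in\mathcal I}\sup_{z\in B}|w_i(z)|<\infty$, and each $T_i:B\to B$ ($i\in\mathcal I$) is holomorphic with $\bigcup_{i\in\mathcal I}T_i(B)$ contained in the ball concentric with $B$ whose radius is $r$ times that of $B$. Let $\mathcal L f=\sum_{i\in\mathcal I}w_i\cdot f\circ T_i$ and $W:=\sup_{z\in B}\sum_{i\in\mathcal I}|w_i(z)|$. Then $\mathcal L:H^2(B)\to H^2(B)$ is compact and $$|\lambda_n(\mathcal L)|<\frac{W\sqrt d}{r^d(1-r^2)^{d/2}}\;n^{(d-1)/(2d)}\;r^{\frac{d}{d+1}(d!)^{1/d}n^{1/d}}\quad\text{for all }n\ge 1.$$ If $d=1$ then $$|\lambda_n(\mathcal L)|\le\frac{W}{\sqrt{1-r^2}}\;r^{(n-1)/2}\quad\text{for all }n\ge1.$$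
   Context: Balls are open. For an open ball $D\subset\mathbb C^d$, $H^\infty(D)$ denotes the Banach space of all bounded holomorphic functions $f:D\to\mathbb C$ with norm $\|f\|_{H^\infty(D)}=\sup_{z\in D}|f(z)|$. Hardy space $H^2(D)$ is the $L^2(\partial D,\sigma)$-closure of the set of those $f\in H^\infty(D)$ which extend continuously to the boundary $\partial D$, where $\sigma$ is $(2d-1)$-dimensional Lebesgue (surface) measure on $\partial D$, normalised so that $\sigma(\partial D)=1$. It is a Hilbert subspace of $L^2(\partial D,\sigma)$, and each $f\in H^2(D)$ has a natural holomorphic extension to $D$; elements of $H^2(D)$ are identified with these holomorphic functions on $D$, so that $(\mathcal L f)(z)=\sum_{i\in\mathcal I}w_i(z)f(T_i(z))$ for $z\in D$ when $D=B$. For a compact operator $\mathcal L$, $\{\lambda_n(\mathcal L)\}_{n=1}^\infty$ denotes the sequence of all eigenvalues of $\mathcal L$, counted with algebraic multiplicity and ordered by decreasing modulus, where distinct eigenvalues with the same modulus can be written in any order. As usual, if there are only finitely many nonzero eigenvalues (counted with multiplicity), the sequence is completed by zeros.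
   Formalization: The strict inequality is asserted only when W is nonzero; if W = 0 (all w_i vanish) it would read 0 < 0, so there the non-strict inequality is stated instead. *)

theory Defs
  imports "HOL-Analysis.Analysis" "HOL-Library.Function_Algebras"
begin

text \<open>
  The space \<open>\<complex>\<^sup>d\<close> is the type \<^typ>\<open>complex ^ 'n\<close> with \<open>d = CARD('n)\<close>; its norm is the Euclidean one.
\<close>

definition cholomorphic_on :: "(complex ^ 'n \<Rightarrow> complex) \<Rightarrow> (complex ^ 'n) set \<Rightarrow> bool"
    (infix "cholomorphic'_on" 50)
  where "f cholomorphic_on S \<longleftrightarrow>
    (\<forall>z\<in>S. \<exists>D. (f has_derivative D) (at z within S) \<and> (\<forall>a x. D (a *s x) = a * D x))"

definition cholomorphic_map_on :: "(complex ^ 'n \<Rightarrow> complex ^ 'm) \<Rightarrow> (complex ^ 'n) set \<Rightarrow> bool"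
    (infix "cholomorphic'_map'_on" 50)
  where "F cholomorphic_map_on S \<longleftrightarrow> (\<forall>j. (\<lambda>z. F z $ j) cholomorphic_on S)"


subsection \<open>Hardy space of a ball\<close>

definition Hinfty :: "complex ^ 'n \<Rightarrow> real \<Rightarrow> (complex ^ 'n \<Rightarrow> complex) set"
  where "Hinfty c R = {f. f cholomorphic_on ball c R \<and> bounded (f ` ball c R)}"

definition ball_algebra :: "complex ^ 'n \<Rightarrow> real \<Rightarrow> (complex ^ 'n \<Rightarrow> complex) set"
  where "ball_algebra c R = {f \<in> Hinfty c R. continuous_on (cball c R) f}"

text \<open>
  Normalised surface measure on \<open>sphere c R\<close>, by polar coordinates: the measure of \<open>A\<close> is the
  proportion of the volume of the ball taken up by the cone over \<open>A\<close> with apex at the centre.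
  The measure is restricted to the sphere so that functions that are continuous on
  \<open>cball c R\<close> and arbitrary elsewhere are measurable.
\<close>

definition sphere_measure :: "complex ^ 'n \<Rightarrow> real \<Rightarrow> (complex ^ 'n) measure"
  where "sphere_measure c R =
    restrict_space
      (distr (uniform_measure lborel (ball 0 1)) borel (\<lambda>x. c + R *\<^sub>R sgn x))
      (sphere c R)"

definition L2 :: "'a measure \<Rightarrow> ('a \<Rightarrow> complex) set"
  where "L2 M = {g \<in> borel_measurable M. integrable M (\<lambda>x. (cmod (g x))\<^sup>2)}"

definition L2_norm :: "'a measure \<Rightarrow> ('a \<Rightarrow> complex) \<Rightarrow> real"
  where "L2_norm M g = sqrt (LINT x|M. (cmod (g x))\<^sup>2)"

text \<open>
  \<open>hardy_boundary c R f g\<close>: the function \<open>g\<close> lies in the closure of the ball algebra in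
  \<open>L\<^sup>2\<close> of the sphere, and \<open>f\<close> is its holomorphic extension to the ball. Point evaluations
  at interior points are \<open>L\<^sup>2\<close>-bounded on the ball algebra, locally uniformly, so
  \<open>L\<^sup>2\<close>-convergence on the sphere forces locally uniform convergence in the ball; the
  extension is that limit.
\<close>

definition hardy_boundary ::
    "complex ^ 'n \<Rightarrow> real \<Rightarrow> (complex ^ 'n \<Rightarrow> complex) \<Rightarrow> (complex ^ 'n \<Rightarrow> complex) \<Rightarrow> bool"
  where "hardy_boundary c R f g \<longleftrightarrow>
    g \<in> L2 (sphere_measure c R) \<and>
    (\<exists>p. (\<forall>k::nat. p k \<in> ball_algebra c R) \<and>
         (\<lambda>k. L2_norm (sphere_measure c R) (\<lambda>x. p k x - g x)) \<longlonglongrightarrow> 0 \<and>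
         (\<forall>K. compact K \<and> K \<subseteq> ball c R \<longrightarrow> uniform_limit K p f sequentially))"

text \<open>
  Elements of the Hardy space are functions on the ball, represented by their extension by
  zero so that equality and linear dimension are those of functions on the ball.
\<close>

definition hardy_space :: "complex ^ 'n \<Rightarrow> real \<Rightarrow> (complex ^ 'n \<Rightarrow> complex) set"
  where "hardy_space c R = {f. (\<forall>z. z \<notin> ball c R \<longrightarrow> f z = 0) \<and> (\<exists>g. hardy_boundary c R f g)}"

text \<open>The boundary function is unique up to null sets, so the choice below is immaterial.\<close>

definition hardy_norm :: "complex ^ 'n \<Rightarrow> real \<Rightarrow> (complex ^ 'n \<Rightarrow> complex) \<Rightarrow> real"
  where "hardy_norm c R f = L2_norm (sphere_measure c R) (SOME g. hardy_boundary c R f g)"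


subsection \<open>Compact operators and eigenvalue sequences\<close>

global_interpretation cfun: vector_space "\<lambda>(a::complex) (f :: 'a \<Rightarrow> complex) x. a * f x"
  defines cfun_dim = cfun.dim and cfun_span = cfun.span
  by unfold_locales (auto simp: algebra_simps fun_eq_iff)

text \<open>
  \<open>L\<close> is a compact linear operator on the space with carrier \<open>X\<close> and norm \<open>N\<close>.
\<close>

definition compact_operator ::
    "('a \<Rightarrow> complex) set \<Rightarrow> (('a \<Rightarrow> complex) \<Rightarrow> real) \<Rightarrow> (('a \<Rightarrow> complex) \<Rightarrow> ('a \<Rightarrow> complex)) \<Rightarrow> bool"
  where "compact_operator X N L \<longleftrightarrow>
    (\<forall>f\<in>X. L f \<in> X) \<and>
    (\<forall>f\<in>X. \<forall>g\<in>X. \<forall>a b. L (\<lambda>x. a * f x + b * g x) = (\<lambda>x. a * L f x + b * L g x)) \<and>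
    (\<forall>F. (\<forall>k::nat. F k \<in> X) \<and> (\<exists>C. \<forall>k. N (F k) \<le> C) \<longrightarrow>
         (\<exists>g\<in>X. \<exists>s. strict_mono s \<and> (\<lambda>k. N (\<lambda>x. L (F (s k)) x - g x)) \<longlonglongrightarrow> 0))"

definition gen_eigenspace ::
    "('a \<Rightarrow> complex) set \<Rightarrow> (('a \<Rightarrow> complex) \<Rightarrow> ('a \<Rightarrow> complex)) \<Rightarrow> complex \<Rightarrow> ('a \<Rightarrow> complex) set"
  where "gen_eigenspace X L \<mu> =
    {f \<in> X. \<exists>k. ((\<lambda>g x. L g x - \<mu> * g x) ^^ k) f = (\<lambda>x. 0)}"

text \<open>
  \<open>lam 1, lam 2, \<dots>\<close> enumerates the eigenvalues of \<open>L\<close> with algebraic multiplicity by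
  decreasing modulus. The index \<open>0\<close> is not used. A nonzero number that is not an eigenvalue
  has multiplicity \<open>0\<close> and so does not occur; hence if the nonzero eigenvalues are exhausted,
  all further entries are zero. Finite dimension is required separately because
  \<^const>\<open>cfun_dim\<close> is \<open>0\<close> on spaces of infinite dimension.
\<close>

definition eigenvalue_sequence ::
    "('a \<Rightarrow> complex) set \<Rightarrow> (('a \<Rightarrow> complex) \<Rightarrow> ('a \<Rightarrow> complex)) \<Rightarrow> (nat \<Rightarrow> complex) \<Rightarrow> bool"
  where "eigenvalue_sequence X L lam \<longleftrightarrow>
    (\<forall>m n. 1 \<le> m \<and> m \<le> n \<longrightarrow> cmod (lam n) \<le> cmod (lam m)) \<and>
    (\<forall>\<mu>. \<mu> \<noteq> 0 \<longrightarrow>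
       (\<exists>b. finite b \<and> gen_eigenspace X L \<mu> \<subseteq> cfun_span b) \<and>
       finite {n. 1 \<le> n \<and> lam n = \<mu>} \<and>
       card {n. 1 \<le> n \<and> lam n = \<mu>} = cfun_dim (gen_eigenspace X L \<mu>))"


subsection \<open>The transfer operator\<close>

definition transfer_operator ::
    "(complex ^ 'n) set \<Rightarrow> 'i set \<Rightarrow> ('i \<Rightarrow> complex ^ 'n \<Rightarrow> complex) \<Rightarrow>
     ('i \<Rightarrow> complex ^ 'n \<Rightarrow> complex ^ 'n) \<Rightarrow> (complex ^ 'n \<Rightarrow> complex) \<Rightarrow> complex ^ 'n \<Rightarrow> complex"
  where "transfer_operator B I w T f =
    (\<lambda>z. if z \<in> B then \<Sum>\<^sub>\<infinity>i\<in>I. w i z * f (T i z) else 0)"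

end

theory Submission
  imports Defs
    "HOL-Complex_Analysis.Great_Picard"
    "HOL-Real_Asymp.Real_Asymp"
    "Jordan_Normal_Form.Determinant"
begin

text \<open>
  A holomorphic function \<open>f\<close> on the unit ball is the sum of its homogeneous components \<open>G\<^sub>m\<close>, which lie
  in the space of homogeneous polynomials of degree \<open>m\<close>, of dimension at most
  \<open>N\<^sub>m = (m + d - 1) choose m\<close>. Components of different degrees are orthogonal on every sphere about
  the centre, and by unitary invariance the reproducing kernel of degree \<open>m\<close> takes the constant value
  \<open>N\<^sub>m\<close> on the unit sphere. Hence, if the components of degree below \<open>K\<close> vanish, then \<open>f\<close> is bounded on
  the ball of radius \<open>r\<close> by \<open>(\<Sum>m\<ge>K. N\<^sub>m r\<^bsup>2m\<^esup>)\<^bsup>1/2\<^esup> \<parallel>f\<parallel>\<close>, and \<open>\<parallel>L f\<parallel>\<close> is at most \<open>W\<close> times this supremum.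
  The vanishing of these components amounts to \<open>N\<^sub>0 + \<dots> + N\<^sub>K\<^sub>-\<^sub>1\<close> linear conditions. A determinant
  argument turns such estimates into a bound for products of eigenvalues; it is carried
  out for the inner product on a sphere of radius \<open>s < 1\<close>, where all functions are continuous, and then
  \<open>s\<close> tends to \<open>1\<close>.
\<close>

subsection \<open>Holomorphic functions of several variables\<close>

no_notation fps_nth (infixl "$" 75)

text \<open>A single eigenvalue is not controlled by a single approximation number; only the product
  of the first \<open>n\<close> moduli is, by Weyl's inequality. Taking the \<open>n\<close>-th root
  averages exponents: the sum of \<open>k powr (1/d)\<close> over \<open>k \<le> n\<close> exceeds
  \<open>n powr (1 + 1/d) / (1 + 1/d)\<close>, the origin of \<open>d / (d + 1)\<close>. The number
  \<open>fact d\<close> enters because the polynomials of degree below \<open>K\<close> form a space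
  of dimension \<open>(K + d - 1) choose d\<close>, roughly \<open>K ^ d / fact d\<close>; shifting
  the degree by \<open>d\<close> to reach a clean inequality costs \<open>r\<close> to the power
  \<open>-d\<close>. The square root of the dimension of one homogeneous degree gives
  \<open>sqrt d\<close> and \<open>n powr ((d - 1) / (2 * d))\<close>. The Hardy norm refers to a
  chosen boundary function, which makes it awkward as an inner product on spans of generalised
  eigenvectors. On a sphere inside the ball the inner product is an explicit integral, diagonal in
  the homogeneous components. The price is only that \<open>r\<close> becomes \<open>r / s\<close>,
  and the eigenvalues do not depend on \<open>s\<close>.\<close>

lemma norm_smult_vec: "norm (a *s x) = cmod a * norm (x :: complex ^ 'n)"
  by (simp add: norm_vec_def norm_mult L2_set_right_distrib)

lemma smult_of_real_vec: "complex_of_real a *s x = a *\<^sub>R (x :: complex ^ 'n)"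
  by (simp add: Finite_Cartesian_Product.vec_eq_iff) (simp add: scaleR_conv_of_real)

lemma bounded_linear_smult_left: "bounded_linear (\<lambda>t. t *s (v :: complex ^ 'n))"
proof (rule bounded_linear_intro[where K = "norm v"])
  show "(r *\<^sub>R x) *s v = r *\<^sub>R (x *s v)" for r x
    by (simp add: Finite_Cartesian_Product.vec_eq_iff)
qed (auto simp: Finite_Cartesian_Product.vec_eq_iff distrib_right norm_smult_vec mult.commute)

lemma bounded_linear_smult_right: "bounded_linear (\<lambda>v :: complex ^ 'n. t *s v)"
  by (rule bounded_linear_intro[where K = "cmod t"])
     (auto simp: Finite_Cartesian_Product.vec_eq_iff distrib_left norm_smult_vec mult.commute)

lemma continuous_on_smult_vec [continuous_intros]:
  fixes g :: "'a::topological_space \<Rightarrow> complex ^ 'n"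
  assumes "continuous_on S f" "continuous_on S g"
  shows "continuous_on S (\<lambda>x. f x *s g x)"
  unfolding vector_scalar_mult_def by (intro continuous_intros assms)

lemma cholomorphic_on_open_iff:
  assumes "open S"
  shows "f cholomorphic_on S \<longleftrightarrow>
    (\<forall>z\<in>S. \<exists>D. (f has_derivative D) (at z) \<and> (\<forall>a x. D (a *s x) = a * D x))"
  unfolding cholomorphic_on_def by (intro ball_cong refl) (simp only: at_within_open[OF _ assms])

lemma cholomorphic_on_subset:
  assumes "f cholomorphic_on S" "T \<subseteq> S"
  shows "f cholomorphic_on T"
  unfolding cholomorphic_on_def
proof
  fix z assume "z \<in> T"
  with assms obtain D where D: "(f has_derivative D) (at z within S)" "\<forall>a x. D (a *s x) = a * D x"
    unfolding cholomorphic_on_def by blast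
  from has_derivative_subset[OF D(1) assms(2)] D(2)
  show "\<exists>D. (f has_derivative D) (at z within T) \<and> (\<forall>a x. D (a *s x) = a * D x)" by fast
qed

lemma cholomorphic_on_cong:
  assumes "f cholomorphic_on S" "\<And>z. z \<in> S \<Longrightarrow> f z = g z"
  shows "g cholomorphic_on S"
  unfolding cholomorphic_on_def
proof
  fix z assume z: "z \<in> S"
  then obtain D where D: "(f has_derivative D) (at z within S)" "\<forall>a x. D (a *s x) = a * D x"
    using assms(1) by (auto simp: cholomorphic_on_def)
  have "(g has_derivative D) (at z within S)"
    using has_derivative_transform[OF z _ D(1), of g] assms(2) by auto
  with D(2) show "\<exists>D. (g has_derivative D) (at z within S) \<and> (\<forall>a x. D (a *s x) = a * D x)"
    by blast
qed

lemma cholomorphic_on_imp_continuous_on: "f cholomorphic_on S \<Longrightarrow> continuous_on S f"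
  unfolding cholomorphic_on_def continuous_on_eq_continuous_within
  by (meson has_derivative_continuous)

lemma cholomorphic_on_const: "(\<lambda>_. k) cholomorphic_on S"
  unfolding cholomorphic_on_def by (auto intro!: exI[of _ "\<lambda>_. 0"])

lemma cholomorphic_on_nth: "(\<lambda>z. z $ j) cholomorphic_on S"
  unfolding cholomorphic_on_def
  by (auto intro!: exI[of _ "\<lambda>z. z $ j"] bounded_linear_imp_has_derivative bounded_linear_vec_nth)

lemma cholomorphic_on_add:
  assumes "f cholomorphic_on S" "g cholomorphic_on S"
  shows "(\<lambda>z. f z + g z) cholomorphic_on S"
  unfolding cholomorphic_on_def
proof
  fix z assume "z \<in> S"
  with assms obtain D E where "(f has_derivative D) (at z within S)" "\<forall>a x. D (a *s x) = a * D x"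
    "(g has_derivative E) (at z within S)" "\<forall>a x. E (a *s x) = a * E x"
    unfolding cholomorphic_on_def by meson
  then show "\<exists>D. ((\<lambda>z. f z + g z) has_derivative D) (at z within S) \<and> (\<forall>a x. D (a *s x) = a * D x)"
    by (intro exI[of _ "\<lambda>h. D h + E h"]) (auto intro!: derivative_intros simp: algebra_simps)
qed

lemma cholomorphic_on_mult:
  assumes "f cholomorphic_on S" "g cholomorphic_on S"
  shows "(\<lambda>z. f z * g z) cholomorphic_on S"
  unfolding cholomorphic_on_def
proof
  fix z assume "z \<in> S"
  with assms obtain D E where "(f has_derivative D) (at z within S)" "\<forall>a x. D (a *s x) = a * D x"
    "(g has_derivative E) (at z within S)" "\<forall>a x. E (a *s x) = a * E x"
    unfolding cholomorphic_on_def by meson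
  then show "\<exists>D. ((\<lambda>z. f z * g z) has_derivative D) (at z within S) \<and> (\<forall>a x. D (a *s x) = a * D x)"
    by (intro exI[of _ "\<lambda>h. f z * E h + D h * g z"] conjI has_derivative_mult)
       (auto simp: algebra_simps)
qed

lemma cholomorphic_on_cmult: "f cholomorphic_on S \<Longrightarrow> (\<lambda>z. k * f z) cholomorphic_on S"
  by (intro cholomorphic_on_mult cholomorphic_on_const)

lemma cholomorphic_on_diff:
  assumes "f cholomorphic_on S" "g cholomorphic_on S"
  shows "(\<lambda>z. f z - g z) cholomorphic_on S"
  using cholomorphic_on_add[OF assms(1) cholomorphic_on_cmult[OF assms(2), of "-1"]] by simp

lemma cholomorphic_on_sum:
  assumes "\<And>i. i \<in> A \<Longrightarrow> f i cholomorphic_on S"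
  shows "(\<lambda>z. \<Sum>i\<in>A. f i z) cholomorphic_on S"
  using assms
  by (induction A rule: infinite_finite_induct)
     (auto intro: cholomorphic_on_add cholomorphic_on_const)

text \<open>The real chain rule does the work: the derivative of \<open>T\<close> is put together
  from its components, and complex homogeneity of both derivatives passes to the composite.\<close>

lemma cholomorphic_on_compose:
  assumes T: "T cholomorphic_map_on S" and f: "f cholomorphic_on U" and sub: "T ` S \<subseteq> U"
  shows "(\<lambda>z. f (T z)) cholomorphic_on S"
  unfolding cholomorphic_on_def
proof
  fix z assume z: "z \<in> S"
  have "\<forall>j. \<exists>D. ((\<lambda>z. T z $ j) has_derivative D) (at z within S) \<and> (\<forall>a x. D (a *s x) = a * D x)"
    using T z unfolding cholomorphic_map_on_def cholomorphic_on_def by blast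
  then obtain D where D: "\<And>j. ((\<lambda>z. T z $ j) has_derivative D j) (at z within S)"
    "\<And>j a x. D j (a *s x) = a * D j x" by metis
  have T': "(T has_derivative (\<lambda>h. \<chi> j. D j h)) (at z within S)"
    unfolding has_derivative_componentwise_within[of T]
  proof
    fix b :: "complex ^ 'b" assume "b \<in> Basis"
    then obtain j u where b: "b = axis j u" by (auto simp: Basis_vec_def)
    show "((\<lambda>x. T x \<bullet> b) has_derivative (\<lambda>x. (\<chi> j. D j x) \<bullet> b)) (at z within S)"
      unfolding b inner_axis by (auto intro!: derivative_eq_intros D)
  qed
  have "T z \<in> U" using sub z by auto
  with f obtain E where E: "(f has_derivative E) (at (T z) within U)" "\<And>a x. E (a *s x) = a * E x"
    unfolding cholomorphic_on_def by meson
  have "(f has_derivative E) (at (T z) within T ` S)"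
    using E(1) sub has_derivative_subset by blast
  from diff_chain_within[OF T' this] have "((\<lambda>z. f (T z)) has_derivative (\<lambda>h. E (\<chi> j. D j h))) (at z within S)"
    by (simp add: o_def)
  moreover have "(\<chi> j. D j (a *s x)) = a *s (\<chi> j. D j x)" for a x
    by (simp add: Finite_Cartesian_Product.vec_eq_iff D(2))
  ultimately show "\<exists>D. ((\<lambda>z. f (T z)) has_derivative D) (at z within S) \<and> (\<forall>a x. D (a *s x) = a * D x)"
    using E(2) by (intro exI[of _ "\<lambda>h. E (\<chi> j. D j h)"]) auto
qed

section \<open>Restriction to complex lines, Cauchy's estimate and uniform limits\<close>

lemma cholomorphic_map_affine: "(\<lambda>z :: complex ^ 'n. p + a *s z) cholomorphic_map_on S"
  unfolding cholomorphic_map_on_def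
  by (auto intro!: cholomorphic_on_add cholomorphic_on_const cholomorphic_on_cmult cholomorphic_on_nth)

text \<open>Complex homogeneity turns the real derivative \<open>h \<mapsto> D (h *s v)\<close> into
  multiplication by \<open>D v\<close>, so the restriction to a complex line is complex
  differentiable. One-variable theory enters through this.\<close>

lemma has_field_derivative_line:
  fixes f :: "complex ^ 'n \<Rightarrow> complex"
  assumes D: "(f has_derivative D) (at (z + t *s v))" "\<And>a x. D (a *s x) = a * D x"
  shows "((\<lambda>t. f (z + t *s v)) has_field_derivative D v) (at t)"
proof -
  have "((\<lambda>t. z + t *s v) has_derivative (\<lambda>h. h *s v)) (at t)"
    using has_derivative_add[OF has_derivative_const[of z "at t"]
        bounded_linear_imp_has_derivative[OF bounded_linear_smult_left[of v]]] by simp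
  from has_derivative_compose[OF this D(1)]
  have "((\<lambda>t. f (z + t *s v)) has_derivative (\<lambda>h. D (h *s v))) (at t)" .
  moreover have "(\<lambda>h. D (h *s v)) = (*) (D v)"
    by (rule ext) (simp only: D(2) mult.commute)
  ultimately show ?thesis
    unfolding has_field_derivative_def by (simp only:)
qed

lemma holomorphic_on_line:
  assumes "open S" "f cholomorphic_on S"
  shows "(\<lambda>t. f (z + t *s v)) holomorphic_on {t. z + t *s v \<in> S}"
  unfolding holomorphic_on_def
proof
  fix t assume "t \<in> {t. z + t *s v \<in> S}"
  with assms obtain D where "(f has_derivative D) (at (z + t *s v))" "\<And>a x. D (a *s x) = a * D x"
    by (auto simp: cholomorphic_on_open_iff)
  from has_field_derivative_at_within[OF has_field_derivative_line[OF this]]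
  show "(\<lambda>t. f (z + t *s v)) field_differentiable at t within {t. z + t *s v \<in> S}"
    unfolding field_differentiable_def by fast
qed

text \<open>Cauchy's inequality for the first derivative of the restriction of \<open>f\<close> to
  the complex line through \<open>z\<close> in direction \<open>v\<close>.\<close>

lemma cholomorphic_derivative_bound:
  fixes f :: "complex ^ 'n \<Rightarrow> complex"
  assumes f: "f cholomorphic_on ball z \<delta>" and bd: "\<And>y. y \<in> ball z \<delta> \<Longrightarrow> cmod (f y) \<le> M"
    and \<delta>: "0 < \<delta>" and D: "(f has_derivative D) (at z)" "\<And>a x. D (a *s x) = a * D x"
  shows "cmod (D v) \<le> 2 * M / \<delta> * norm v"
proof (cases "v = 0")
  case True
  have "D 0 = 0" using D(2)[of 0 0] unfolding vector_smult_lzero mult_zero_left .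
  with True show ?thesis by simp
next
  case False
  \<comment> \<open>Half of the largest admissible radius, so that the closed disc is still mapped
    into the open ball; this is where the factor 2 comes from.\<close>
  define \<rho> where "\<rho> = \<delta> / (2 * norm v)"
  have \<rho>: "0 < \<rho>" "\<rho> * norm v < \<delta>" using False \<delta> by (auto simp: \<rho>_def)
  let ?h = "\<lambda>t. f (z + t *s v)"
  have sub: "cball 0 \<rho> \<subseteq> {t. z + t *s v \<in> ball z \<delta>}"
  proof
    fix t :: complex assume "t \<in> cball 0 \<rho>"
    then have "cmod t * norm v \<le> \<rho> * norm v" by (auto intro: mult_right_mono)
    with \<rho> show "t \<in> {t. z + t *s v \<in> ball z \<delta>}" by (simp add: dist_norm norm_smult_vec)
  qed
  have hol: "?h holomorphic_on cball 0 \<rho>"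
    using holomorphic_on_subset[OF holomorphic_on_line[OF open_ball f] sub] .
  have "cmod ((deriv ^^ 1) ?h 0) \<le> fact 1 * M / \<rho> ^ 1"
  proof (rule Cauchy_inequality)
    show "?h holomorphic_on ball 0 \<rho>" using hol holomorphic_on_subset ball_subset_cball by blast
    show "continuous_on (cball 0 \<rho>) ?h" using hol holomorphic_on_imp_continuous_on by blast
    show "\<And>x. cmod (0 - x) = \<rho> \<Longrightarrow> cmod (?h x) \<le> M" using sub by (intro bd) (auto simp: subset_iff)
  qed fact
  moreover have "deriv ?h 0 = D v"
    by (rule DERIV_imp_deriv, rule has_field_derivative_line) (use D in auto)
  ultimately show ?thesis using False by (simp add: \<rho>_def field_simps)
qed

text \<open>Weierstrass' theorem. Cauchy's estimate, applied to differences \<open>f m - f n\<close>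
  on balls of radius \<open>\<delta>/2\<close> about points of the smaller ball, makes the
  derivatives uniformly Cauchy there. Their limit is the derivative of \<open>g\<close>, and complex
  homogeneity survives pointwise limits.\<close>

lemma cholomorphic_uniform_limit_ball:
  fixes f :: "nat \<Rightarrow> complex ^ 'n \<Rightarrow> complex"
  assumes f: "\<And>k. f k cholomorphic_on ball z \<delta>"
    and lim: "uniform_limit (ball z \<delta>) f g sequentially" and \<delta>: "0 < \<delta>"
  shows "g cholomorphic_on ball z (\<delta>/2)"
proof -
  define S where "S = ball z (\<delta>/2)"
  have "\<forall>k. \<forall>y\<in>ball z \<delta>. \<exists>D. (f k has_derivative D) (at y) \<and> (\<forall>a x. D (a *s x) = a * D x)"
    using f by (simp add: cholomorphic_on_open_iff)
  then obtain D where D: "\<And>k y. y \<in> ball z \<delta> \<Longrightarrow> (f k has_derivative D k y) (at y)"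
    "\<And>k y a x. y \<in> ball z \<delta> \<Longrightarrow> D k y (a *s x) = a * D k y x"
    by metis
  have cauchy: "\<exists>N. \<forall>m\<ge>N. \<forall>n\<ge>N. \<forall>y\<in>S. \<forall>v. cmod (D m y v - D n y v) \<le> e * norm v" if e: "e > 0" for e
  proof -
    have "e * \<delta> / 8 > 0" using e \<delta> by simp
    with lim have "\<exists>N. \<forall>n\<ge>N. \<forall>y\<in>ball z \<delta>. dist (f n y) (g y) < e * \<delta> / 8"
      unfolding uniform_limit_iff eventually_sequentially by blast
    then obtain N where N: "\<And>n y. n \<ge> N \<Longrightarrow> y \<in> ball z \<delta> \<Longrightarrow> dist (f n y) (g y) < e * \<delta> / 8"
      by blast
    show ?thesis
    proof (intro exI[of _ N] allI impI ballI)
      fix m n y v assume mn: "m \<ge> N" "n \<ge> N" and y: "y \<in> S"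
      have sub: "ball y (\<delta>/2) \<subseteq> ball z \<delta>"
      proof
        fix x assume "x \<in> ball y (\<delta>/2)"
        with y show "x \<in> ball z \<delta>" using dist_triangle[of z x y] by (simp add: S_def)
      qed
      have yin: "y \<in> ball z \<delta>" using y \<delta> by (auto simp: S_def)
      \<comment> \<open>Both functions are within \<open>e * \<delta> / 8\<close> of
        \<open>g\<close>, so their difference is at most \<open>e * \<delta> / 4\<close> on a ball
        of radius \<open>\<delta>/2\<close>; the constants collapse to \<open>e\<close>.\<close>
      have "cmod (D m y v - D n y v) \<le> 2 * (e * \<delta> / 4) / (\<delta>/2) * norm v"
      proof (rule cholomorphic_derivative_bound[where f = "\<lambda>x. f m x - f n x" and D = "\<lambda>v. D m y v - D n y v"])
        show "(\<lambda>x. f m x - f n x) cholomorphic_on ball y (\<delta>/2)"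
          by (intro cholomorphic_on_diff cholomorphic_on_subset[OF f sub])
        show "cmod (f m x - f n x) \<le> e * \<delta> / 4" if "x \<in> ball y (\<delta>/2)" for x
        proof -
          have "x \<in> ball z \<delta>" using that sub by blast
          from N[OF mn(1) this] N[OF mn(2) this] have "dist (f m x) (f n x) < e*\<delta>/8 + e*\<delta>/8"
            by (metis add_strict_mono dist_commute dist_triangle_less_add)
          then show ?thesis by (simp add: dist_norm mult.commute)
        qed
        show "((\<lambda>x. f m x - f n x) has_derivative (\<lambda>v. D m y v - D n y v)) (at y)"
          by (intro has_derivative_diff D yin)
      qed (use \<delta> D(2)[OF yin] in \<open>auto simp: algebra_simps\<close>)
      also have "\<dots> = e * norm v" using \<delta> by simp
      finally show "cmod (D m y v - D n y v) \<le> e * norm v" .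
    qed
  qed
  define G where "G y v = lim (\<lambda>k. D k y v)" for y v
  have conv: "(\<lambda>k. D k y v) \<longlonglongrightarrow> G y v" if y: "y \<in> S" for y v
  proof -
    have "Cauchy (\<lambda>k. D k y v)"
    proof (rule CauchyI)
      fix e :: real assume "e > 0"
      then have "e / (norm v + 1) > 0" by (simp add: add_nonneg_pos)
      from cauchy[OF this] y obtain N where
        N: "\<And>m n. m \<ge> N \<Longrightarrow> n \<ge> N \<Longrightarrow> cmod (D m y v - D n y v) \<le> e / (norm v + 1) * norm v" by meson
      have "e / (norm v + 1) * norm v < e" using \<open>e > 0\<close>
        by (simp add: field_simps add_pos_nonneg)
      with N show "\<exists>M. \<forall>m\<ge>M. \<forall>n\<ge>M. cmod (D m y v - D n y v) < e" by (meson le_less_trans)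
    qed
    then show ?thesis unfolding G_def using Cauchy_convergent convergent_LIMSEQ_iff by blast
  qed
  have "\<exists>h. \<forall>x\<in>S. (\<lambda>n. f n x) \<longlonglongrightarrow> h x \<and> (h has_derivative G x) (at x within S)"
  proof (rule has_derivative_sequence)
    show "convex S" by (simp add: S_def)
    show "z \<in> S" using \<delta> by (simp add: S_def)
    show "(\<lambda>n. f n z) \<longlonglongrightarrow> g z" using tendsto_uniform_limitI[OF lim] \<delta> by simp
    show "(f n has_derivative D n x) (at x within S)" if "x \<in> S" for n x
      using that D(1)[of x n] \<delta> by (auto simp: S_def intro: has_derivative_at_withinI)
    fix e :: real assume "e > 0"
    from cauchy[OF this] obtain N where
      N: "\<And>m n y v. m \<ge> N \<Longrightarrow> n \<ge> N \<Longrightarrow> y \<in> S \<Longrightarrow> cmod (D m y v - D n y v) \<le> e * norm v" by meson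
    have "cmod (D n y v - G y v) \<le> e * norm v" if "n \<ge> N" "y \<in> S" for n y v
    proof (rule LIMSEQ_le_const2)
      show "(\<lambda>m. cmod (D n y v - D m y v)) \<longlonglongrightarrow> cmod (D n y v - G y v)"
        by (intro tendsto_intros conv that)
    qed (use N that in blast)
    then show "\<forall>\<^sub>F n in sequentially. \<forall>x\<in>S. \<forall>h. cmod (D n x h - G x h) \<le> e * norm h"
      unfolding eventually_sequentially by blast
  qed
  then obtain h where h: "\<And>x. x \<in> S \<Longrightarrow> (\<lambda>n. f n x) \<longlonglongrightarrow> h x"
    "\<And>x. x \<in> S \<Longrightarrow> (h has_derivative G x) (at x within S)" by blast
  have hg: "h x = g x" if "x \<in> S" for x
    using LIMSEQ_unique[OF h(1)[OF that] tendsto_uniform_limitI[OF lim, of x]] that \<delta> by (auto simp: S_def)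
  have "h cholomorphic_on S" unfolding cholomorphic_on_def
  proof
    fix x assume x: "x \<in> S"
    have "G x (a *s v) = a * G x v" for a v
    proof (rule LIMSEQ_unique[OF conv[OF x]])
      have "D k x (a *s v) = a * D k x v" for k using D(2)[of x k a v] x \<delta> by (auto simp: S_def)
      then show "(\<lambda>k. D k x (a *s v)) \<longlonglongrightarrow> a * G x v"
        using tendsto_mult_left[OF conv[OF x], of a v] by simp
    qed
    with h(2)[OF x] show "\<exists>D. (h has_derivative D) (at x within S) \<and> (\<forall>a x. D (a *s x) = a * D x)"
      by blast
  qed
  then show ?thesis using cholomorphic_on_cong hg unfolding S_def by blast
qed

lemma cholomorphic_on_local:
  assumes "open S" "\<And>z. z \<in> S \<Longrightarrow> \<exists>\<delta>>0. f cholomorphic_on ball z \<delta>"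
  shows "f cholomorphic_on S"
  unfolding cholomorphic_on_open_iff[OF assms(1)]
proof
  fix z assume "z \<in> S"
  with assms(2) obtain \<delta> where "\<delta> > 0" "f cholomorphic_on ball z \<delta>" by blast
  then show "\<exists>D. (f has_derivative D) (at z) \<and> (\<forall>a x. D (a *s x) = a * D x)"
    using cholomorphic_on_open_iff[OF open_ball, of f z \<delta>] by auto
qed

lemma cholomorphic_locally_uniform_limit:
  fixes f :: "nat \<Rightarrow> complex ^ 'n \<Rightarrow> complex"
  assumes S: "open S" and f: "\<And>z. z \<in> S \<Longrightarrow>
     \<exists>\<delta>>0. (\<forall>k. f k cholomorphic_on ball z \<delta>) \<and> uniform_limit (ball z \<delta>) f g sequentially"
  shows "g cholomorphic_on S"
proof (rule cholomorphic_on_local[OF S])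
  fix z assume "z \<in> S"
  from f[OF this] obtain \<delta> where "\<delta> > 0" "\<And>k. f k cholomorphic_on ball z \<delta>"
    "uniform_limit (ball z \<delta>) f g sequentially" by blast
  from cholomorphic_uniform_limit_ball[OF this(2,3,1)]
  show "\<exists>\<delta>>0. g cholomorphic_on ball z \<delta>" using \<open>\<delta> > 0\<close> by (intro exI[of _ "\<delta>/2"]) auto
qed

subsection \<open>Homogeneous components and homogeneous polynomials\<close>

text \<open>The \<open>m\<close>-th Taylor coefficient at 0 of the slice
  \<open>t \<mapsto> f (t *s z)\<close>. For \<open>f\<close> holomorphic on the unit ball every
  slice is holomorphic near 0, so the component is meaningful for all \<open>z\<close>, also outside
  the ball.\<close>

definition hcomp :: "nat \<Rightarrow> (complex ^ 'n \<Rightarrow> complex) \<Rightarrow> complex ^ 'n \<Rightarrow> complex"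
  where "hcomp m f z = (deriv ^^ m) (\<lambda>t. f (t *s z)) 0 / fact m"

text \<open>Homogeneous entire functions; that they are polynomials is proved in
  \<open>hpoly_subset_span_monomials\<close>. In this form the space is visibly invariant under
  unitary maps.\<close>

definition hpoly :: "nat \<Rightarrow> (complex ^ 'n \<Rightarrow> complex) set"
  where "hpoly m = {G. G cholomorphic_on UNIV \<and> (\<forall>a z. G (a *s z) = a ^ m * G z)}"

lemma holomorphic_on_radial:
  assumes f: "f cholomorphic_on ball 0 1" and \<rho>: "\<rho> * norm z \<le> 1"
  shows "(\<lambda>t. f (t *s z)) holomorphic_on ball 0 \<rho>"
proof -
  have "ball 0 \<rho> \<subseteq> {t. 0 + t *s z \<in> ball 0 1}"
  proof
    fix t :: complex assume "t \<in> ball 0 \<rho>"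
    then have t: "cmod t < \<rho>" by simp
    have "cmod t * norm z < 1"
    proof (cases "z = 0")
      case False
      then have "cmod t * norm z < \<rho> * norm z" using t by simp
      then show ?thesis using \<rho> by simp
    qed simp
    then show "t \<in> {t. 0 + t *s z \<in> ball 0 1}" by (simp add: norm_smult_vec)
  qed
  from holomorphic_on_subset[OF holomorphic_on_line[OF open_ball f] this] show ?thesis by simp
qed

lemma radius_exists:
  fixes z :: "complex ^ 'n"
  assumes "norm (t *s z) < 1"
  obtains \<rho> where "cmod t < \<rho>" "\<rho> * norm z \<le> 1" "0 < \<rho>"
proof (cases "z = 0")
  case True
  then show ?thesis using that[of "cmod t + 1"] by (simp add: add_nonneg_pos)
next
  case False
  then show ?thesis using that[of "1 / norm z"] assms by (simp add: norm_smult_vec field_simps)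
qed

lemma hcomp_sums:
  assumes f: "f cholomorphic_on ball 0 1" and t: "norm (t *s z) < 1"
  shows "(\<lambda>m. hcomp m f z * t ^ m) sums f (t *s z)"
proof -
  obtain \<rho> where \<rho>: "cmod t < \<rho>" "\<rho> * norm z \<le> 1" "0 < \<rho>" using radius_exists[OF t] .
  from holomorphic_power_series[OF holomorphic_on_radial[OF f \<rho>(2)], of t] \<rho>(1)
  show ?thesis by (simp add: hcomp_def)
qed

lemma hcomp_homogeneous:
  assumes f: "f cholomorphic_on ball 0 1"
  shows "hcomp m f (a *s z) = a ^ m * hcomp m f z"
proof -
  obtain \<rho> where \<rho>: "\<rho> * norm z \<le> 1" "0 < \<rho>" using radius_exists[of 0 z] by auto
  \<comment> \<open>The added 1 keeps the radius meaningful for \<open>a = 0\<close> and still makes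
    \<open>a * t\<close> stay in the disc of radius \<open>\<rho>\<close>.\<close>
  define S where "S = ball (0::complex) (\<rho> / (cmod a + 1))"
  have S0: "0 \<in> S" using \<rho>(2) by (simp add: S_def add_nonneg_pos)
  have "(deriv ^^ m) (\<lambda>t. f ((a * t) *s z)) 0 = a ^ m * (deriv ^^ m) (\<lambda>t. f (t *s z)) (a * 0)"
  proof (rule higher_deriv_compose_linear[OF holomorphic_on_radial[OF f \<rho>(1)] _ open_ball S0])
    show "open S" by (simp add: S_def)
    fix t assume "t \<in> S"
    then have t: "cmod t * (cmod a + 1) < \<rho>"
      using pos_less_divide_eq[of "cmod a + 1" "cmod t" \<rho>] norm_ge_zero[of a] by (simp add: S_def)
    have "cmod a * cmod t \<le> cmod t * (cmod a + 1)" by (simp add: algebra_simps)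
    with t show "a * t \<in> ball 0 \<rho>" by (simp add: norm_mult)
  qed
  moreover have "(\<lambda>t. f (t *s (a *s z))) = (\<lambda>t. f ((a * t) *s z))"
    by (simp only: vector_smult_assoc mult.commute)
  ultimately show ?thesis by (simp add: hcomp_def del: vector_smult_assoc)
qed

lemma hcomp_linear:
  assumes f: "f cholomorphic_on ball 0 1" and g: "g cholomorphic_on ball 0 1"
  shows "hcomp m (\<lambda>z. a * f z + b * g z) z = a * hcomp m f z + b * hcomp m g z"
proof -
  obtain \<rho> where \<rho>: "\<rho> * norm z \<le> 1" "0 < \<rho>" using radius_exists[of 0 z] by auto
  note hf = holomorphic_on_radial[OF f \<rho>(1)] and hg = holomorphic_on_radial[OF g \<rho>(1)]
  have "(deriv ^^ m) (\<lambda>t. a * f (t *s z) + b * g (t *s z)) 0 =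
      a * (deriv ^^ m) (\<lambda>t. f (t *s z)) 0 + b * (deriv ^^ m) (\<lambda>t. g (t *s z)) 0"
    using \<rho>(2) hf hg
    by (subst higher_deriv_add[of _ "ball 0 \<rho>"])
       (auto intro!: holomorphic_intros simp: higher_deriv_cmult[of _ "ball 0 \<rho>"])
  then show ?thesis by (simp add: hcomp_def add_divide_distrib)
qed

text \<open>Cauchy's inequality on the circle of radius \<open>q / norm z\<close>, along which
  \<open>t *s z\<close> runs through points of norm exactly \<open>q\<close>. For
  \<open>z = 0\<close> there is no such circle and homogeneity with the scalar 0 settles the
  claim.\<close>

lemma hcomp_bound:
  assumes f: "f cholomorphic_on ball 0 1" and q: "0 < q" "q < 1"
    and M: "\<And>z. norm z \<le> q \<Longrightarrow> cmod (f z) \<le> M"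
  shows "cmod (hcomp m f z) \<le> M * (norm z / q) ^ m"
proof (cases "z = 0")
  case True
  have "hcomp m f 0 = 0 ^ m * hcomp m f 0" using hcomp_homogeneous[OF f, of m 0 0] by simp
  moreover have "cmod (f 0) \<le> M" using M[of 0] q by simp
  ultimately show ?thesis using True by (cases m) (auto simp: hcomp_def)
next
  case False
  define \<rho> where "\<rho> = q / norm z"
  have \<rho>: "\<rho> > 0" "\<rho> * norm z = q" using False q by (auto simp: \<rho>_def)
  have "(\<lambda>t. f (t *s z)) holomorphic_on ball 0 (1 / norm z)"
    by (rule holomorphic_on_radial[OF f]) simp
  moreover have "cball 0 \<rho> \<subseteq> ball 0 (1 / norm z)" using q False by (auto simp: \<rho>_def field_simps)
  ultimately have hol: "(\<lambda>t. f (t *s z)) holomorphic_on cball 0 \<rho>" by (rule holomorphic_on_subset)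
  have "cmod ((deriv ^^ m) (\<lambda>t. f (t *s z)) 0) \<le> fact m * M / \<rho> ^ m"
  proof (rule Cauchy_inequality)
    show "(\<lambda>t. f (t *s z)) holomorphic_on ball 0 \<rho>" using hol holomorphic_on_subset ball_subset_cball by blast
    show "continuous_on (cball 0 \<rho>) (\<lambda>t. f (t *s z))" using hol holomorphic_on_imp_continuous_on by blast
    show "cmod (f (t *s z)) \<le> M" if "cmod (0 - t) = \<rho>" for t
      by (rule M) (use that \<rho> in \<open>simp add: norm_smult_vec\<close>)
  qed (rule \<rho>(1))
  then have "cmod (hcomp m f z) \<le> M / \<rho> ^ m"
    by (simp add: hcomp_def norm_divide divide_le_eq mult.commute)
  then show ?thesis by (simp add: \<rho>_def power_divide)
qed

text \<open>
  Homogeneous components and partial derivatives are both limits of the difference quotients below,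
  and the estimate makes these limits locally uniform.
\<close>

lemma hcomp_quotient_bound:
  assumes f: "f cholomorphic_on ball 0 1"
    and M: "\<And>z. norm z \<le> 1/2 \<Longrightarrow> cmod (f z) \<le> M"
    and z: "norm z \<le> \<rho>" and \<rho>: "0 < \<rho>" and t: "t = complex_of_real (1 / (2 * \<rho> * (real k + 2)))"
  shows "cmod ((f (t *s z) - (\<Sum>i<m. hcomp i f z * t ^ i)) / t ^ m - hcomp m f z)
    \<le> M * (2 * \<rho>) ^ m / (real k + 1)"
proof -
  \<comment> \<open>The components of degree \<open>i\<close> grow at most like
    \<open>(2 * \<rho>) ^ i\<close>, and \<open>t\<close> has modulus
    \<open>x / (2 * \<rho>)\<close>, so the tail is geometric with ratio \<open>x\<close>. The value
    of \<open>x\<close> is chosen so that \<open>x / (1 - x)\<close> equals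
    \<open>1 / (real k + 1)\<close>.\<close>
  define x where "x = 1 / (real k + 2)"
  have x: "0 < x" "x < 1" by (auto simp: x_def)
  have t0: "t \<noteq> 0" "cmod t = x / (2 * \<rho>)" using \<rho> by (simp_all add: t x_def norm_of_real del: of_real_divide of_real_mult of_real_add)
  have "norm (t *s z) \<le> x / (2 * \<rho>) * \<rho>"
    unfolding norm_smult_vec t0(2) by (rule mult_left_mono) (use z x \<rho> in auto)
  also have "\<dots> < 1" using \<rho> x by simp
  finally have tz: "norm (t *s z) < 1" .
  have M0: "M \<ge> 0" using M[of 0] norm_ge_zero[of "f 0"] by (simp del: norm_ge_zero)
  have "(\<lambda>i. hcomp (i + m) f z * t ^ (i + m)) sums (f (t *s z) - (\<Sum>i<m. hcomp i f z * t ^ i))"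
    by (rule sums_split_initial_segment[OF hcomp_sums[OF f tz]])
  from sums_divide[OF this, of "t ^ m"]
  have "(\<lambda>i. hcomp (i + m) f z * t ^ i) sums ((f (t *s z) - (\<Sum>i<m. hcomp i f z * t ^ i)) / t ^ m)"
    using t0(1) by (simp add: power_add)
  from sums_split_initial_segment[OF this, of 1]
  have s1: "(\<lambda>i. hcomp (i + 1 + m) f z * t ^ (i + 1)) sums
     ((f (t *s z) - (\<Sum>i<m. hcomp i f z * t ^ i)) / t ^ m - hcomp m f z)" by simp
  have s2: "(\<lambda>i. M * (2 * \<rho>) ^ m * x * x ^ i) sums (M * (2 * \<rho>) ^ m * x * (1 / (1 - x)))"
    by (intro sums_mult geometric_sums) (use x in auto)
  have "cmod ((f (t *s z) - (\<Sum>i<m. hcomp i f z * t ^ i)) / t ^ m - hcomp m f z)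
     \<le> M * (2 * \<rho>) ^ m * x * (1 / (1 - x))"
  proof (rule norm_sums_le[OF s1 s2])
    fix i
    have "cmod (hcomp (i + 1 + m) f z) \<le> M * (norm z / (1/2)) ^ (i + 1 + m)"
      by (rule hcomp_bound[OF f _ _ M]) auto
    also have "\<dots> \<le> M * (2 * \<rho>) ^ (i + 1 + m)"
      using z M0 by (intro mult_left_mono power_mono) auto
    finally have "cmod (hcomp (i + 1 + m) f z * t ^ (i + 1)) \<le> M * (2 * \<rho>) ^ (i + 1 + m) * (x / (2 * \<rho>)) ^ (i + 1)"
      unfolding norm_mult norm_power t0(2) using x \<rho> by (intro mult_right_mono) auto
    also have "\<dots> = M * (2 * \<rho>) ^ m * x * x ^ i"
      using \<rho> by (simp add: power_add power_divide power_mult_distrib)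
    finally show "cmod (hcomp (i + 1 + m) f z * t ^ (i + 1)) \<le> M * (2 * \<rho>) ^ m * x * x ^ i" .
  qed
  also have "\<dots> = M * (2 * \<rho>) ^ m * (x * (1 / (1 - x)))" by (simp only: mult.assoc)
  also have "x * (1 / (1 - x)) = 1 / (real k + 1)" by (simp add: x_def field_simps)
  finally show ?thesis by (simp only: times_divide_eq_right mult_1_right)
qed

lemma uniform_limit_of_bound:
  fixes f :: "nat \<Rightarrow> 'a \<Rightarrow> complex"
  assumes "\<And>k z. z \<in> S \<Longrightarrow> cmod (f k z - g z) \<le> C / (real k + 1)"
  shows "uniform_limit S f g sequentially"
proof (rule uniform_limitI)
  fix e :: real assume e: "e > 0"
  have "(\<lambda>k. C / (real k + 1)) \<longlonglongrightarrow> 0" by real_asymp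
  from order_tendstoD(2)[OF this e]
  show "\<forall>\<^sub>F k in sequentially. \<forall>z\<in>S. dist (f k z) (g z) < e"
  proof eventually_elim
    case (elim k)
    then show ?case using assms le_less_trans unfolding dist_norm by metis
  qed
qed

lemma bounded_on_cball:
  assumes "f cholomorphic_on S" "cball z q \<subseteq> S"
  obtains M where "\<And>y. y \<in> cball z q \<Longrightarrow> cmod (f y) \<le> M"
proof -
  have "compact (f ` cball z q)"
    using cholomorphic_on_imp_continuous_on[OF assms(1)] assms(2)
    by (intro compact_continuous_image) (auto intro: continuous_on_subset)
  then have "bounded (f ` cball z q)" by (rule compact_imp_bounded)
  then obtain M where "\<forall>x\<in>f ` cball z q. cmod x \<le> M" unfolding bounded_iff by (elim exE)
  then show ?thesis using that[of M] by simp
qed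

text \<open>Strong induction on the degree. Once the components of degree below \<open>m\<close> are
  known to be holomorphic, so are the quotients that remove them from \<open>f (t *s z)\<close> and
  divide by \<open>t ^ m\<close>; these tend locally uniformly to the component of degree
  \<open>m\<close>.\<close>

lemma hcomp_in_hpoly:
  assumes f: "f cholomorphic_on ball 0 (1 :: real)"
  shows "hcomp m f \<in> hpoly m"
proof -
  obtain M where M: "\<And>z. norm z \<le> 1/2 \<Longrightarrow> cmod (f z) \<le> M"
    using bounded_on_cball[OF f, of 0 "1/2"] by (auto simp: cball_subset_ball_iff)
  have "hcomp m f cholomorphic_on UNIV"
  proof (induction m rule: less_induct)
    case (less m)
    show ?case
    proof (rule cholomorphic_on_local)
      fix z0 :: "complex ^ 'a"
      \<comment> \<open>Bounds the norm on the ball of radius 1 about \<open>z0\<close>; the scalars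
        \<open>t k\<close> shrink that ball into the unit ball, however large \<open>z0\<close>
        is.\<close>
      define \<rho> where "\<rho> = norm z0 + 1"
      have \<rho>: "\<rho> > 0" by (simp add: \<rho>_def add_nonneg_pos)
      define t where "t k = complex_of_real (1 / (2 * \<rho> * (real k + 2)))" for k
      have zin: "norm z \<le> \<rho>" if "z \<in> ball z0 1" for z
        using that norm_triangle_ineq2[of z z0] by (simp add: \<rho>_def dist_norm norm_minus_commute)
      define g where "g k z = (f (t k *s z) - (\<Sum>i<m. hcomp i f z * t k ^ i)) / t k ^ m" for k z
      have "g k cholomorphic_on ball z0 1" for k
      proof -
        have tk: "cmod (t k) = 1 / (2 * \<rho> * (real k + 2))" using \<rho> by (simp add: t_def norm_of_real del: of_real_divide of_real_mult of_real_add)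
        have "(\<lambda>z. 0 + t k *s z) ` ball z0 1 \<subseteq> ball 0 1"
        proof clarify
          fix z assume "z \<in> ball z0 1"
          from zin[OF this] have "norm (t k *s z) \<le> 1 / (2 * \<rho> * (real k + 2)) * \<rho>"
            unfolding norm_smult_vec tk using \<rho> by (intro mult_left_mono) auto
          also have "\<dots> = 1 / (2 * (real k + 2))" using \<rho> by simp
          also have "\<dots> < 1" by simp
          finally show "0 + t k *s z \<in> ball 0 1" by simp
        qed
        from cholomorphic_on_compose[OF cholomorphic_map_affine f this]
        have "(\<lambda>z. (1 / t k ^ m) * (f (t k *s z) - (\<Sum>i<m. t k ^ i * hcomp i f z))) cholomorphic_on ball z0 1"
          by (intro cholomorphic_on_cmult cholomorphic_on_diff cholomorphic_on_sum)
             (auto intro: cholomorphic_on_subset[OF less.IH])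
        then show ?thesis by (simp add: g_def[abs_def] mult.commute)
      qed
      moreover have "uniform_limit (ball z0 1) g (hcomp m f) sequentially"
        by (rule uniform_limit_of_bound, unfold g_def, rule hcomp_quotient_bound[OF f M])
           (use zin \<rho> in \<open>auto simp: t_def\<close>)
      ultimately have "hcomp m f cholomorphic_on ball z0 (1/2)"
        by (intro cholomorphic_uniform_limit_ball) auto
      then show "\<exists>\<delta>>0. hcomp m f cholomorphic_on ball z0 \<delta>" by (intro exI[of _ "1/2"]) auto
    qed auto
  qed
  then show ?thesis using hcomp_homogeneous[OF f] by (auto simp: hpoly_def)
qed

text \<open>The derivative of \<open>G\<close> at \<open>z\<close> in direction \<open>e\<close> is
  the component of degree 1, taken at \<open>e\<close>, of the translate
  \<open>y \<mapsto> G (z + y)\<close>. The quotient estimate with \<open>m = 1\<close> therefore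
  exhibits it as a locally uniform limit of holomorphic difference quotients.\<close>

lemma partial_derivative_cholomorphic:
  fixes G :: "complex ^ 'n \<Rightarrow> complex"
  assumes G: "G cholomorphic_on UNIV"
    and D: "\<And>z. (G has_derivative D z) (at z)" "\<And>z a x. D z (a *s x) = a * D z x"
    and e: "norm e \<le> 1"
  shows "(\<lambda>z. D z e) cholomorphic_on UNIV"
proof (rule cholomorphic_on_local)
  fix z0 :: "complex ^ 'n"
  obtain M where M: "\<And>y. y \<in> cball z0 2 \<Longrightarrow> cmod (G y) \<le> M"
    using bounded_on_cball[OF G, of z0 2] by auto
  define t where "t k = complex_of_real (1 / (2 * 1 * (real k + 2)))" for k
  define g where "g k z = (G (z + t k *s e) - G z) / t k" for k z
  have map: "(\<lambda>y. z + y) cholomorphic_map_on S" for z :: "complex ^ 'n" and S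
    using cholomorphic_map_affine[of z 1 S] by simp
  have "g k cholomorphic_on ball z0 1" for k
  proof -
    have "(\<lambda>z. (1 / t k) * (G (t k *s e + z) - G z)) cholomorphic_on ball z0 1"
      by (intro cholomorphic_on_cmult cholomorphic_on_diff cholomorphic_on_compose[OF map G]
            cholomorphic_on_subset[OF G]) auto
    then show ?thesis by (simp add: g_def[abs_def] add.commute)
  qed
  moreover have "uniform_limit (ball z0 1) g (\<lambda>z. D z e) sequentially"
  proof (rule uniform_limit_of_bound)
    fix k z assume z: "z \<in> ball z0 1"
    let ?u = "\<lambda>y. G (z + y)"
    have u: "?u cholomorphic_on ball 0 1" by (rule cholomorphic_on_compose[OF map G]) auto
    have uM: "cmod (?u y) \<le> M" if "norm y \<le> 1/2" for y
    proof (rule M)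
      have "dist z0 (z + y) \<le> dist z0 z + norm y"
        using dist_triangle[of z0 "z + y" z] by (simp add: dist_norm)
      with z that show "z + y \<in> cball z0 2" by simp
    qed
    have "hcomp 1 ?u e = D z e"
    proof -
      have "((\<lambda>t. G (z + t *s e)) has_field_derivative D z e) (at 0)"
        by (rule has_field_derivative_line) (use D in auto)
      then show ?thesis by (simp add: hcomp_def DERIV_imp_deriv)
    qed
    moreover have "hcomp 0 ?u e = G z" by (simp add: hcomp_def)
    ultimately show "cmod (g k z - D z e) \<le> (M * (2 * 1) ^ 1) / (real k + 1)"
      using hcomp_quotient_bound[OF u uM e _ t_def, of k 1] by (simp add: g_def)
  qed
  ultimately have "(\<lambda>z. D z e) cholomorphic_on ball z0 (1/2)"
    by (intro cholomorphic_uniform_limit_ball) auto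
  then show "\<exists>\<delta>>0. (\<lambda>z. D z e) cholomorphic_on ball z0 \<delta>" by (intro exI[of _ "1/2"]) auto
qed auto

section \<open>Homogeneous entire functions as combinations of monomials\<close>

lemma sum_fun_apply: "(\<Sum>i\<in>A. f i) x = (\<Sum>i\<in>A. f i x)"
  for f :: "'i \<Rightarrow> 'a \<Rightarrow> 'b::comm_monoid_add"
  by (induction A rule: infinite_finite_induct) auto

definition monomials :: "nat \<Rightarrow> (complex ^ 'n \<Rightarrow> complex) set"
  where "monomials m = (\<lambda>\<alpha> z. \<Prod>j\<in>UNIV. z $ j ^ \<alpha> j) ` {\<alpha>. sum \<alpha> UNIV = m}"

lemma monomials_mult_coordinate:
  assumes "p \<in> monomials m"
  shows "(\<lambda>z. z $ j * p z) \<in> monomials (Suc m)"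
proof -
  obtain \<alpha> where \<alpha>: "sum \<alpha> UNIV = m" "p = (\<lambda>z. \<Prod>j\<in>UNIV. z $ j ^ \<alpha> j)"
    using assms by (auto simp: monomials_def)
  have "(\<lambda>z. z $ j * p z) = (\<lambda>z. \<Prod>i\<in>UNIV. z $ i ^ (\<alpha>(j := Suc (\<alpha> j))) i)"
  proof
    fix z :: "complex ^ 'a"
    have "(\<Prod>i\<in>UNIV. z $ i ^ (\<alpha>(j := Suc (\<alpha> j))) i) = z $ j ^ Suc (\<alpha> j) * (\<Prod>i\<in>UNIV - {j}. z $ i ^ \<alpha> i)"
      by (subst prod.remove[of _ j]) (auto intro!: prod.cong)
    also have "\<dots> = z $ j * p z"
      unfolding \<alpha>(2) by (subst prod.remove[of _ j]) auto
    finally show "z $ j * p z = (\<Prod>i\<in>UNIV. z $ i ^ (\<alpha>(j := Suc (\<alpha> j))) i)" by simp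
  qed
  moreover have "sum (\<alpha>(j := Suc (\<alpha> j))) UNIV = Suc m"
  proof -
    have "sum (\<alpha>(j := Suc (\<alpha> j))) UNIV = Suc (\<alpha> j) + sum \<alpha> (UNIV - {j})"
      by (subst sum.remove[of _ j]) (auto intro!: sum.cong)
    also have "\<dots> = Suc (sum \<alpha> UNIV)" by (subst (2) sum.remove[of _ j]) auto
    finally show ?thesis using \<alpha>(1) by simp
  qed
  ultimately show ?thesis unfolding monomials_def by blast
qed

text \<open>Induction on the degree by Euler's identity: \<open>of_nat (Suc m) * G z\<close> is the
  sum of \<open>z $ j\<close> times the \<open>j\<close>-th partial derivative. The partial
  derivatives are homogeneous of degree \<open>m\<close>, and multiplication by a coordinate maps
  monomials to monomials of the next degree.\<close>

lemma hpoly_subset_span_monomials: "(hpoly m :: (complex ^ 'n \<Rightarrow> complex) set) \<subseteq> cfun_span (monomials m)"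
proof (induction m)
  case 0
  show ?case
  proof
    fix G :: "complex ^ 'n \<Rightarrow> complex" assume "G \<in> hpoly 0"
    then have "G (0 *s z) = 0 ^ 0 * G z" for z unfolding hpoly_def by blast
    then have "G = (\<lambda>z. G 0 * (\<Prod>j\<in>UNIV. z $ j ^ (\<lambda>_. 0) j))"
      by (intro ext) (simp, metis)
    moreover have "(\<lambda>z :: complex ^ 'n. \<Prod>j\<in>UNIV. z $ j ^ (\<lambda>_. 0) j) \<in> monomials 0"
      unfolding monomials_def by force
    ultimately show "G \<in> cfun_span (monomials 0)" by (metis cfun.span_base cfun.span_scale)
  qed
next
  case (Suc m)
  show ?case
  proof
    fix G :: "complex ^ 'n \<Rightarrow> complex" assume "G \<in> hpoly (Suc m)"
    then have G: "G cholomorphic_on UNIV" and hom: "\<And>a z. G (a *s z) = a ^ Suc m * G z"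
      by (auto simp: hpoly_def)
    have "\<forall>z. \<exists>D. (G has_derivative D) (at z) \<and> (\<forall>a x. D (a *s x) = a * D x)"
      using G by (auto simp: cholomorphic_on_open_iff)
    then obtain D where D: "\<And>z. (G has_derivative D z) (at z)" "\<And>z a x. D z (a *s x) = a * D z x"
      by metis
    have partial: "(\<lambda>z. D z e) \<in> hpoly m" if e: "norm e \<le> 1" for e
    proof -
      have hol: "(\<lambda>z. D z e) cholomorphic_on UNIV" using partial_derivative_cholomorphic[OF G D e] .
      \<comment> \<open>The map \<open>z \<mapsto> G (a *s z)\<close> is differentiated by the chain
        rule and by homogeneity; comparison leaves one factor \<open>a\<close> to cancel.\<close>
      have nz: "D (a *s z) e = a ^ m * D z e" if "a \<noteq> 0" for a z
      proof -
        have "((\<lambda>z. G (a *s z)) has_derivative (\<lambda>h. D (a *s z) (a *s h))) (at z)"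
          using has_derivative_compose[OF bounded_linear_imp_has_derivative[OF bounded_linear_smult_right[of a]] D(1)] .
        moreover have "((\<lambda>z. G (a *s z)) has_derivative (\<lambda>h. a ^ Suc m * D z h)) (at z)"
          unfolding hom by (intro has_derivative_mult_right D)
        ultimately have "(\<lambda>h. D (a *s z) (a *s h)) = (\<lambda>h. a ^ Suc m * D z h)"
          by (rule has_derivative_unique)
        from fun_cong[OF this, of e] have "a * D (a *s z) e = a * (a ^ m * D z e)"
          by (simp add: D(2))
        with that show ?thesis by simp
      qed
      \<comment> \<open>At \<open>a = 0\<close> the cancellation is impossible, so the identity is
        obtained by continuity from nonzero scalars.\<close>
      have "D (0 *s z) e = 0 ^ m * D z e" for z
      proof -
        have "continuous_on UNIV (\<lambda>a. D (a *s z) e)"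
          by (rule continuous_on_compose2[OF cholomorphic_on_imp_continuous_on[OF hol], of UNIV "\<lambda>a. a *s z"])
             (auto intro!: continuous_intros)
        then have "((\<lambda>a. D (a *s z) e) \<longlongrightarrow> D (0 *s z) e) (at 0)"
          by (simp only: continuous_on_eq_continuous_at[OF open_UNIV] isCont_def ball_UNIV)
        moreover have "((\<lambda>a. a ^ m * D z e) \<longlongrightarrow> 0 ^ m * D z e) (at 0)" by (intro tendsto_intros)
        then have "((\<lambda>a. D (a *s z) e) \<longlongrightarrow> 0 ^ m * D z e) (at 0)"
          by (rule Lim_transform_eventually) (auto simp: eventually_at_filter nz)
        ultimately show ?thesis using tendsto_unique[OF trivial_limit_at] by blast
      qed
      with nz have "D (a *s z) e = a ^ m * D z e" for a z by (cases "a = 0") auto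
      with hol show ?thesis by (simp add: hpoly_def)
    qed
    \<comment> \<open>Euler's identity: the derivative at 1 of \<open>t \<mapsto> G (t *s z)\<close>
      is computed by the chain rule and by homogeneity.\<close>
    have euler: "G z = (1 / of_nat (Suc m)) * (\<Sum>j\<in>UNIV. z $ j * D z (axis j 1))" for z
    proof -
      have "((\<lambda>t. G (0 + t *s z)) has_field_derivative D z z) (at 1)"
        by (rule has_field_derivative_line) (use D in auto)
      moreover have "((\<lambda>t. G (0 + t *s z)) has_field_derivative (of_nat (Suc m) * G z)) (at 1)"
        unfolding add_0_left hom by (auto intro!: derivative_eq_intros)
      ultimately have "D z z = of_nat (Suc m) * G z" by (rule DERIV_unique)
      moreover have "D z z = (\<Sum>j\<in>UNIV. z $ j * D z (axis j 1))"
      proof -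
        have "z = (\<Sum>j\<in>UNIV. z $ j *s axis j 1)" by (simp add: basis_expansion)
        then have "D z z = D z (\<Sum>j\<in>UNIV. z $ j *s axis j 1)" by simp
        also have "\<dots> = (\<Sum>j\<in>UNIV. D z (z $ j *s axis j 1))"
          using has_derivative_linear[OF D(1)] by (rule linear_sum)
        finally show ?thesis by (simp add: D(2))
      qed
      ultimately show ?thesis by (simp del: of_nat_Suc)
    qed
    have mem: "(\<lambda>z. z $ j * g z) \<in> cfun_span (monomials (Suc m))"
      if "g \<in> cfun_span (monomials m)" for j and g :: "complex ^ 'n \<Rightarrow> complex"
      using that
    proof (induction rule: cfun.span_induct)
      case base
      have "(\<lambda>z :: complex ^ 'n. 0 :: complex) \<in> cfun_span (monomials (Suc m))"
        using cfun.span_zero by (simp add: zero_fun_def)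
      then show ?case
        unfolding cfun.subspace_def
        using cfun.span_add[of _ "monomials (Suc m) :: (complex ^ 'n \<Rightarrow> complex) set"]
          cfun.span_scale[of _ "monomials (Suc m) :: (complex ^ 'n \<Rightarrow> complex) set"]
        by (auto simp: plus_fun_def zero_fun_def algebra_simps)
    next
      case (step p)
      then show ?case by (intro cfun.span_base monomials_mult_coordinate)
    qed
    have "(\<Sum>j\<in>UNIV. (\<lambda>z. z $ j * D z (axis j 1))) \<in> cfun_span (monomials (Suc m))"
    proof (intro cfun.span_sum mem)
      fix j :: 'n
      have "(\<lambda>z. D z (axis j 1)) \<in> hpoly m" by (rule partial) (auto intro!: eq_refl[OF norm_Basis] simp: Basis_vec_def Basis_complex_def)
      then show "(\<lambda>z. D z (axis j 1)) \<in> cfun_span (monomials m)" using Suc.IH by blast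
    qed
    from cfun.span_scale[OF this, of "1 / of_nat (Suc m)"]
    have "(\<lambda>z. (1 / of_nat (Suc m)) * (\<Sum>j\<in>UNIV. z $ j * D z (axis j 1))) \<in> cfun_span (monomials (Suc m))"
      by (simp add: sum_fun_apply del: of_nat_Suc)
    then show "G \<in> cfun_span (monomials (Suc m))" using euler by presburger
  qed
qed

lemma
  shows finite_monomials: "finite (monomials m :: (complex ^ 'n \<Rightarrow> complex) set)"
    and card_monomials: "card (monomials m :: (complex ^ 'n \<Rightarrow> complex) set) \<le> (m + CARD('n) - 1) choose m"
proof -
  obtain e where e: "bij_betw e {..<CARD('n)} (UNIV :: 'n set)"
    using ex_bij_betw_nat_finite[of "UNIV :: 'n set"] by (auto simp: lessThan_atLeast0)
  let ?A = "{\<alpha> :: 'n \<Rightarrow> nat. sum \<alpha> UNIV = m}"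
  let ?B = "{l :: nat list. size l = CARD('n) \<and> sum_list l = m}"
  \<comment> \<open>Stars and bars: an exponent is read as the list of its values along an
    enumeration of the coordinates.\<close>
  let ?g = "\<lambda>\<alpha>. map (\<lambda>i. \<alpha> (e i)) [0..<CARD('n)]"
  have cardB: "card ?B = (m + CARD('n) - 1) choose m" by (rule card_length_sum_list)
  have "(m + CARD('n) - 1) choose m > 0" 
  proof -
    have "CARD('n) > 0" by (rule zero_less_card_finite)
    then show ?thesis by (intro zero_less_binomial) linarith
  qed
  then have finB: "finite ?B" using cardB card_ge_0_finite by metis
  have "inj_on ?g ?A"
  proof (rule inj_onI)
    fix \<alpha> \<beta> assume "?g \<alpha> = ?g \<beta>"
    then have *: "\<And>i. i < CARD('n) \<Longrightarrow> \<alpha> (e i) = \<beta> (e i)" by simp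
    show "\<alpha> = \<beta>"
    proof
      fix j :: 'n
      obtain i where "i < CARD('n)" "j = e i" using e unfolding bij_betw_def by blast
      then show "\<alpha> j = \<beta> j" using * by simp
    qed
  qed
  moreover have "?g ` ?A \<subseteq> ?B"
  proof clarify
    fix \<alpha> :: "'n \<Rightarrow> nat"
    have "sum_list (?g \<alpha>) = (\<Sum>i<CARD('n). \<alpha> (e i))"
      by (simp add: interv_sum_list_conv_sum_set_nat lessThan_atLeast0)
    also have "\<dots> = sum \<alpha> UNIV" using sum.reindex_bij_betw[OF e] .
    finally show "size (?g \<alpha>) = CARD('n) \<and> sum_list (?g \<alpha>) = sum \<alpha> UNIV" by simp
  qed
  ultimately have "finite ?A" "card ?A \<le> card ?B"
    using finB by (auto intro: inj_on_finite card_inj_on_le)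
  then show "finite (monomials m :: (complex ^ 'n \<Rightarrow> complex) set)"
    "card (monomials m :: (complex ^ 'n \<Rightarrow> complex) set) \<le> (m + CARD('n) - 1) choose m"
    unfolding monomials_def cardB[symmetric] using card_image_le[of ?A] by (blast, force intro: order_trans)
qed

subsection \<open>Unitary invariance of Lebesgue measure\<close>

text \<open>
  Translation invariance determines Lebesgue measure: by Tonelli, the double integral of
  \<open>indicator A (U x) * indicator (ball 0 1) (U x + y)\<close> can be evaluated as
  \<open>\<lambda> (U -` A) * \<lambda> (ball 0 1)\<close> and, after translating \<open>x\<close>, as \<open>\<lambda> A * \<lambda> (ball 0 1)\<close>.
\<close>

lemma emeasure_lborel_isometry:
  fixes U :: "'a::euclidean_space \<Rightarrow> 'a"
  assumes U: "linear U" and iso: "\<And>x. norm (U x) = norm x" and A: "A \<in> sets borel"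
  shows "emeasure lborel (U -` A) = emeasure lborel A"
proof -
  define C where "C = ball (0::'a) 1"
  have [measurable]: "C \<in> sets borel" by (simp add: C_def)
  have trans: "(\<integral>\<^sup>+y. g (a + y) \<partial>lborel) = (\<integral>\<^sup>+y. g y \<partial>lborel)"
    if [measurable]: "g \<in> borel_measurable borel" for g :: "'a \<Rightarrow> ennreal" and a
  proof -
    have "(\<integral>\<^sup>+y. g y \<partial>distr lborel borel ((+) a)) = (\<integral>\<^sup>+y. g (a + y) \<partial>lborel)"
      by (rule nn_integral_distr) auto
    then show ?thesis by (simp add: lborel_distr_plus)
  qed
  have refl: "(\<integral>\<^sup>+y. g (a - y) \<partial>lborel) = (\<integral>\<^sup>+y. g y \<partial>lborel)"
    if [measurable]: "g \<in> borel_measurable borel" for g :: "'a \<Rightarrow> ennreal" and a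
  proof -
    have "(lborel :: 'a measure) = distr lborel borel (\<lambda>x. a - x)"
      using lborel_affine[of "-1 :: real" a] by (simp add: density_1)
    then have "(\<integral>\<^sup>+y. g y \<partial>lborel) = (\<integral>\<^sup>+y. g y \<partial>distr lborel borel (\<lambda>x. a - x))" by simp
    also have "\<dots> = (\<integral>\<^sup>+y. g (a - y) \<partial>lborel)" by (rule nn_integral_distr) auto
    finally show ?thesis by simp
  qed
  have "inj U" using U iso by (auto simp: linear_injective_0) (metis norm_eq_zero)
  then obtain V where V: "linear V" "U \<circ> V = id"
    using linear_injective_imp_surjective[OF U] linear_surjective_right_inverse[OF U] by blast
  then have UV: "U (V y) = y" for y by (simp add: fun_eq_iff)
  have [measurable]: "U \<in> borel_measurable borel" using U by (intro borel_measurable_continuous_onI linear_continuous_on linear_conv_bounded_linear[THEN iffD1])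
  have [measurable]: "V \<in> borel_measurable borel" using V(1) by (intro borel_measurable_continuous_onI linear_continuous_on linear_conv_bounded_linear[THEN iffD1])
  have [measurable]: "A \<in> sets borel" by (rule A)
  have mC: "(indicator C :: 'a \<Rightarrow> ennreal) \<in> borel_measurable borel"
    by (rule borel_measurable_indicator) simp
  have indC: "indicator C (U x) = (indicator C x :: ennreal)" for x
    by (auto simp: indicator_def iso C_def)
  have "emeasure lborel (U -` A) * emeasure lborel C = (\<integral>\<^sup>+x. indicator A (U x) * emeasure lborel C \<partial>lborel)"
  proof -
    have "(\<integral>\<^sup>+x. indicator A (U x) \<partial>lborel) = (\<integral>\<^sup>+x. indicator (U -` A) x \<partial>lborel)"
      by (intro nn_integral_cong) (auto simp: indicator_def)
    also have "\<dots> = emeasure lborel (U -` A)"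
      by (rule nn_integral_indicator) (use measurable_sets[of U borel borel A] in \<open>auto simp: A\<close>)
    finally show ?thesis by (subst nn_integral_multc) auto
  qed
  also have "\<dots> = (\<integral>\<^sup>+x. \<integral>\<^sup>+y. indicator A (U x) * indicator C (U x + y) \<partial>lborel \<partial>lborel)"
  proof (rule nn_integral_cong)
    fix x
    have "(\<integral>\<^sup>+y. indicator A (U x) * indicator C (U x + y) \<partial>lborel)
      = indicator A (U x) * (\<integral>\<^sup>+y. indicator C (U x + y) \<partial>lborel)"
      by (rule nn_integral_cmult) (rule measurable_compose[OF _ mC], simp)
    also have "(\<integral>\<^sup>+y. indicator C (U x + y) \<partial>lborel) = (\<integral>\<^sup>+y. indicator C y \<partial>lborel)"
      by (rule trans[OF mC])
    finally show "indicator A (U x) * emeasure lborel C =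
      (\<integral>\<^sup>+y. indicator A (U x) * indicator C (U x + y) \<partial>lborel)" by simp
  qed
  also have "\<dots> = (\<integral>\<^sup>+y. \<integral>\<^sup>+x. indicator A (U x) * indicator C (U x + y) \<partial>lborel \<partial>lborel)"
    by (rule lborel_pair.Fubini'[symmetric]) measurable
  also have "\<dots> = (\<integral>\<^sup>+y. \<integral>\<^sup>+x. indicator A (U x - y) * indicator C (U x) \<partial>lborel \<partial>lborel)"
  proof (rule nn_integral_cong)
    fix y
    have "(\<integral>\<^sup>+x. indicator A (U x) * indicator C (U x + y) \<partial>lborel)
       = (\<integral>\<^sup>+x. indicator A (U (- V y + x)) * indicator C (U (- V y + x) + y) \<partial>lborel)"
      by (rule trans[symmetric]) measurable
    also have "\<dots> = (\<integral>\<^sup>+x. indicator A (U x - y) * indicator C (U x) \<partial>lborel)"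
      using U by (simp add: linear_add linear_neg UV linear_diff algebra_simps)
    finally show "(\<integral>\<^sup>+x. indicator A (U x) * indicator C (U x + y) \<partial>lborel) =
      (\<integral>\<^sup>+x. indicator A (U x - y) * indicator C (U x) \<partial>lborel)" .
  qed
  also have "\<dots> = (\<integral>\<^sup>+x. \<integral>\<^sup>+y. indicator A (U x - y) * indicator C (U x) \<partial>lborel \<partial>lborel)"
    by (rule lborel_pair.Fubini') measurable
  also have "\<dots> = (\<integral>\<^sup>+x. emeasure lborel A * indicator C x \<partial>lborel)"
    by (intro nn_integral_cong, subst nn_integral_multc) (auto simp: refl[of "indicator A"] indC)
  also have "\<dots> = emeasure lborel A * emeasure lborel C"
    by (subst nn_integral_cmult) auto
  finally have "emeasure lborel C * emeasure lborel (U -` A) = emeasure lborel C * emeasure lborel A"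
    by (simp only: mult.commute)
  moreover have "emeasure lborel C \<noteq> 0" using content_ball_pos[of 1 "0::'a"] by (auto simp: measure_def C_def)
  moreover have "emeasure lborel C \<noteq> \<infinity>" using emeasure_lborel_ball_finite[of "0::'a" 1] by (simp add: C_def)
  ultimately show ?thesis by (simp add: ennreal_mult_cancel_left)
qed

text \<open>Integrals over the unit sphere are written as integrals of \<open>\<phi> (sgn x)\<close>
  against this probability measure, in accordance with the description of
  \<open>sphere_measure\<close> by cones. The spherical measure then inherits unitary invariance
  from Lebesgue measure.\<close>

definition unit_ball_measure :: "(complex ^ 'n) measure"
  where "unit_ball_measure = uniform_measure lborel (ball 0 1)"

lemma sets_unit_ball_measure [simp, measurable_cong]: "sets unit_ball_measure = sets borel"
  and space_unit_ball_measure [simp]: "space unit_ball_measure = UNIV"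
  by (simp_all add: unit_ball_measure_def)

lemma unit_ball_content:
  "emeasure lborel (ball (0 :: complex ^ 'n) 1) \<noteq> 0" "emeasure lborel (ball (0 :: complex ^ 'n) 1) \<noteq> \<infinity>"
  using content_ball_pos[of 1 "0 :: complex ^ 'n"] emeasure_lborel_ball_finite[of "0 :: complex ^ 'n" 1]
  by (auto simp: measure_def)

lemma emeasure_unit_ball_measure_UNIV: "emeasure (unit_ball_measure :: (complex ^ 'n) measure) UNIV = 1"
  unfolding unit_ball_measure_def using unit_ball_content[where 'n = 'n]
  by (subst emeasure_uniform_measure) (auto simp: ennreal_divide_self less_top[symmetric])

interpretation unit_ball: finite_measure "unit_ball_measure :: (complex ^ 'n) measure"
  by (rule finite_measureI) (simp add: emeasure_unit_ball_measure_UNIV)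

lemma measure_unit_ball_measure_UNIV [simp]: "measure (unit_ball_measure :: (complex ^ 'n) measure) UNIV = 1"
  by (simp add: measure_def emeasure_unit_ball_measure_UNIV)

lemma AE_unit_ball_nonzero: "AE x in (unit_ball_measure :: (complex ^ 'n) measure). x \<noteq> 0"
  unfolding unit_ball_measure_def
  by (rule AE_uniform_measureI) (auto intro: AE_mp[OF AE_lborel_singleton[of 0]])

lemma distr_unit_ball_measure_isometry:
  fixes U :: "complex ^ 'n \<Rightarrow> complex ^ 'n"
  assumes U: "linear U" and iso: "\<And>x. norm (U x) = norm x"
  shows "distr unit_ball_measure borel U = unit_ball_measure"
proof (rule measure_eqI)
  have Um: "U \<in> borel_measurable borel"
    using U by (intro borel_measurable_continuous_onI linear_continuous_on linear_conv_bounded_linear[THEN iffD1])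
  then have Um': "U \<in> measurable unit_ball_measure borel"
    by (simp cong: measurable_cong_sets)
  show "sets (distr unit_ball_measure borel U) = sets (unit_ball_measure :: (complex ^ 'n) measure)" by simp
  fix A assume "A \<in> sets (distr (unit_ball_measure :: (complex ^ 'n) measure) borel U)"
  then have A: "A \<in> sets borel" by simp
  have UA: "U -` A \<in> sets borel" using measurable_sets[OF Um A] by simp
  have "ball 0 1 \<inter> U -` A = U -` (ball 0 1 \<inter> A)" by (auto simp: iso)
  then have "emeasure lborel (ball 0 1 \<inter> U -` A) = emeasure lborel (ball 0 1 \<inter> A)"
    using emeasure_lborel_isometry[OF U iso, of "ball 0 1 \<inter> A"] A by auto
  then show "emeasure (distr unit_ball_measure borel U) A = emeasure unit_ball_measure A"
    using A UA Um' by (simp add: emeasure_distr) (simp add: unit_ball_measure_def)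
qed

text \<open>A norm-preserving linear map commutes with \<open>sgn\<close>, so invariance of the
  measure on the ball passes to spherical integrals.\<close>

lemma integral_sgn_isometry:
  fixes \<phi> :: "complex ^ 'n \<Rightarrow> 'b::{banach, second_countable_topology}"
    and U :: "complex ^ 'n \<Rightarrow> complex ^ 'n"
  assumes U: "linear U" and iso: "\<And>x. norm (U x) = norm x"
    and meas: "(\<lambda>x. \<phi> (sgn x)) \<in> borel_measurable borel"
  shows "(LINT x|unit_ball_measure. \<phi> (U (sgn x))) = (LINT x|unit_ball_measure. \<phi> (sgn x))"
proof -
  have Um: "U \<in> measurable unit_ball_measure borel"
    using U by (intro borel_measurable_continuous_onI linear_continuous_on linear_conv_bounded_linear[THEN iffD1]
      measurable_cong_sets[OF sets_unit_ball_measure refl, THEN equalityD2, THEN subsetD])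
  have "(LINT x|unit_ball_measure. \<phi> (sgn x)) = (LINT x|distr unit_ball_measure borel U. \<phi> (sgn x))"
    by (simp add: distr_unit_ball_measure_isometry[OF U iso])
  also have "\<dots> = (LINT x|unit_ball_measure. \<phi> (sgn (U x)))"
    by (rule integral_distr[OF Um meas])
  also have "\<dots> = (LINT x|unit_ball_measure. \<phi> (U (sgn x)))"
    unfolding sgn_div_norm iso by (simp add: linear_scale[OF U])
  finally show ?thesis by (rule sym)
qed

section \<open>The Hermitian product and unitary maps between vectors of equal norm\<close>

definition herm :: "complex ^ 'n \<Rightarrow> complex ^ 'n \<Rightarrow> complex"
  where "herm x y = (\<Sum>i\<in>UNIV. x $ i * cnj (y $ i))"

lemma herm_add_left: "herm (x + y) z = herm x z + herm y z"
  and herm_diff_left: "herm (x - y) z = herm x z - herm y z"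
  and herm_diff_right: "herm z (x - y) = herm z x - herm z y"
  and herm_smult_left: "herm (a *s x) z = a * herm x z"
  and herm_smult_right: "herm z (a *s x) = cnj a * herm z x"
  and cnj_herm: "cnj (herm x y) = herm y x"
  by (simp_all add: herm_def algebra_simps sum.distrib sum_subtractf sum_distrib_left)

lemma herm_self: "herm x x = complex_of_real ((norm x)\<^sup>2)"
proof -
  have "(norm x)\<^sup>2 = (\<Sum>i\<in>UNIV. (cmod (x $ i))\<^sup>2)"
    by (simp add: norm_vec_def L2_set_def sum_nonneg)
  then show ?thesis by (simp add: herm_def complex_norm_square del: of_real_power)
qed

lemma linear_smult_vec: "linear (\<lambda>v :: complex ^ 'n. a *s v)"
  using bounded_linear_smult_right bounded_linear.linear by blast

text \<open>The complex Householder reflection in \<open>v = z - w\<close>. It fixes the orthogonal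
  complement of \<open>v\<close> and sends \<open>z\<close> to \<open>w\<close> precisely because
  \<open>herm z w\<close> is real: only then \<open>herm v v = 2 * herm z v\<close>, so that the
  coefficient \<open>b z\<close> is 1.\<close>

lemma complex_reflection:
  fixes z w :: "complex ^ 'n"
  assumes eq: "norm z = norm w" and real: "herm z w \<in> \<real>"
  obtains H where "linear H" "\<And>a x. H (a *s x) = a *s H x" "\<And>x. norm (H x) = norm x" "H z = w"
proof (cases "z = w")
  case True
  then show ?thesis using that[of "\<lambda>x. x"] by (simp add: linear_ident)
next
  case False
  define v where "v = z - w"
  define b where "b x = 2 * herm x v / herm v v" for x
  define H where "H x = x - b x *s v" for x
  have hv: "herm v v \<noteq> 0" using False by (simp add: herm_self v_def)
  have b_add: "b (x + y) = b x + b y" and b_smult: "b (a *s x) = a * b x" for a x y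
    by (simp_all add: b_def herm_add_left herm_smult_left add_divide_distrib algebra_simps)
  show ?thesis
  proof
    show "linear H"
    proof (rule linearI)
      show "H (x + y) = H x + H y" for x y
        by (simp add: H_def b_add vector_sadd_rdistrib)
      show "H (r *\<^sub>R x) = r *\<^sub>R H x" for r x
        unfolding smult_of_real_vec[symmetric] H_def b_smult
        by (simp add: vector_ssub_ldistrib vector_smult_assoc)
    qed
    show "H (a *s x) = a *s H x" for a x
      unfolding H_def b_smult by (simp add: vector_ssub_ldistrib vector_smult_assoc)
    show "norm (H x) = norm x" for x
    proof -
      have "herm (H x) (H x) = herm x x - cnj (b x) * herm x v - b x * herm v x + b x * cnj (b x) * herm v v"
        by (simp add: H_def herm_diff_left herm_diff_right herm_smult_left herm_smult_right algebra_simps)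
      also have "cnj (b x) * herm v v = 2 * herm v x" using hv
        by (simp add: b_def cnj_herm)
      then have "b x * cnj (b x) * herm v v = 2 * b x * herm v x" by (simp add: mult.assoc)
      also have "b x * herm v x = cnj (b x) * herm x v"
        by (simp add: b_def cnj_herm)
      then have "herm x x - cnj (b x) * herm x v - b x * herm v x + 2 * b x * herm v x = herm x x"
        by (simp add: algebra_simps)
      finally have "complex_of_real ((norm (H x))\<^sup>2) = complex_of_real ((norm x)\<^sup>2)" by (simp only: herm_self)
      then show ?thesis by (simp only: of_real_eq_iff) (simp add: power2_eq_iff_nonneg)
    qed
    have sym: "herm w z = herm z w" using real cnj_herm[of z w] by (simp add: Reals_cnj_iff)
    have "herm v v = 2 * herm z v"
      unfolding v_def herm_diff_left herm_diff_right sym by (simp add: herm_self eq)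
    then have "b z = 1" using hv by (simp add: b_def)
    then show "H z = w" by (simp add: H_def v_def)
  qed
qed

text \<open>A scalar of modulus 1 rotates \<open>z\<close> until its Hermitian product with
  \<open>w\<close> is real; a reflection does the rest.\<close>

lemma unitary_transitive:
  fixes z w :: "complex ^ 'n"
  assumes eq: "norm z = norm w"
  obtains U where "linear U" "\<And>a x. U (a *s x) = a *s U x" "\<And>x. norm (U x) = norm x" "U z = w"
proof -
  obtain a where a: "cmod a = 1" "a * herm z w \<in> \<real>"
  proof (cases "herm z w = 0")
    case True
    then show ?thesis using that[of 1] by simp
  next
    case False
    have "cnj (sgn (herm z w)) * herm z w = of_real (cmod (herm z w))"
      using False by (simp add: sgn_eq complex_norm_square[symmetric] field_simps power2_eq_square mult.commute)
    then show ?thesis using that[of "cnj (sgn (herm z w))"] False by (simp add: norm_sgn)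
  qed
  have "norm (a *s z) = norm w" "herm (a *s z) w \<in> \<real>"
    using a eq by (simp_all add: norm_smult_vec herm_smult_left)
  from complex_reflection[OF this]
  obtain H where H: "linear H" "\<And>a x. H (a *s x) = a *s H x" "\<And>x. norm (H x) = norm x" "H (a *s z) = w"
    by blast
  show ?thesis
  proof
    show "linear (\<lambda>x. H (a *s x))"
      using linear_compose[OF linear_smult_vec H(1)] by (simp add: o_def)
  qed (use H a in \<open>simp_all add: norm_smult_vec vector_smult_assoc mult.commute\<close>)
qed

subsection \<open>The inner product on the sphere and the reproducing kernel\<close>

definition sphere_inner :: "(complex ^ 'n \<Rightarrow> complex) \<Rightarrow> (complex ^ 'n \<Rightarrow> complex) \<Rightarrow> complex"
  where "sphere_inner \<phi> \<psi> = (LINT x|unit_ball_measure. \<phi> (sgn x) * cnj (\<psi> (sgn x)))"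

definition sphere_norm2 :: "(complex ^ 'n \<Rightarrow> complex) \<Rightarrow> real"
  where "sphere_norm2 \<phi> = (LINT x|unit_ball_measure. (cmod (\<phi> (sgn x)))\<^sup>2)"

lemma measurable_sgn_unit [measurable]: "sgn \<in> measurable unit_ball_measure (borel :: (complex ^ 'n) measure)"
  using borel_measurable_sgn by (simp cong: measurable_cong_sets)

text \<open>Since \<open>sgn 0 = 0\<close>, the values of \<open>sgn\<close> lie in the closed ball
  but not all on the sphere; cutting \<open>\<phi>\<close> off outside the closed ball makes it
  Borel without changing the composite.\<close>

lemma borel_measurable_sgn_continuous:
  fixes \<phi> :: "complex ^ 'n \<Rightarrow> 'b::{banach, second_countable_topology}"
  assumes "continuous_on (cball 0 1) \<phi>"
  shows "(\<lambda>x. \<phi> (sgn x)) \<in> borel_measurable borel"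
proof -
  have "(\<lambda>x. if x \<in> cball 0 1 then \<phi> x else 0) \<in> borel_measurable borel"
    by (rule borel_measurable_continuous_on_if) (use assms in auto)
  from measurable_compose[OF borel_measurable_sgn this]
  show ?thesis by (rule measurable_cong[THEN iffD1, rotated]) (simp add: norm_sgn)
qed

lemma integrable_sgn_continuous:
  fixes \<phi> :: "complex ^ 'n \<Rightarrow> 'b::{banach, second_countable_topology}"
  assumes "continuous_on (cball 0 1) \<phi>"
  shows "integrable unit_ball_measure (\<lambda>x. \<phi> (sgn x))"
proof -
  have "bounded (\<phi> ` cball 0 1)"
    by (intro compact_imp_bounded compact_continuous_image assms compact_cball)
  then obtain B where B: "\<And>x. x \<in> cball 0 1 \<Longrightarrow> norm (\<phi> x) \<le> B" unfolding bounded_iff by blast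
  show ?thesis
  proof (rule unit_ball.integrable_const_bound[where B = B])
    show "AE x in unit_ball_measure. norm (\<phi> (sgn x)) \<le> B" by (auto intro!: AE_I2 B simp: norm_sgn)
    show "(\<lambda>x. \<phi> (sgn x)) \<in> borel_measurable unit_ball_measure"
      using borel_measurable_sgn_continuous[OF assms] by (simp cong: measurable_cong_sets)
  qed
qed

lemma sphere_inner_add_left:
  assumes "continuous_on (cball 0 1) f" "continuous_on (cball 0 1) g" "continuous_on (cball 0 1) h"
  shows "sphere_inner (\<lambda>x. a * f x + b * g x) h = a * sphere_inner f h + b * sphere_inner g h"
proof -
  have "integrable unit_ball_measure (\<lambda>x. f (sgn x) * cnj (h (sgn x)))"
    "integrable unit_ball_measure (\<lambda>x. g (sgn x) * cnj (h (sgn x)))"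
    by (intro integrable_sgn_continuous[of "\<lambda>x. f x * cnj (h x)"] integrable_sgn_continuous[of "\<lambda>x. g x * cnj (h x)"]
      continuous_intros assms)+
  then show ?thesis
    unfolding sphere_inner_def by (simp add: algebra_simps)
qed

lemma cnj_sphere_inner: "cnj (sphere_inner f g) = sphere_inner g f"
proof -
  have "cnj (sphere_inner f g) = (LINT x|unit_ball_measure. cnj (f (sgn x) * cnj (g (sgn x))))"
    unfolding sphere_inner_def by (rule Bochner_Integration.integral_cnj[symmetric])
  then show ?thesis by (simp add: sphere_inner_def mult.commute)
qed

lemma sphere_inner_self: "sphere_inner f f = of_real (sphere_norm2 f)"
  unfolding sphere_inner_def sphere_norm2_def
  by (simp add: complex_norm_square[symmetric] integral_complex_of_real[symmetric] del: of_real_power integral_complex_of_real)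

lemma sphere_norm2_nonneg: "sphere_norm2 f \<ge> 0"
  by (simp add: sphere_norm2_def)

lemma sphere_inner_sum_left:
  assumes "finite A" "\<And>j. j \<in> A \<Longrightarrow> continuous_on (cball 0 1) (f j)" "continuous_on (cball 0 1) h"
  shows "sphere_inner (\<lambda>x. \<Sum>j\<in>A. a j * f j x) h = (\<Sum>j\<in>A. a j * sphere_inner (f j) h)"
  using assms
proof (induction A rule: finite_induct)
  case empty
  then show ?case by (simp add: sphere_inner_def)
next
  case (insert j A)
  have "sphere_inner (\<lambda>x. a j * f j x + 1 * (\<Sum>j\<in>A. a j * f j x)) h =
      a j * sphere_inner (f j) h + 1 * sphere_inner (\<lambda>x. \<Sum>j\<in>A. a j * f j x) h"
    using insert.prems by (intro sphere_inner_add_left continuous_intros) auto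
  with insert show ?case by simp
qed

lemma sphere_inner_sum_right:
  assumes "finite A" "\<And>j. j \<in> A \<Longrightarrow> continuous_on (cball 0 1) (f j)" "continuous_on (cball 0 1) h"
  shows "sphere_inner h (\<lambda>x. \<Sum>j\<in>A. a j * f j x) = (\<Sum>j\<in>A. cnj (a j) * sphere_inner h (f j))"
  using arg_cong[OF sphere_inner_sum_left[where a = a, OF assms], where f = cnj] by (simp add: cnj_sphere_inner)

text \<open>If \<open>\<phi>\<close> did not vanish at \<open>z\<close>, the cone over a
  neighbourhood of \<open>z\<close> would contain a nonempty open part of the ball on which the
  integrand is nonzero, and such a set has positive measure.\<close>

lemma sphere_norm2_definite:
  fixes \<phi> :: "complex ^ 'n \<Rightarrow> complex"
  assumes c: "continuous_on (cball 0 1) \<phi>" and 0: "sphere_norm2 \<phi> = 0" and z: "norm z = 1"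
  shows "\<phi> z = 0"
proof (rule ccontr)
  assume nz: "\<phi> z \<noteq> 0"
  have "integrable unit_ball_measure (\<lambda>x. (cmod (\<phi> (sgn x)))\<^sup>2)"
    by (rule integrable_sgn_continuous[of "\<lambda>x. (cmod (\<phi> x))\<^sup>2"]) (intro continuous_intros c)
  with 0 have ae: "AE x in unit_ball_measure. \<phi> (sgn x) = 0"
    unfolding sphere_norm2_def by (subst (asm) integral_nonneg_eq_0_iff_AE) auto
  define Q where "Q = {x \<in> ball 0 1 - {0}. \<phi> (sgn x) \<noteq> 0}"
  have cont: "continuous_on (ball 0 1 - {0}) (\<lambda>x. \<phi> (sgn x))"
    by (rule continuous_on_compose2[OF c]) (auto intro!: continuous_on_sgn continuous_intros simp: norm_sgn split: if_splits)
  have "Q = (ball 0 1 - {0}) \<inter> (\<lambda>x. \<phi> (sgn x)) -` (- {0})" by (auto simp: Q_def)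
  then have "open Q" using continuous_open_preimage[OF cont, of "- {0}"] by auto
  \<comment> \<open>The point \<open>z\<close> itself lies on the boundary of the ball; half of it
    has the same direction and lies inside.\<close>
  moreover have "(1/2) *\<^sub>R z \<in> Q" using nz z by (auto simp: Q_def sgn_scaleR sgn_div_norm)
  ultimately have "\<not> negligible Q" using open_not_negligible by blast
  moreover have "negligible Q"
  proof -
    have bO: "Q \<in> sets borel" using \<open>open Q\<close> by simp
    have "AE x in unit_ball_measure. x \<notin> Q" using ae by eventually_elim (simp add: Q_def)
    then have "emeasure unit_ball_measure Q = 0"
      using AE_iff_null_sets[of Q unit_ball_measure] bO by (simp add: null_sets_def)
    moreover have "emeasure unit_ball_measure Q = emeasure lborel (ball 0 1 \<inter> Q) / emeasure lborel (ball (0 :: complex ^ 'n) 1)"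
      unfolding unit_ball_measure_def using bO by (intro emeasure_uniform_measure) auto
    ultimately have "emeasure lborel (ball 0 1 \<inter> Q) = 0"
      using unit_ball_content[where 'n = 'n] by (simp add: ennreal_divide_eq_0_iff)
    moreover have "ball 0 1 \<inter> Q = Q" by (auto simp: Q_def)
    ultimately have "Q \<in> null_sets lborel" using bO by (simp add: null_sets_def)
    then show ?thesis by (simp add: negligible_iff_null_sets null_sets_completionI)
  qed
  ultimately show False by simp
qed

section \<open>Homogeneous polynomials on the sphere: orthogonality, bases, pointwise bound\<close>

lemma hpoly_imp_continuous_on: "G \<in> hpoly m \<Longrightarrow> continuous_on S G"
  by (auto simp: hpoly_def intro: cholomorphic_on_imp_continuous_on continuous_on_subset)

lemma hpoly_homogeneous: "G \<in> hpoly m \<Longrightarrow> G (a *s z) = a ^ m * G z"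
  by (simp add: hpoly_def)

lemma hpoly_closed: "F \<in> hpoly m \<Longrightarrow> G \<in> hpoly m \<Longrightarrow> (\<lambda>z. a * F z + b * G z) \<in> hpoly m"
  by (auto simp: hpoly_def algebra_simps intro!: cholomorphic_on_add cholomorphic_on_cmult)

lemma hpoly_sum_closed:
  "(\<And>j. j \<in> A \<Longrightarrow> F j \<in> hpoly m) \<Longrightarrow> (\<lambda>z. \<Sum>j\<in>A. a j * F j z) \<in> hpoly m"
  by (auto simp: hpoly_def algebra_simps sum_distrib_left intro!: cholomorphic_on_sum cholomorphic_on_cmult)

lemma hpoly_compose_linear:
  fixes U :: "complex ^ 'n \<Rightarrow> complex ^ 'n"
  assumes "G \<in> hpoly m" "linear U" "\<And>a x. U (a *s x) = a *s U x"
  shows "(\<lambda>z. G (U z)) \<in> hpoly m"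
proof -
  have "U cholomorphic_map_on UNIV"
    unfolding cholomorphic_map_on_def cholomorphic_on_def
  proof (intro allI ballI exI conjI)
    have "bounded_linear U" using assms(2) by (simp add: linear_conv_bounded_linear)
    from bounded_linear_compose[OF bounded_linear_vec_nth this]
    show "((\<lambda>z. U z $ j) has_derivative (\<lambda>z. U z $ j)) (at z within UNIV)" for j z
      by (rule bounded_linear_imp_has_derivative)
  qed (simp add: assms(3))
  then have "(\<lambda>z. G (U z)) cholomorphic_on UNIV"
    by (rule cholomorphic_on_compose[OF _ _ subset_UNIV]) (use assms(1) in \<open>simp add: hpoly_def\<close>)
  then show ?thesis using assms by (simp add: hpoly_def)
qed

lemma hpoly_norm2_eq_0:
  fixes G :: "complex ^ 'n \<Rightarrow> complex"
  assumes G: "G \<in> hpoly m" and 0: "sphere_norm2 G = 0"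
  shows "G = (\<lambda>_. 0)"
proof
  fix z
  have sph: "G z = 0" if "norm z = 1" for z
    by (rule sphere_norm2_definite[OF hpoly_imp_continuous_on[OF G] 0 that])
  obtain u :: "complex ^ 'n" where u: "norm u = 1" using vector_choose_size[of 1] by auto
  show "G z = 0"
  proof (cases "z = 0")
    case True
    then have "G z = 0 ^ m * G u" using hpoly_homogeneous[OF G, of 0 u] by simp
    with sph[OF u] show ?thesis by simp
  next
    case False
    then have "z = of_real (norm z) *s sgn z" by (simp add: smult_of_real_vec sgn_div_norm)
    then have "G z = of_real (norm z) ^ m * G (sgn z)" using hpoly_homogeneous[OF G] by metis
    then show ?thesis using sph[of "sgn z"] False by (simp add: norm_sgn)
  qed
qed

text \<open>Multiplication by a unimodular scalar \<open>a\<close> preserves the inner product but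
  multiplies it by \<open>a ^ k * cnj a ^ m\<close>. For \<open>k \<noteq> m\<close> the angle
  \<open>\<theta>\<close> makes this factor -1.\<close>

lemma hpoly_orthogonal:
  fixes F G :: "complex ^ 'n \<Rightarrow> complex"
  assumes F: "F \<in> hpoly k" and G: "G \<in> hpoly m" and ne: "k \<noteq> m"
  shows "sphere_inner F G = 0"
proof -
  define \<theta> where "\<theta> = pi / (real k - real m)"
  define a where "a = cis \<theta>"
  have a: "cmod a = 1" by (simp add: a_def)
  have "a ^ k * cnj a ^ m = cis (real k * \<theta> - real m * \<theta>)"
    unfolding a_def cis_cnj Complex.DeMoivre cis_mult by simp
  also have "real k * \<theta> - real m * \<theta> = (real k - real m) * \<theta>" by (simp add: algebra_simps)
  also have "\<dots> = pi" using ne by (simp add: \<theta>_def)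
  finally have ak: "a ^ k * cnj a ^ m = - 1" by simp
  have cont: "continuous_on (cball 0 1) (\<lambda>x. F x * cnj (G x))"
    by (intro continuous_intros hpoly_imp_continuous_on[OF F] hpoly_imp_continuous_on[OF G])
  have "sphere_inner F G = (LINT x|unit_ball_measure. F (a *s sgn x) * cnj (G (a *s sgn x)))"
    unfolding sphere_inner_def
    by (rule integral_sgn_isometry[of "\<lambda>v. a *s v" "\<lambda>x. F x * cnj (G x)", symmetric])
       (auto intro: linear_smult_vec borel_measurable_sgn_continuous[OF cont] simp: norm_smult_vec a)
  also have "\<dots> = (LINT x|unit_ball_measure. (a ^ k * cnj a ^ m) * (F (sgn x) * cnj (G (sgn x))))"
    by (simp add: hpoly_homogeneous[OF F] hpoly_homogeneous[OF G] mult_ac)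
  also have "\<dots> = (a ^ k * cnj a ^ m) * sphere_inner F G"
    unfolding sphere_inner_def by simp
  finally show ?thesis using ak by simp
qed

definition orthonormal :: "nat \<Rightarrow> (nat \<Rightarrow> complex ^ 'n \<Rightarrow> complex) \<Rightarrow> bool"
  where "orthonormal N e \<longleftrightarrow> (\<forall>i<N. \<forall>j<N. sphere_inner (e i) (e j) = (if i = j then 1 else 0))"

text \<open>Orthonormal functions are linearly independent and here lie in the span of finitely many
  monomials. The resulting bound on their number is what makes a maximal orthonormal family
  exist.\<close>

lemma orthonormal_hpoly_bound:
  fixes e :: "nat \<Rightarrow> complex ^ 'n \<Rightarrow> complex"
  assumes on: "orthonormal N e" and e: "\<And>j. j < N \<Longrightarrow> e j \<in> hpoly m"
  shows "N \<le> card (monomials m :: (complex ^ 'n \<Rightarrow> complex) set)"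
proof -
  have cont: "continuous_on (cball 0 1) (e j)" if "j < N" for j using hpoly_imp_continuous_on[OF e[OF that]] .
  have inj: "inj_on e {..<N}"
    using on by (auto simp: inj_on_def orthonormal_def) (metis zero_neq_one)
  have "cfun.independent (e ` {..<N})"
  proof (rule cfun.independent_if_scalars_zero)
    fix u v
    assume sum0: "(\<Sum>x\<in>e ` {..<N}. (\<lambda>xa. u x * x xa)) = 0" and v: "v \<in> e ` {..<N}"
    then obtain i where i: "i < N" "v = e i" by auto
    have "(\<lambda>x. \<Sum>j<N. u (e j) * e j x) = (\<lambda>_. 0)"
      using sum0 by (simp add: sum.reindex[OF inj] fun_eq_iff sum_fun_apply)
    moreover have "sphere_inner (\<lambda>x. \<Sum>j<N. u (e j) * e j x) (e i) = (\<Sum>j<N. u (e j) * sphere_inner (e j) (e i))"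
      by (rule sphere_inner_sum_left) (use cont i in auto)
    moreover have "\<dots> = (\<Sum>j<N. if j = i then u (e i) else 0)"
      by (rule sum.cong) (use on i in \<open>auto simp: orthonormal_def\<close>)
    ultimately show "u v = 0" using i by (simp add: sphere_inner_def)
  qed auto
  moreover have "e ` {..<N} \<subseteq> cfun_span (monomials m)"
    using e hpoly_subset_span_monomials[of m] by blast
  ultimately have "card (e ` {..<N}) \<le> card (monomials m :: (complex ^ 'n \<Rightarrow> complex) set)"
    using cfun.independent_span_bound[OF finite_monomials] by blast
  then show ?thesis by (simp add: card_image[OF inj])
qed

text \<open>A maximal orthonormal family is a basis: a nonzero remainder of \<open>G\<close> after
  subtraction of its projection could be normalised and appended to the family.\<close>

lemma hpoly_orthonormal_basis:
  obtains N and e :: "nat \<Rightarrow> complex ^ 'n \<Rightarrow> complex" where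
    "N \<le> (m + CARD('n) - 1) choose m" "orthonormal N e" "\<And>j. j < N \<Longrightarrow> e j \<in> hpoly m"
    "\<And>G z. G \<in> hpoly m \<Longrightarrow> G z = (\<Sum>j<N. sphere_inner G (e j) * e j z)"
proof -
  let ?P = "\<lambda>N. \<exists>e :: nat \<Rightarrow> complex ^ 'n \<Rightarrow> complex. orthonormal N e \<and> (\<forall>j<N. e j \<in> hpoly m)"
  have P0: "?P 0" by (simp add: orthonormal_def)
  have bound: "N \<le> card (monomials m :: (complex ^ 'n \<Rightarrow> complex) set)" if "?P N" for N
    using orthonormal_hpoly_bound that by blast
  have "\<exists>N. ?P N \<and> (\<forall>k. ?P k \<longrightarrow> k \<le> N)"
    using Nat.ex_has_greatest_nat[where P = ?P, OF P0] bound by blast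
  then obtain N where N: "?P N \<and> (\<forall>k. ?P k \<longrightarrow> k \<le> N)" by (rule exE)
  then have "?P N" and max: "\<And>k. ?P k \<Longrightarrow> k \<le> N" by simp_all
  then obtain e :: "nat \<Rightarrow> complex ^ 'n \<Rightarrow> complex"
    where on: "orthonormal N e" and e: "\<And>j. j < N \<Longrightarrow> e j \<in> hpoly m" by auto
  have cont: "continuous_on (cball 0 1) (e j)" if "j < N" for j using hpoly_imp_continuous_on[OF e[OF that]] .
  have "G z = (\<Sum>j<N. sphere_inner G (e j) * e j z)" if G: "G \<in> hpoly m" for G z
  proof -
    define S where "S z = (\<Sum>j<N. sphere_inner G (e j) * e j z)" for z
    define H where "H z = 1 * G z + (-1) * S z" for z
    have S: "S \<in> hpoly m" unfolding S_def[abs_def] by (rule hpoly_sum_closed) (use e in auto)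
    have H: "H \<in> hpoly m" unfolding H_def[abs_def] by (rule hpoly_closed[OF G S])
    have ortho: "sphere_inner H (e i) = 0" if i: "i < N" for i
    proof -
      have "sphere_inner H (e i) = 1 * sphere_inner G (e i) + (-1) * sphere_inner S (e i)"
        unfolding H_def[abs_def]
        by (rule sphere_inner_add_left[OF hpoly_imp_continuous_on[OF G] hpoly_imp_continuous_on[OF S] cont[OF i]])
      also have "sphere_inner S (e i) = (\<Sum>j<N. sphere_inner G (e j) * sphere_inner (e j) (e i))"
        unfolding S_def[abs_def] by (rule sphere_inner_sum_left) (use cont i in auto)
      also have "\<dots> = (\<Sum>j<N. if j = i then sphere_inner G (e i) else 0)"
        by (rule sum.cong) (use on i in \<open>auto simp: orthonormal_def\<close>)
      finally show ?thesis using i by simp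
    qed
    have "sphere_norm2 H = 0"
    proof (rule ccontr)
      assume "sphere_norm2 H \<noteq> 0"
      then have pos: "sphere_norm2 H > 0" using sphere_norm2_nonneg[of H] by simp
      define c where "c = complex_of_real (1 / sqrt (sphere_norm2 H))"
      define K where "K z = c * H z + 0 * H z" for z
      have K: "K \<in> hpoly m" unfolding K_def[abs_def] by (rule hpoly_closed[OF H H])
      have KL: "sphere_inner K g = c * sphere_inner H g" if "continuous_on (cball 0 1) g" for g
        using sphere_inner_add_left[OF hpoly_imp_continuous_on[OF H] hpoly_imp_continuous_on[OF H] that, of c 0]
        by (simp add: K_def[abs_def])
      have KH: "sphere_inner K K = 1"
      proof -
        have "sphere_inner K K = c * cnj (sphere_inner K H)"
          using KL[OF hpoly_imp_continuous_on[OF K]] by (simp add: cnj_sphere_inner)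
        also have "\<dots> = c * cnj c * sphere_norm2 H"
          using KL[OF hpoly_imp_continuous_on[OF H]] by (simp add: sphere_inner_self)
        also have "\<dots> = of_real (1 / sqrt (sphere_norm2 H) * (1 / sqrt (sphere_norm2 H)) * sphere_norm2 H)"
          unfolding c_def complex_cnj_complex_of_real of_real_mult ..
        also have "1 / sqrt (sphere_norm2 H) * (1 / sqrt (sphere_norm2 H)) * sphere_norm2 H = 1"
          using pos by simp
        finally show ?thesis by simp
      qed
      have Ke: "sphere_inner K (e i) = 0" "sphere_inner (e i) K = 0" if "i < N" for i
      proof -
        show "sphere_inner K (e i) = 0" using KL[OF cont[OF that]] ortho[OF that] by simp
        then show "sphere_inner (e i) K = 0" using cnj_sphere_inner[of K "e i"] by simp
      qed
      have "orthonormal (Suc N) (e(N := K))"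
        using on KH Ke by (auto simp: orthonormal_def less_Suc_eq)
      moreover have "\<forall>j<Suc N. (e(N := K)) j \<in> hpoly m" using e K by (auto simp: less_Suc_eq)
      ultimately have "Suc N \<le> N" by (intro max exI conjI)
      then show False by simp
    qed
    from hpoly_norm2_eq_0[OF H this] have "H z = 0" by simp
    then show ?thesis by (simp add: H_def S_def)
  qed
  moreover have "N \<le> (m + CARD('n) - 1) choose m"
    using orthonormal_hpoly_bound[OF on e] card_monomials[where m = m and 'n = 'n] by linarith
  ultimately show ?thesis using that on e by blast
qed

text \<open>
  The reproducing kernel is constant on the unit sphere, because unitary maps act transitively on it,
  and its mean value is the dimension.
\<close>

lemma hpoly_pointwise_bound:
  fixes G :: "complex ^ 'n \<Rightarrow> complex"
  assumes G: "G \<in> hpoly m"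
  shows "(cmod (G z))\<^sup>2 \<le> real ((m + CARD('n) - 1) choose m) * norm z ^ (2 * m) * sphere_norm2 G"
proof -
  obtain N e where N: "N \<le> (m + CARD('n) - 1) choose m" and on: "orthonormal N (e :: nat \<Rightarrow> complex ^ 'n \<Rightarrow> complex)"
    and e: "\<And>j. j < N \<Longrightarrow> e j \<in> hpoly m"
    and exp: "\<And>G z. G \<in> hpoly m \<Longrightarrow> G z = (\<Sum>j<N. sphere_inner G (e j) * e j z)"
    using hpoly_orthonormal_basis[where m = m and 'n = 'n] by blast
  have cont: "continuous_on (cball 0 1) (e j)" if "j < N" for j using hpoly_imp_continuous_on[OF e[OF that]] .
  \<comment> \<open>The reproducing kernel of \<open>hpoly m\<close> on the diagonal, written in the
    basis \<open>e\<close>.\<close>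
  define \<kappa> where "\<kappa> z = (\<Sum>j<N. (cmod (e j z))\<^sup>2)" for z
  have \<kappa>0: "\<kappa> z \<ge> 0" for z by (simp add: \<kappa>_def sum_nonneg)
  have parseval: "sphere_norm2 G = (\<Sum>j<N. (cmod (sphere_inner G (e j)))\<^sup>2)" if G: "G \<in> hpoly m" for G
  proof -
    have "of_real (sphere_norm2 G) = sphere_inner (\<lambda>z. \<Sum>j<N. sphere_inner G (e j) * e j z) G"
      using arg_cong[OF ext[of G, OF exp[OF G]], of "\<lambda>f. sphere_inner f G"] by (simp only: sphere_inner_self)
    also have "\<dots> = (\<Sum>j<N. sphere_inner G (e j) * sphere_inner (e j) G)"
      by (rule sphere_inner_sum_left) (use cont hpoly_imp_continuous_on[OF G] in auto)
    also have "\<dots> = (\<Sum>j<N. of_real ((cmod (sphere_inner G (e j)))\<^sup>2))"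
      by (rule sum.cong) (simp_all only: complex_norm_square cnj_sphere_inner)
    finally show ?thesis unfolding of_real_sum[symmetric] by (simp only: of_real_eq_iff)
  qed
  have cs: "(cmod (G z))\<^sup>2 \<le> sphere_norm2 G * \<kappa> z" if G: "G \<in> hpoly m" for G z
  proof -
    have "cmod (G z) \<le> (\<Sum>j<N. cmod (sphere_inner G (e j)) * cmod (e j z))"
      unfolding exp[OF G, of z] by (rule order_trans[OF norm_sum]) (simp add: norm_mult)
    then have "(cmod (G z))\<^sup>2 \<le> (\<Sum>j<N. cmod (sphere_inner G (e j)) * cmod (e j z))\<^sup>2"
      by (rule power_mono) simp
    also have "\<dots> \<le> (\<Sum>j<N. (cmod (sphere_inner G (e j)))\<^sup>2) * (\<Sum>j<N. (cmod (e j z))\<^sup>2)"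
      by (rule Cauchy_Schwarz_ineq_sum)
    finally show ?thesis unfolding parseval[OF G] \<kappa>_def .
  qed
  have \<kappa>_le: "\<kappa> w \<le> \<kappa> z" if zw: "norm z = 1" "norm w = 1" for z w
  proof -
    obtain U where U: "linear U" "\<And>a x. U (a *s x) = a *s U x" "\<And>x. norm (U x) = norm x" "U z = w"
      using unitary_transitive[of z w] zw by auto
    \<comment> \<open>The kernel function at \<open>w\<close>: both its value at \<open>w\<close>
      and its squared norm are \<open>\<kappa> w\<close>. Composition with \<open>U\<close> keeps
      the norm and moves the value to \<open>z\<close>, so the Cauchy-Schwarz bound at
      \<open>z\<close> becomes
      \<open>\<kappa> w * \<kappa> w \<le> \<kappa> w * \<kappa> z\<close>.\<close>
    define H where "H x = (\<Sum>j<N. cnj (e j w) * e j x)" for x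
    have H: "H \<in> hpoly m" unfolding H_def[abs_def] by (rule hpoly_sum_closed) (use e in auto)
    have Hc: "sphere_inner H (e i) = cnj (e i w)" if i: "i < N" for i
    proof -
      have "sphere_inner H (e i) = (\<Sum>j<N. cnj (e j w) * sphere_inner (e j) (e i))"
        unfolding H_def[abs_def] by (rule sphere_inner_sum_left) (use cont i in auto)
      also have "\<dots> = (\<Sum>j<N. if j = i then cnj (e i w) else 0)"
        by (rule sum.cong) (use on i in \<open>auto simp: orthonormal_def\<close>)
      finally show ?thesis using i by simp
    qed
    have nH: "sphere_norm2 H = \<kappa> w" unfolding parseval[OF H] \<kappa>_def by (rule sum.cong) (simp_all add: Hc)
    have HU: "(\<lambda>x. H (U x)) \<in> hpoly m" by (rule hpoly_compose_linear[OF H U(1,2)])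
    have "sphere_norm2 (\<lambda>x. H (U x)) = sphere_norm2 H"
      unfolding sphere_norm2_def
      by (rule integral_sgn_isometry[OF U(1,3), of "\<lambda>x. (cmod (H x))\<^sup>2"] borel_measurable_sgn_continuous
        continuous_intros hpoly_imp_continuous_on[OF H])+
    then have "(cmod (H (U z)))\<^sup>2 \<le> \<kappa> w * \<kappa> z" using cs[OF HU, of z] by (simp add: nH)
    moreover have "H (U z) = of_real (\<kappa> w)"
      unfolding H_def U(4) \<kappa>_def of_real_sum
      by (rule sum.cong) (simp_all only: complex_norm_square mult.commute)
    ultimately have "\<kappa> w * \<kappa> w \<le> \<kappa> w * \<kappa> z" using \<kappa>0[of w] by (simp add: power2_eq_square)
    then show ?thesis using \<kappa>0[of w] \<kappa>0[of z] by (cases "\<kappa> w = 0") auto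
  qed
  have \<kappa>N: "\<kappa> w \<le> real N" if w: "norm w = 1" for w
  proof -
    have contk: "continuous_on (cball 0 1) \<kappa>"
      unfolding \<kappa>_def[abs_def] by (intro continuous_intros) (use cont in auto)
    have "\<kappa> w = (LINT x|(unit_ball_measure :: (complex ^ 'n) measure). \<kappa> w)" by simp
    \<comment> \<open>The comparison is available only for \<open>sgn x\<close> on the sphere, hence
      away from the null set \<open>x = 0\<close>. Integrating the sum of the squares of the
      normalised \<open>e j\<close> then yields \<open>N\<close>.\<close>
    also have "\<dots> \<le> (LINT x|unit_ball_measure. \<kappa> (sgn x))"
    proof (rule integral_mono_AE)
      show "AE x in unit_ball_measure. \<kappa> w \<le> \<kappa> (sgn x)"
        using AE_unit_ball_nonzero by eventually_elim (intro \<kappa>_le w, simp add: norm_sgn)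
    qed (auto intro: integrable_sgn_continuous[OF contk])
    also have "\<dots> = (\<Sum>j<N. sphere_norm2 (e j))"
      unfolding \<kappa>_def sphere_norm2_def
    proof (rule Bochner_Integration.integral_sum)
      show "integrable unit_ball_measure (\<lambda>x. (cmod (e j (sgn x)))\<^sup>2)" if "j \<in> {..<N}" for j
        using that by (intro integrable_sgn_continuous[of "\<lambda>x. (cmod (e j x))\<^sup>2"] continuous_intros cont) auto
    qed
    also have "\<dots> = (\<Sum>j<N. 1)"
    proof (rule sum.cong)
      fix j assume "j \<in> {..<N}"
      then have "complex_of_real (sphere_norm2 (e j)) = 1"
        using on by (simp add: orthonormal_def sphere_inner_self[symmetric])
      then show "sphere_norm2 (e j) = 1" by (metis of_real_eq_1_iff)
    qed simp
    finally show ?thesis by simp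
  qed
  have sph: "(cmod (G w))\<^sup>2 \<le> real ((m + CARD('n) - 1) choose m) * sphere_norm2 G" if w: "norm w = 1" for w
  proof -
    have "(cmod (G w))\<^sup>2 \<le> sphere_norm2 G * \<kappa> w" by (rule cs[OF G])
    also have "\<dots> \<le> sphere_norm2 G * real ((m + CARD('n) - 1) choose m)"
      using \<kappa>N[OF w] N by (intro mult_left_mono sphere_norm2_nonneg) (meson of_nat_mono order_trans)
    finally show ?thesis by (simp add: mult.commute)
  qed
  obtain u :: "complex ^ 'n" where u: "norm u = 1" using vector_choose_size[of 1] by auto
  have "\<exists>w. norm w = 1 \<and> z = of_real (norm z) *s w"
  proof (cases "z = 0")
    case True
    then show ?thesis using u by (intro exI[of _ u]) simp
  next
    case False
    then show ?thesis
      by (intro exI[of _ "sgn z"]) (simp add: norm_sgn, simp add: smult_of_real_vec sgn_div_norm)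
  qed
  then obtain w where w: "norm w = 1" "z = of_real (norm z) *s w" by blast
  have "G z = of_real (norm z) ^ m * G w" using hpoly_homogeneous[OF G] w(2) by metis
  then have "(cmod (G z))\<^sup>2 = norm z ^ (2 * m) * (cmod (G w))\<^sup>2"
    by (simp add: norm_mult norm_power power_mult_distrib power_mult[symmetric] mult.commute)
  also have "\<dots> \<le> norm z ^ (2 * m) * (real ((m + CARD('n) - 1) choose m) * sphere_norm2 G)"
    by (rule mult_left_mono[OF sph[OF w(1)]]) simp
  finally show ?thesis by (simp add: mult_ac)
qed

subsection \<open>Parseval identity and tail estimate\<close>

lemma binomial_Suc_real:
  "real ((l + Suc p) choose Suc p) = real ((l + p) choose p) * (real l + real p + 1) / (real p + 1)"
proof -
  have "Suc p * ((l + Suc p) choose Suc p) = Suc (l + p) * ((l + p) choose p)"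
    using Suc_times_binomial_eq[of "l + p" p] by (simp add: mult.commute)
  then have "real (Suc p) * real ((l + Suc p) choose Suc p) = real (Suc (l + p)) * real ((l + p) choose p)"
    by (metis of_nat_mult)
  then show ?thesis by (simp add: field_simps)
qed

text \<open>For \<open>p = d - 1\<close> these are the dimensions of the homogeneous degrees.
  Submultiplicativity lets a power series tail starting at \<open>K\<close> be compared with its
  first coefficient times the whole series.\<close>

lemma binomial_submult:
  "real ((K + l + p) choose p) \<le> real ((K + p) choose p) * real ((l + p) choose p)"
proof (induction p)
  case (Suc p)
  have le: "(real (K + l) + real p + 1) / (real p + 1)
     \<le> ((real K + real p + 1) / (real p + 1)) * ((real l + real p + 1) / (real p + 1))"
  proof -
    have "((real K + real p + 1) / (real p + 1)) * ((real l + real p + 1) / (real p + 1))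
       = (real (K + l) + real p + 1) / (real p + 1) + real K * real l / (real p + 1)\<^sup>2"
      by (simp add: divide_simps power2_eq_square) (simp add: algebra_simps)
    then show ?thesis by simp
  qed
  have "real ((K + l + Suc p) choose Suc p) = real ((K + l + p) choose p) * ((real (K + l) + real p + 1) / (real p + 1))"
    by (subst binomial_Suc_real) simp
  also have "\<dots> \<le> (real ((K + p) choose p) * real ((l + p) choose p)) *
      (((real K + real p + 1) / (real p + 1)) * ((real l + real p + 1) / (real p + 1)))"
    by (rule mult_mono[OF Suc.IH le]) auto
  also have "\<dots> = real ((K + Suc p) choose Suc p) * real ((l + Suc p) choose Suc p)"
    unfolding binomial_Suc_real by simp
  finally show ?case .
qed simp

text \<open>The partial sums of the expansion of \<open>1 / (1 - y) ^ Suc p\<close>. Multiplication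
  by \<open>1 - y\<close> lowers \<open>p\<close> by one, by Pascal's rule, up to a boundary term of
  favourable sign.\<close>

lemma negative_binomial_partial_sum:
  fixes y :: real
  assumes y: "0 \<le> y" "y < 1"
  shows "(\<Sum>l<M. real ((l + p) choose p) * y ^ l) \<le> 1 / (1 - y) ^ Suc p"
proof (induction p)
  case 0
  have "(\<Sum>l<M. y ^ l) = (1 - y ^ M) / (1 - y)" using y by (simp add: sum_gp_strict)
  also have "\<dots> \<le> 1 / (1 - y)" using y by (intro divide_right_mono) auto
  finally show ?case by simp
next
  case (Suc p)
  have tele: "(1 - y) * (\<Sum>l<Suc M. real ((l + Suc p) choose Suc p) * y ^ l) + y ^ Suc M * real ((M + Suc p) choose Suc p)
    = (\<Sum>l<Suc M. real ((l + p) choose p) * y ^ l)" for M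
  proof (induction M)
    case (Suc M)
    have pascal: "(Suc M + Suc p) choose Suc p = ((M + Suc p) choose Suc p) + ((Suc M + p) choose p)" by simp
    show ?case
      unfolding sum.lessThan_Suc[of _ "Suc M"] Suc.IH[symmetric] pascal by (simp add: algebra_simps)
  qed (simp add: algebra_simps)
  have "(1 - y) * (\<Sum>l<M. real ((l + Suc p) choose Suc p) * y ^ l) \<le> (\<Sum>l<M. real ((l + p) choose p) * y ^ l)"
  proof (cases M)
    case (Suc M')
    have "y ^ Suc M' * real ((M' + Suc p) choose Suc p) \<ge> 0" using y by simp
    with tele[of M'] show ?thesis unfolding Suc by linarith
  qed simp
  also have "\<dots> \<le> 1 / (1 - y) ^ Suc p" by (rule Suc.IH)
  finally have "(\<Sum>l<M. real ((l + Suc p) choose Suc p) * y ^ l) \<le> 1 / (1 - y) ^ Suc p / (1 - y)"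
    using y by (subst pos_le_divide_eq) (simp_all only: mult.commute diff_gt_0_iff_gt)
  then show ?case by (simp only: power_Suc divide_divide_eq_left mult_1_left mult.commute)
qed

text \<open>Submultiplicativity extracts the first term of the tail, and the remaining factor is at
  most the negative binomial series. For \<open>K = 0\<close> the first term is 1.\<close>

lemma tail_sum_bound:
  fixes y :: real
  assumes y: "0 \<le> y" "y < 1" and d: "d \<ge> 1"
  shows "(\<Sum>m=K..<M. real ((m + d - 1) choose m) * y ^ m) \<le> real ((K + d - 1) choose K) * y ^ K / (1 - y) ^ d"
proof -
  obtain p where p: "d = Suc p" using d by (cases d) auto
  have sym: "(m + p) choose m = (m + p) choose p" for m by (simp add: binomial_symmetric[of m "m + p"])
  have "(\<Sum>m=K..<M. real ((m + p) choose p) * y ^ m) \<le> (\<Sum>l<M-K. real ((K + p) choose p) * y ^ K * (real ((l + p) choose p) * y ^ l))"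
  proof (cases "K \<le> M")
    case True
    have "(\<Sum>m=K..<M. real ((m + p) choose p) * y ^ m) = (\<Sum>l<M-K. real ((K + l + p) choose p) * y ^ (K + l))"
      using sum.shift_bounds_nat_ivl[of "\<lambda>m. real ((m + p) choose p) * y ^ m" 0 K "M - K"] True
      by (simp add: lessThan_atLeast0 add.commute)
    also have "\<dots> \<le> (\<Sum>l<M-K. real ((K + p) choose p) * y ^ K * (real ((l + p) choose p) * y ^ l))"
    proof (rule sum_mono)
      fix l
      have "real ((K + l + p) choose p) * y ^ (K + l) \<le> (real ((K + p) choose p) * real ((l + p) choose p)) * y ^ (K + l)"
        using y by (intro mult_right_mono binomial_submult) auto
      then show "real ((K + l + p) choose p) * y ^ (K + l) \<le> real ((K + p) choose p) * y ^ K * (real ((l + p) choose p) * y ^ l)"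
        by (simp add: power_add mult_ac)
    qed
    finally show ?thesis .
  qed simp
  also have "\<dots> = real ((K + p) choose p) * y ^ K * (\<Sum>l<M-K. real ((l + p) choose p) * y ^ l)"
    by (simp add: sum_distrib_left)
  also have "\<dots> \<le> real ((K + p) choose p) * y ^ K * (1 / (1 - y) ^ Suc p)"
    using y by (intro mult_left_mono negative_binomial_partial_sum) auto
  finally show ?thesis by (simp add: p sym)
qed

lemma sphere_norm2_tendsto:
  fixes F :: "nat \<Rightarrow> complex ^ 'n \<Rightarrow> complex"
  assumes F: "\<And>k. continuous_on (cball 0 1) (F k)" and G: "continuous_on (cball 0 1) G"
    and lim: "\<And>x. norm x \<le> 1 \<Longrightarrow> (\<lambda>k. F k x) \<longlonglongrightarrow> G x"
    and bd: "\<And>k x. norm x \<le> 1 \<Longrightarrow> cmod (F k x) \<le> B"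
  shows "(\<lambda>k. sphere_norm2 (F k)) \<longlonglongrightarrow> sphere_norm2 G"
  unfolding sphere_norm2_def
proof (rule integral_dominated_convergence[where w = "\<lambda>_. B\<^sup>2"])
  have ns: "norm (sgn x) \<le> 1" for x :: "complex ^ 'n" by (simp add: norm_sgn)
  have "continuous_on (cball 0 1) (\<lambda>x. (cmod (G x))\<^sup>2)" by (intro continuous_intros G)
  from borel_measurable_integrable[OF integrable_sgn_continuous[OF this]]
  show "(\<lambda>x. (cmod (G (sgn x)))\<^sup>2) \<in> borel_measurable unit_ball_measure" .
  fix k
  have "continuous_on (cball 0 1) (\<lambda>x. (cmod (F k x))\<^sup>2)" by (intro continuous_intros F)
  from borel_measurable_integrable[OF integrable_sgn_continuous[OF this]]
  show "(\<lambda>x. (cmod (F k (sgn x)))\<^sup>2) \<in> borel_measurable unit_ball_measure" .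
  show "AE x in unit_ball_measure. norm ((cmod (F k (sgn x)))\<^sup>2) \<le> B\<^sup>2"
    using bd[OF ns] by (auto intro!: AE_I2 power_mono)
  show "AE x in unit_ball_measure. (\<lambda>k. (cmod (F k (sgn x)))\<^sup>2) \<longlonglongrightarrow> (cmod (G (sgn x)))\<^sup>2"
    using lim[OF ns] by (auto intro!: AE_I2 tendsto_intros)
qed simp

lemma sphere_norm2_le:
  assumes "continuous_on (cball 0 1) G" "\<And>x. norm x \<le> 1 \<Longrightarrow> cmod (G x) \<le> B"
  shows "sphere_norm2 (G :: complex ^ 'n \<Rightarrow> complex) \<le> B\<^sup>2"
proof -
  have "sphere_norm2 G \<le> (LINT x|(unit_ball_measure :: (complex ^ 'n) measure). B\<^sup>2)"
    unfolding sphere_norm2_def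
  proof (rule integral_mono)
    show "integrable unit_ball_measure (\<lambda>x. (cmod (G (sgn x)))\<^sup>2)"
      by (rule integrable_sgn_continuous[of "\<lambda>x. (cmod (G x))\<^sup>2"]) (intro continuous_intros assms(1))
    show "(cmod (G (sgn x)))\<^sup>2 \<le> B\<^sup>2" for x
      using assms(2)[of "sgn x"] by (intro power_mono) (auto simp: norm_sgn)
  qed simp
  then show ?thesis by simp
qed

lemma sphere_norm2_scale: "sphere_norm2 (\<lambda>x. a * f x) = (cmod a)\<^sup>2 * sphere_norm2 f"
  by (simp add: sphere_norm2_def norm_mult power_mult_distrib)

lemma sphere_norm2_sum_hpoly:
  fixes G :: "nat \<Rightarrow> complex ^ 'n \<Rightarrow> complex"
  assumes G: "\<And>m. G m \<in> hpoly m"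
  shows "sphere_norm2 (\<lambda>x. \<Sum>m<M. a m * G m x) = (\<Sum>m<M. (cmod (a m))\<^sup>2 * sphere_norm2 (G m))"
proof -
  have cont: "continuous_on (cball 0 1) (G m)" for m by (rule hpoly_imp_continuous_on[OF G])
  let ?S = "\<lambda>x. \<Sum>m<M. a m * G m x"
  have contS: "continuous_on (cball 0 1) ?S" by (intro continuous_intros cont)
  have "of_real (sphere_norm2 ?S) = (\<Sum>m<M. a m * sphere_inner (G m) ?S)"
    unfolding sphere_inner_self[symmetric] by (rule sphere_inner_sum_left) (use cont contS in auto)
  also have "\<dots> = (\<Sum>m<M. of_real ((cmod (a m))\<^sup>2 * sphere_norm2 (G m)))"
  proof (rule sum.cong)
    fix m assume m: "m \<in> {..<M}"
    have "sphere_inner (G m) ?S = (\<Sum>k<M. cnj (a k) * sphere_inner (G m) (G k))"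
      by (rule sphere_inner_sum_right) (use cont in auto)
    also have "\<dots> = (\<Sum>k<M. if k = m then cnj (a m) * of_real (sphere_norm2 (G m)) else 0)"
      by (rule sum.cong) (auto simp: sphere_inner_self hpoly_orthogonal[OF G G])
    finally show "a m * sphere_inner (G m) ?S = of_real ((cmod (a m))\<^sup>2 * sphere_norm2 (G m))"
      using m by (simp add: complex_norm_square del: of_real_power)
  qed simp
  finally show ?thesis unfolding of_real_sum[symmetric] by (simp only: of_real_eq_iff)
qed

section \<open>Dilations, Parseval's identity and the reproducing kernel estimate\<close>

lemma dilate_in_ball:
  assumes "norm x \<le> 1" "0 \<le> s" "s < 1"
  shows "norm (complex_of_real s *s (x :: complex ^ 'n)) < 1"
proof -
  have "s * norm x \<le> s * 1" using assms by (intro mult_left_mono) auto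
  then show ?thesis using assms by (simp add: norm_smult_vec)
qed

lemma continuous_on_dilate:
  fixes f :: "complex ^ 'n \<Rightarrow> complex"
  assumes f: "f cholomorphic_on ball 0 1" and s: "0 \<le> s" "s < 1"
  shows "continuous_on (cball 0 1) (\<lambda>x. f (complex_of_real s *s x))"
  by (rule continuous_on_compose2[OF cholomorphic_on_imp_continuous_on[OF f]])
     (use dilate_in_ball[OF _ s] in \<open>auto intro!: continuous_intros\<close>)

text \<open>Parseval's identity on the sphere of radius \<open>s\<close>. For partial sums it is
  orthogonality of the degrees; the passage to the limit is by dominated convergence.\<close>

lemma sphere_norm2_dilate_sums:
  fixes f :: "complex ^ 'n \<Rightarrow> complex"
  assumes f: "f cholomorphic_on ball 0 1" and s: "0 \<le> s" "s < 1"
  shows "(\<lambda>m. s ^ (2 * m) * sphere_norm2 (hcomp m f)) sums sphere_norm2 (\<lambda>x. f (complex_of_real s *s x))"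
proof -
  \<comment> \<open>A radius strictly between \<open>s\<close> and 1: Cauchy's bound at radius
    \<open>q\<close> gives the partial sums on the sphere of radius \<open>s\<close> a geometric
    majorant with ratio \<open>s / q\<close>.\<close>
  define q where "q = (s + 1) / 2"
  have q: "0 < q" "q < 1" "s < q" using s by (auto simp: q_def)
  obtain B where B: "\<And>z. norm z \<le> q \<Longrightarrow> cmod (f z) \<le> B"
    using bounded_on_cball[OF f, of 0 q] q by (auto simp: cball_subset_ball_iff)
  have B0: "B \<ge> 0" using B[of 0] q norm_ge_zero[of "f 0"] by (simp del: norm_ge_zero)
  have hp: "hcomp m f \<in> hpoly m" for m by (rule hcomp_in_hpoly[OF f])
  define S where "S M x = (\<Sum>m<M. complex_of_real s ^ m * hcomp m f x)" for M x
  have lim: "(\<lambda>M. sphere_norm2 (S M)) \<longlonglongrightarrow> sphere_norm2 (\<lambda>x. f (complex_of_real s *s x))"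
  proof (rule sphere_norm2_tendsto)
    show "continuous_on (cball 0 1) (S M)" for M
      unfolding S_def[abs_def] by (intro continuous_intros hpoly_imp_continuous_on[OF hp])
    show "(\<lambda>M. S M x) \<longlonglongrightarrow> f (complex_of_real s *s x)" if "norm x \<le> 1" for x
      using hcomp_sums[OF f dilate_in_ball[OF that s]] unfolding sums_def S_def by (simp add: mult.commute)
    show "cmod (S M x) \<le> B * (1 / (1 - s / q))" if x: "norm x \<le> 1" for M x
    proof -
      have "cmod (S M x) \<le> (\<Sum>m<M. B * (s / q) ^ m)"
        unfolding S_def
      proof (rule sum_norm_le)
        fix m
        have "cmod (hcomp m f x) \<le> B * (norm x / q) ^ m" by (rule hcomp_bound[OF f q(1,2) B])
        also have "\<dots> \<le> B * (1 / q) ^ m"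
          using x q B0 by (intro mult_left_mono power_mono divide_right_mono) auto
        finally have "s ^ m * cmod (hcomp m f x) \<le> s ^ m * (B * (1 / q) ^ m)"
          using s by (intro mult_left_mono) auto
        then show "cmod (complex_of_real s ^ m * hcomp m f x) \<le> B * (s / q) ^ m"
          using s by (simp add: norm_mult norm_power power_divide mult_ac)
      qed
      also have "\<dots> = B * ((1 - (s / q) ^ M) / (1 - s / q))"
        using q s by (simp add: sum_distrib_left[symmetric] sum_gp_strict)
      also have "\<dots> \<le> B * (1 / (1 - s / q))"
        using q s B0 by (intro mult_left_mono divide_right_mono) auto
      finally show ?thesis .
    qed
  qed (rule continuous_on_dilate[OF f s])
  have "sphere_norm2 (S M) = (\<Sum>m<M. s ^ (2 * m) * sphere_norm2 (hcomp m f))" for M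
    unfolding S_def using sphere_norm2_sum_hpoly[of "\<lambda>m. hcomp m f" "\<lambda>m. complex_of_real s ^ m" M, OF hp] s
    by (simp add: norm_power power_mult[symmetric] mult.commute)
  with lim show ?thesis by (simp add: sums_def)
qed

text \<open>Each degree is estimated by its reproducing kernel and the degrees are combined by
  Cauchy-Schwarz. The function is evaluated within radius \<open>\<rho>\<close> while its norm is
  taken at radius \<open>s\<close>, hence the ratio \<open>(\<rho> / s)\<^sup>2\<close>.\<close>

lemma tail_bound:
  fixes f :: "complex ^ 'n \<Rightarrow> complex"
  assumes f: "f cholomorphic_on ball 0 1" and vanish: "\<And>m. m < K \<Longrightarrow> hcomp m f = (\<lambda>_. 0)"
    and \<rho>: "0 \<le> \<rho>" "\<rho> < s" and s: "s < 1" and z: "norm z \<le> \<rho>"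
  shows "(cmod (f z))\<^sup>2 \<le> real ((K + CARD('n) - 1) choose K) * ((\<rho> / s)\<^sup>2) ^ K / (1 - (\<rho> / s)\<^sup>2) ^ CARD('n)
     * sphere_norm2 (\<lambda>x. f (complex_of_real s *s x))"
proof -
  define y where "y = (\<rho> / s)\<^sup>2"
  have s0: "s > 0" using \<rho> by simp
  have y: "0 \<le> y" "y < 1" using \<rho> s0 power_strict_mono[of "\<rho> / s" 1 2] by (auto simp: y_def)
  let ?N = "\<lambda>m. real ((m + CARD('n) - 1) choose m)"
  let ?a = "\<lambda>m. sphere_norm2 (hcomp m f)"
  let ?S = "sphere_norm2 (\<lambda>x. f (complex_of_real s *s x))"
  let ?A = "?N K * y ^ K / (1 - y) ^ CARD('n)"
  have A0: "?A \<ge> 0" using y by simp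
  have sums: "(\<lambda>m. s ^ (2 * m) * ?a m) sums ?S"
    by (rule sphere_norm2_dilate_sums[OF f]) (use s0 s in auto)
  have part: "(\<Sum>m<M. s ^ (2 * m) * ?a m) \<le> ?S" for M
    unfolding sums_unique[OF sums]
    by (rule sum_le_suminf[OF sums_summable[OF sums] finite_lessThan])
       (use s0 in \<open>simp add: sphere_norm2_nonneg\<close>)
  have bound: "(cmod (\<Sum>m<M. hcomp m f z))\<^sup>2 \<le> ?A * ?S" for M
  proof -
    have vanish': "hcomp m f z = 0" if "m \<notin> {K..<M}" "m < M" for m using vanish[of m] that by auto
    have "cmod (\<Sum>m<M. hcomp m f z) = cmod (\<Sum>m=K..<M. hcomp m f z)"
      by (intro arg_cong[where f = cmod] sum.mono_neutral_right) (use vanish' in auto)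
    \<comment> \<open>The weight \<open>\<rho> ^ (2 * m)\<close> is split as
      \<open>y ^ m * s ^ (2 * m)\<close>: the first part goes with the dimensions into the kernel
      tail, the second completes the Parseval sum at radius \<open>s\<close>.\<close>
    also have "\<dots> \<le> (\<Sum>m=K..<M. sqrt (?N m * y ^ m) * sqrt (s ^ (2 * m) * ?a m))"
    proof (rule sum_norm_le)
      fix m
      have "(cmod (hcomp m f z))\<^sup>2 \<le> ?N m * norm z ^ (2 * m) * ?a m"
        by (rule hpoly_pointwise_bound[OF hcomp_in_hpoly[OF f]])
      also have "\<dots> \<le> ?N m * \<rho> ^ (2 * m) * ?a m"
        using z by (intro mult_right_mono mult_left_mono power_mono sphere_norm2_nonneg) auto
      also have "\<rho> ^ (2 * m) = y ^ m * s ^ (2 * m)"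
        using s0 by (simp add: y_def power_mult power_divide)
      finally have "cmod (hcomp m f z) \<le> sqrt (?N m * (y ^ m * s ^ (2 * m)) * ?a m)" by (rule real_le_rsqrt)
      then show "cmod (hcomp m f z) \<le> sqrt (?N m * y ^ m) * sqrt (s ^ (2 * m) * ?a m)"
        unfolding real_sqrt_mult[symmetric] by (simp only: mult_ac)
    qed
    finally have "(cmod (\<Sum>m<M. hcomp m f z))\<^sup>2 \<le> (\<Sum>m=K..<M. sqrt (?N m * y ^ m) * sqrt (s ^ (2 * m) * ?a m))\<^sup>2"
      by (rule power_mono) simp
    also have "\<dots> \<le> (\<Sum>m=K..<M. (sqrt (?N m * y ^ m))\<^sup>2) * (\<Sum>m=K..<M. (sqrt (s ^ (2 * m) * ?a m))\<^sup>2)"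
      by (rule Cauchy_Schwarz_ineq_sum)
    also have "\<dots> = (\<Sum>m=K..<M. ?N m * y ^ m) * (\<Sum>m=K..<M. s ^ (2 * m) * ?a m)"
    proof -
      have "(sqrt (?N m * y ^ m))\<^sup>2 = ?N m * y ^ m" for m using y by (intro real_sqrt_pow2) simp
      moreover have "(sqrt (s ^ (2 * m) * ?a m))\<^sup>2 = s ^ (2 * m) * ?a m" for m
        using s0 by (intro real_sqrt_pow2) (simp add: sphere_norm2_nonneg)
      ultimately show ?thesis by (simp only:)
    qed
    also have "\<dots> \<le> ?A * ?S"
    proof (rule mult_mono)
      show "(\<Sum>m=K..<M. ?N m * y ^ m) \<le> ?A" by (rule tail_sum_bound[OF y]) (simp add: Suc_le_eq)
      have "(\<Sum>m=K..<M. s ^ (2 * m) * ?a m) \<le> (\<Sum>m<M. s ^ (2 * m) * ?a m)"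
        by (rule sum_mono2) (use s0 in \<open>auto simp: sphere_norm2_nonneg\<close>)
      also have "\<dots> \<le> ?S" by (rule part)
      finally show "(\<Sum>m=K..<M. s ^ (2 * m) * ?a m) \<le> ?S" .
    qed (use A0 s0 in \<open>auto intro!: sum_nonneg simp: sphere_norm2_nonneg\<close>)
    finally show ?thesis .
  qed
  have "norm (1 *s z) < 1" using z \<rho> s by simp
  from hcomp_sums[OF f this] have "(\<lambda>M. \<Sum>m<M. hcomp m f z) \<longlonglongrightarrow> f z" by (simp add: sums_def)
  then have "(\<lambda>M. (cmod (\<Sum>m<M. hcomp m f z))\<^sup>2) \<longlonglongrightarrow> (cmod (f z))\<^sup>2" by (intro tendsto_intros)
  then have "(cmod (f z))\<^sup>2 \<le> ?A * ?S" by (rule LIMSEQ_le_const2) (use bound in auto)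
  then show ?thesis by (simp add: y_def)
qed

text \<open>Degree by degree this is
  \<open>(s ^ m - t ^ m)\<^sup>2 \<le> s ^ (2 * m) - t ^ (2 * m)\<close>. It shows that norms
  increase with the radius and that dilates form a Cauchy sequence as soon as their norms are
  bounded.\<close>

lemma sphere_norm2_dilate_mono:
  fixes f :: "complex ^ 'n \<Rightarrow> complex"
  assumes f: "f cholomorphic_on ball 0 1" and "0 \<le> t" "t \<le> s" "s < 1"
  shows "sphere_norm2 (\<lambda>x. f (complex_of_real s *s x) - f (complex_of_real t *s x))
     \<le> sphere_norm2 (\<lambda>x. f (complex_of_real s *s x)) - sphere_norm2 (\<lambda>x. f (complex_of_real t *s x))"
proof -
  \<comment> \<open>An intermediate radius: the difference of the two dilates becomes the
    restriction to the sphere of radius \<open>\<sigma> < 1\<close> of one function \<open>h\<close>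
    holomorphic on the unit ball, so that Parseval's identity applies to it.\<close>
  define \<sigma> where "\<sigma> = (s + 1) / 2"
  have \<sigma>: "0 < \<sigma>" "\<sigma> < 1" "s < \<sigma>" "t < \<sigma>" using assms by (auto simp: \<sigma>_def)
  have dil: "(\<lambda>z. f (complex_of_real a *s z)) cholomorphic_on ball 0 1" if "0 \<le> a" "a < 1" for a
  proof -
    have "(\<lambda>z. 0 + complex_of_real a *s z) ` ball 0 1 \<subseteq> (ball 0 1 :: (complex ^ 'n) set)"
    proof clarify
      fix z :: "complex ^ 'n" assume "z \<in> ball 0 1"
      then show "0 + complex_of_real a *s z \<in> ball 0 1" using dilate_in_ball[OF _ that, of z] by simp
    qed
    from cholomorphic_on_compose[OF cholomorphic_map_affine f this] show ?thesis by simp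
  qed
  define h where "h z = 1 * f (complex_of_real (s / \<sigma>) *s z) + (- 1) * f (complex_of_real (t / \<sigma>) *s z)" for z
  have st: "0 \<le> s / \<sigma>" "s / \<sigma> < 1" "0 \<le> t / \<sigma>" "t / \<sigma> < 1" using \<sigma> assms by auto
  have h: "h cholomorphic_on ball 0 1"
    unfolding h_def[abs_def] by (intro cholomorphic_on_add cholomorphic_on_cmult dil st)
  have hc: "hcomp m h = (\<lambda>z. complex_of_real ((s / \<sigma>) ^ m - (t / \<sigma>) ^ m) * hcomp m f z)" for m
  proof
    fix z
    have e: "hcomp m (\<lambda>z. f (a *s z)) z = hcomp m f (a *s z)" for a
      by (simp add: hcomp_def vector_smult_assoc mult.commute)
    have "hcomp m h z = 1 * hcomp m (\<lambda>z. f (complex_of_real (s / \<sigma>) *s z)) z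
       + (-1) * hcomp m (\<lambda>z. f (complex_of_real (t / \<sigma>) *s z)) z"
      unfolding h_def[abs_def] by (rule hcomp_linear[OF dil[OF st(1,2)] dil[OF st(3,4)]])
    then show "hcomp m h z = complex_of_real ((s / \<sigma>) ^ m - (t / \<sigma>) ^ m) * hcomp m f z"
      unfolding e hcomp_homogeneous[OF f] by (simp add: algebra_simps)
  qed
  have "(\<lambda>m. \<sigma> ^ (2 * m) * sphere_norm2 (hcomp m h)) sums sphere_norm2 (\<lambda>x. h (complex_of_real \<sigma> *s x))"
    by (rule sphere_norm2_dilate_sums[OF h]) (use \<sigma> in auto)
  also have "(\<lambda>x. h (complex_of_real \<sigma> *s x)) = (\<lambda>x. f (complex_of_real s *s x) - f (complex_of_real t *s x))"
    using \<sigma> by (simp add: h_def vector_smult_assoc)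
  also have "(\<lambda>m. \<sigma> ^ (2 * m) * sphere_norm2 (hcomp m h)) = (\<lambda>m. (s ^ m - t ^ m)\<^sup>2 * sphere_norm2 (hcomp m f))"
  proof
    fix m
    have "\<sigma> ^ (2 * m) * ((s / \<sigma>) ^ m - (t / \<sigma>) ^ m)\<^sup>2 = (\<sigma> ^ m * ((s / \<sigma>) ^ m - (t / \<sigma>) ^ m))\<^sup>2"
      by (simp add: power_mult_distrib power_mult[symmetric] mult.commute)
    also have "\<sigma> ^ m * ((s / \<sigma>) ^ m - (t / \<sigma>) ^ m) = s ^ m - t ^ m"
      using \<sigma> by (simp add: power_divide right_diff_distrib)
    finally show "\<sigma> ^ (2 * m) * sphere_norm2 (hcomp m h) = (s ^ m - t ^ m)\<^sup>2 * sphere_norm2 (hcomp m f)"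
      unfolding hc sphere_norm2_scale norm_of_real by (simp add: mult.assoc[symmetric])
  qed
  finally have s1: "(\<lambda>m. (s ^ m - t ^ m)\<^sup>2 * sphere_norm2 (hcomp m f)) sums
    sphere_norm2 (\<lambda>x. f (complex_of_real s *s x) - f (complex_of_real t *s x))" .
  have "(\<lambda>m. s ^ (2 * m) * sphere_norm2 (hcomp m f) - t ^ (2 * m) * sphere_norm2 (hcomp m f)) sums
    (sphere_norm2 (\<lambda>x. f (complex_of_real s *s x)) - sphere_norm2 (\<lambda>x. f (complex_of_real t *s x)))"
    by (intro sums_diff sphere_norm2_dilate_sums[OF f]) (use assms in auto)
  from s1 this show ?thesis
  proof (rule sums_le[rotated])
    fix m
    have "t ^ m \<le> s ^ m" using assms by (intro power_mono) auto
    then have "t ^ m * t ^ m \<le> s ^ m * t ^ m" using assms by (intro mult_right_mono) auto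
    moreover have "(s ^ m - t ^ m)\<^sup>2 = s ^ m * s ^ m + t ^ m * t ^ m - 2 * (s ^ m * t ^ m)"
      by (simp add: power2_eq_square algebra_simps)
    ultimately have "(s ^ m - t ^ m)\<^sup>2 \<le> s ^ (2 * m) - t ^ (2 * m)"
      unfolding mult_2 power_add by linarith
    then show "(s ^ m - t ^ m)\<^sup>2 * sphere_norm2 (hcomp m f) \<le> s ^ (2 * m) * sphere_norm2 (hcomp m f) - t ^ (2 * m) * sphere_norm2 (hcomp m f)"
      unfolding left_diff_distrib[symmetric] by (rule mult_right_mono[OF _ sphere_norm2_nonneg])
  qed
qed

definition radius :: "nat \<Rightarrow> real"
  where "radius k = 1 - 1 / (real k + 2)"

lemma radius: "0 \<le> radius k" "radius k < 1" "j \<le> k \<Longrightarrow> radius j \<le> radius k" "radius \<longlonglongrightarrow> 1"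
proof -
  show "radius \<longlonglongrightarrow> 1" unfolding radius_def[abs_def] by real_asymp
qed (auto simp: radius_def field_simps)

lemma sphere_norm2_dilate_tendsto:
  fixes f :: "complex ^ 'n \<Rightarrow> complex"
  assumes c: "continuous_on (cball 0 1) f"
  shows "(\<lambda>k. sphere_norm2 (\<lambda>x. f (complex_of_real (radius k) *s x))) \<longlonglongrightarrow> sphere_norm2 f"
    and "(\<lambda>k. sphere_norm2 (\<lambda>x. f x - f (complex_of_real (radius k) *s x))) \<longlonglongrightarrow> 0"
proof -
  have in1: "norm (complex_of_real (radius k) *s x) \<le> 1" if "norm x \<le> 1" for k and x :: "complex ^ 'n"
    using dilate_in_ball[OF that radius(1,2)] by (rule less_imp_le)
  have ck: "continuous_on (cball 0 1) (\<lambda>x. f (complex_of_real (radius k) *s x))" for k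
    by (rule continuous_on_compose2[OF c]) (use in1 in \<open>auto intro!: continuous_intros\<close>)
  have lim: "(\<lambda>k. f (complex_of_real (radius k) *s x)) \<longlonglongrightarrow> f x" if "norm x \<le> 1" for x
  proof -
    have "(\<lambda>k. radius k *\<^sub>R x) \<longlonglongrightarrow> 1 *\<^sub>R x" by (intro tendsto_intros radius(4))
    then have "(\<lambda>k. complex_of_real (radius k) *s x) \<longlonglongrightarrow> x" by (simp add: smult_of_real_vec)
    with c that in1[OF that] show ?thesis
      by (intro continuous_on_tendsto_compose[OF c]) auto
  qed
  have "bounded (f ` cball 0 1)" by (intro compact_imp_bounded compact_continuous_image c compact_cball)
  then obtain B where "\<forall>y\<in>f ` cball 0 1. cmod y \<le> B" unfolding bounded_iff by (elim exE)
  then have B: "cmod (f x) \<le> B" if "norm x \<le> 1" for x using that by simp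
  show "(\<lambda>k. sphere_norm2 (\<lambda>x. f (complex_of_real (radius k) *s x))) \<longlonglongrightarrow> sphere_norm2 f"
    by (rule sphere_norm2_tendsto[OF ck c lim B[OF in1]])
  have "(\<lambda>k. sphere_norm2 (\<lambda>x. f x - f (complex_of_real (radius k) *s x))) \<longlonglongrightarrow> sphere_norm2 (\<lambda>x :: complex ^ 'n. 0 :: complex)"
  proof (rule sphere_norm2_tendsto)
    show "(\<lambda>k. f x - f (complex_of_real (radius k) *s x)) \<longlonglongrightarrow> 0" if "norm x \<le> 1" for x
      using tendsto_diff[OF tendsto_const[of "f x"] lim[OF that]] by simp
    show "cmod (f x - f (complex_of_real (radius k) *s x)) \<le> B + B" if "norm x \<le> 1" for k x
      by (rule order_trans[OF norm_triangle_ineq4 add_mono[OF B[OF that] B[OF in1[OF that]]]])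
  qed (intro continuous_intros c ck)+
  then show "(\<lambda>k. sphere_norm2 (\<lambda>x. f x - f (complex_of_real (radius k) *s x))) \<longlonglongrightarrow> 0"
    by (simp add: sphere_norm2_def)
qed

lemma sphere_norm2_dilate_le:
  fixes f :: "complex ^ 'n \<Rightarrow> complex"
  assumes f: "f cholomorphic_on ball 0 1" and c: "continuous_on (cball 0 1) f" and s: "0 \<le> s" "s < 1"
  shows "sphere_norm2 (\<lambda>x. f (complex_of_real s *s x)) \<le> sphere_norm2 f"
proof (rule LIMSEQ_le_const[OF sphere_norm2_dilate_tendsto(1)[OF c]])
  have "\<forall>\<^sub>F k in sequentially. s < radius k" using order_tendstoD(1)[OF radius(4) s(2)] .
  then obtain N where N: "\<And>k. k \<ge> N \<Longrightarrow> s < radius k" unfolding eventually_sequentially by blast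
  show "\<exists>N. \<forall>k\<ge>N. sphere_norm2 (\<lambda>x. f (complex_of_real s *s x)) \<le> sphere_norm2 (\<lambda>x. f (complex_of_real (radius k) *s x))"
  proof (intro exI[of _ N] allI impI)
    fix k assume "k \<ge> N"
    then have "s \<le> radius k" using N by (simp add: less_imp_le)
    from sphere_norm2_dilate_mono[OF f s(1) this radius(2)]
    show "sphere_norm2 (\<lambda>x. f (complex_of_real s *s x)) \<le> sphere_norm2 (\<lambda>x. f (complex_of_real (radius k) *s x))"
      using sphere_norm2_nonneg[of "\<lambda>x. f (complex_of_real (radius k) *s x) - f (complex_of_real s *s x)"] by linarith
  qed
qed

text \<open>The tail estimate with \<open>K = 0\<close>, where no component has to vanish and the
  leading dimension is 1, in the limit of radii tending to 1.\<close>

lemma ball_algebra_point_bound: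
  fixes f :: "complex ^ 'n \<Rightarrow> complex"
  assumes f: "f cholomorphic_on ball 0 1" and c: "continuous_on (cball 0 1) f"
    and \<rho>: "0 \<le> \<rho>" "\<rho> < 1" and z: "norm z \<le> \<rho>"
  shows "(cmod (f z))\<^sup>2 \<le> 1 / (1 - \<rho>\<^sup>2) ^ CARD('n) * sphere_norm2 f"
proof (rule LIMSEQ_le_const)
  have ne: "(1 - \<rho>\<^sup>2) ^ CARD('n) \<noteq> 0" using \<rho> by (simp add: power2_eq_1_iff)
  have "(\<lambda>k. 1 / (1 - (\<rho> / radius k)\<^sup>2) ^ CARD('n)) \<longlonglongrightarrow> 1 / (1 - (\<rho> / 1)\<^sup>2) ^ CARD('n)"
    by (intro tendsto_intros radius(4)) (use ne in auto)
  from tendsto_mult[OF this sphere_norm2_dilate_tendsto(1)[OF c]]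
  show "(\<lambda>k. 1 / (1 - (\<rho> / radius k)\<^sup>2) ^ CARD('n) * sphere_norm2 (\<lambda>x. f (complex_of_real (radius k) *s x)))
     \<longlonglongrightarrow> 1 / (1 - \<rho>\<^sup>2) ^ CARD('n) * sphere_norm2 f" by simp
  have "\<forall>\<^sub>F k in sequentially. \<rho> < radius k" using order_tendstoD(1)[OF radius(4) \<rho>(2)] .
  then obtain N where N: "\<And>k. k \<ge> N \<Longrightarrow> \<rho> < radius k" unfolding eventually_sequentially by blast
  show "\<exists>N. \<forall>k\<ge>N. (cmod (f z))\<^sup>2 \<le> 1 / (1 - (\<rho> / radius k)\<^sup>2) ^ CARD('n) * sphere_norm2 (\<lambda>x. f (complex_of_real (radius k) *s x))"
    using tail_bound[OF f _ \<rho>(1) N radius(2) z, of 0] by (intro exI[of _ N]) auto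
qed

subsection \<open>The Hardy space of a ball\<close>

lemma L2_norm_nonneg: "L2_norm M g \<ge> 0"
  by (simp add: L2_norm_def)

text \<open>Minkowski's inequality from the pointwise bound with weights \<open>1 + t\<close> and
  \<open>1 + 1 / t\<close>, integrated and then optimised over \<open>t\<close>.\<close>

lemma L2_add:
  assumes f: "f \<in> L2 M" and g: "g \<in> L2 M"
  shows "(\<lambda>x. f x + g x) \<in> L2 M"
    and "L2_norm M (\<lambda>x. f x + g x) \<le> L2_norm M f + L2_norm M g"
proof -
  have [measurable]: "f \<in> borel_measurable M" "g \<in> borel_measurable M" using f g by (auto simp: L2_def)
  have i: "integrable M (\<lambda>x. (cmod (f x))\<^sup>2)" "integrable M (\<lambda>x. (cmod (g x))\<^sup>2)"
    using f g by (auto simp: L2_def)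
  have pw: "(cmod (f x + g x))\<^sup>2 \<le> (1 + t) * (cmod (f x))\<^sup>2 + (1 + 1 / t) * (cmod (g x))\<^sup>2" if t: "t > 0" for t x
  proof -
    have "(cmod (f x + g x))\<^sup>2 \<le> (cmod (f x) + cmod (g x))\<^sup>2" by (intro power_mono norm_triangle_ineq) auto
    also have "\<dots> = (cmod (f x))\<^sup>2 + (cmod (g x))\<^sup>2 + 2 * cmod (f x) * cmod (g x)" by (simp add: power2_sum)
    also have "2 * cmod (f x) * cmod (g x) \<le> t * (cmod (f x))\<^sup>2 + (cmod (g x))\<^sup>2 / t"
    proof -
      have "0 \<le> (t * cmod (f x) - cmod (g x))\<^sup>2 / t" using t by simp
      also have "\<dots> = t * (cmod (f x))\<^sup>2 + (cmod (g x))\<^sup>2 / t - 2 * cmod (f x) * cmod (g x)"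
        using t by (simp add: power2_diff field_simps power2_eq_square)
      finally show ?thesis by simp
    qed
    finally show ?thesis by (simp add: algebra_simps)
  qed
  have int: "integrable M (\<lambda>x. (cmod (f x + g x))\<^sup>2)"
  proof (rule Bochner_Integration.integrable_bound)
    show "integrable M (\<lambda>x. (1 + 1) * (cmod (f x))\<^sup>2 + (1 + 1 / 1) * (cmod (g x))\<^sup>2)"
      using i by (intro Bochner_Integration.integrable_add integrable_mult_right)
    show "AE x in M. norm ((cmod (f x + g x))\<^sup>2) \<le> norm ((1 + 1) * (cmod (f x))\<^sup>2 + (1 + 1 / 1) * (cmod (g x))\<^sup>2)"
      using pw[of 1] by (intro AE_I2) (simp add: abs_of_nonneg)
  qed measurable
  show "(\<lambda>x. f x + g x) \<in> L2 M" using int by (simp add: L2_def)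
  define A where "A = L2_norm M f"
  define B where "B = L2_norm M g"
  have AB: "A \<ge> 0" "B \<ge> 0" "A\<^sup>2 = (LINT x|M. (cmod (f x))\<^sup>2)" "B\<^sup>2 = (LINT x|M. (cmod (g x))\<^sup>2)"
    by (simp_all add: A_def B_def L2_norm_def)
  have *: "(LINT x|M. (cmod (f x + g x))\<^sup>2) \<le> (1 + t) * A\<^sup>2 + (1 + 1 / t) * B\<^sup>2" if t: "t > 0" for t
  proof -
    have "(LINT x|M. (cmod (f x + g x))\<^sup>2) \<le> (LINT x|M. (1 + t) * (cmod (f x))\<^sup>2 + (1 + 1 / t) * (cmod (g x))\<^sup>2)"
      by (rule integral_mono[OF int _ pw[OF t]])
         (use i in \<open>intro Bochner_Integration.integrable_add integrable_mult_right\<close>)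
    also have "\<dots> = (1 + t) * A\<^sup>2 + (1 + 1 / t) * B\<^sup>2"
      unfolding AB using i by simp
    finally show ?thesis .
  qed
  \<comment> \<open>The optimal weight is \<open>t = B / A\<close>. Adding \<open>e / 2\<close> to
    both norms keeps the weight positive and finite when one of them vanishes.\<close>
  have "(LINT x|M. (cmod (f x + g x))\<^sup>2) \<le> (A + B + e)\<^sup>2" if e: "e > 0" for e
  proof -
    have pos: "A + e / 2 > 0" "B + e / 2 > 0" using AB e by auto
    have "(LINT x|M. (cmod (f x + g x))\<^sup>2)
      \<le> (1 + (B + e/2) / (A + e/2)) * A\<^sup>2 + (1 + 1 / ((B + e/2) / (A + e/2))) * B\<^sup>2"
      using pos by (intro *) auto
    also have "\<dots> \<le> (1 + (B + e/2) / (A + e/2)) * (A + e/2)\<^sup>2 + (1 + 1 / ((B + e/2) / (A + e/2))) * (B + e/2)\<^sup>2"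
      using pos AB e by (intro add_mono mult_left_mono power_mono) auto
    also have "\<dots> = ((A + e/2) + (B + e/2))\<^sup>2"
    proof -
      have "(1 + Y / X) * X\<^sup>2 + (1 + 1 / (Y / X)) * Y\<^sup>2 = (X + Y)\<^sup>2" if "X > 0" "Y > 0" for X Y :: real
        using that by (simp add: power2_eq_square field_simps)
      from this[OF pos] show ?thesis .
    qed
    finally show ?thesis by (simp add: algebra_simps)
  qed
  then have "L2_norm M (\<lambda>x. f x + g x) \<le> A + B + e" if "e > 0" for e
    unfolding L2_norm_def using that AB by (intro real_le_lsqrt) auto
  then show "L2_norm M (\<lambda>x. f x + g x) \<le> L2_norm M f + L2_norm M g"
    unfolding A_def B_def by (rule field_le_epsilon)
qed

lemma L2_cmult:
  assumes "f \<in> L2 M" shows "(\<lambda>x. a * f x) \<in> L2 M" "L2_norm M (\<lambda>x. a * f x) = cmod a * L2_norm M f"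
  using assms by (auto simp: L2_def L2_norm_def norm_mult power_mult_distrib real_sqrt_mult)

lemma L2_diff:
  assumes f: "f \<in> L2 M" and g: "g \<in> L2 M"
  shows "(\<lambda>x. f x - g x) \<in> L2 M"
    and "L2_norm M (\<lambda>x. f x - g x) \<le> L2_norm M f + L2_norm M g"
  using L2_add[OF f L2_cmult(1)[OF g, of "-1"]] L2_cmult(2)[OF g, of "-1"] by auto

lemma L2_norm_commute: "L2_norm M (\<lambda>x. f x - g x) = L2_norm M (\<lambda>x. g x - f x)"
  by (simp add: L2_norm_def norm_minus_commute)

lemma L2_norm_triangle:
  assumes "f \<in> L2 M" "g \<in> L2 M" "h \<in> L2 M"
  shows "L2_norm M (\<lambda>x. f x - h x) \<le> L2_norm M (\<lambda>x. f x - g x) + L2_norm M (\<lambda>x. g x - h x)"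
  using L2_add(2)[OF L2_diff(1)[OF assms(1,2)] L2_diff(1)[OF assms(2,3)]] by simp

lemma L2_norm_triangle_diff:
  assumes "f \<in> L2 M" "g \<in> L2 M"
  shows "L2_norm M f \<le> L2_norm M (\<lambda>x. f x - g x) + L2_norm M g"
  using L2_add(2)[OF L2_diff(1)[OF assms] assms(2)] by simp

section \<open>Transport to the unit ball and boundary functions\<close>

definition to_unit :: "complex ^ 'n \<Rightarrow> real \<Rightarrow> (complex ^ 'n \<Rightarrow> complex) \<Rightarrow> complex ^ 'n \<Rightarrow> complex"
  where "to_unit c R f z = f (c + complex_of_real R *s z)"

context
  fixes c :: "complex ^ 'n" and R :: real
  assumes R: "0 < R"
begin

lemma affine_ball: "c + complex_of_real R *s z \<in> ball c R \<longleftrightarrow> norm z < 1"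
  and affine_cball: "c + complex_of_real R *s z \<in> cball c R \<longleftrightarrow> norm z \<le> 1"
  using R by (simp_all add: dist_norm norm_smult_vec)

lemma affine_inverse: "c + complex_of_real R *s (complex_of_real (1 / R) *s (z - c)) = z"
  using R by (simp add: vector_smult_assoc)

lemma norm_affine_inverse: "norm (complex_of_real (1 / R) *s (z - c)) = dist c z / R"
  unfolding norm_smult_vec dist_norm using R by (simp add: norm_minus_commute norm_divide)

lemma dist_dilate: "0 \<le> s \<Longrightarrow> dist c (c + complex_of_real s *s (x - c)) = s * dist c x"
  unfolding dist_norm by (subst norm_minus_commute) (simp add: norm_smult_vec norm_minus_commute del: vector_ssub_ldistrib)

lemma to_unit_cholomorphic:
  assumes "f cholomorphic_on ball c R"
  shows "to_unit c R f cholomorphic_on ball 0 1"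
  unfolding to_unit_def[abs_def]
  by (rule cholomorphic_on_compose[OF cholomorphic_map_affine assms]) (use affine_ball in auto)

lemma to_unit_continuous:
  assumes "continuous_on (cball c R) f"
  shows "continuous_on (cball 0 1) (to_unit c R f)"
  unfolding to_unit_def[abs_def]
  by (rule continuous_on_compose2[OF assms]) (use affine_cball in \<open>auto intro!: continuous_intros\<close>)

lemma sphere_measure_integral:
  fixes g :: "complex ^ 'n \<Rightarrow> real"
  assumes g: "g \<in> borel_measurable (sphere_measure c R)"
  shows "(LINT x|sphere_measure c R. g x) = (LINT x|unit_ball_measure. g (c + complex_of_real R *s sgn x))"
proof -
  let ?h = "\<lambda>x. c + R *\<^sub>R sgn x"
  let ?D = "distr unit_ball_measure borel ?h"
  have h: "?h \<in> measurable unit_ball_measure borel" by measurable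
  have SM: "sphere_measure c R = restrict_space ?D (sphere c R)"
    by (simp add: sphere_measure_def unit_ball_measure_def)
  have sph: "sphere c R \<in> sets borel" by simp
  have ind: "(\<lambda>x. indicator (sphere c R) x *\<^sub>R g x) \<in> borel_measurable borel"
    using g sph unfolding SM by (subst (asm) borel_measurable_restrict_space_iff) auto
  have "(LINT x|sphere_measure c R. g x) = (LINT x|?D. indicator (sphere c R) x *\<^sub>R g x)"
    unfolding SM using sph by (subst integral_restrict_space) (auto simp: set_lebesgue_integral_def)
  also have "\<dots> = (LINT x|unit_ball_measure. indicator (sphere c R) (?h x) *\<^sub>R g (?h x))"
    by (rule integral_distr[OF h ind])
  \<comment> \<open>The map \<open>?h\<close> misses the sphere only at \<open>x = 0\<close>, which
    it sends to the centre; that point is null.\<close>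
  also have "\<dots> = (LINT x|unit_ball_measure. g (?h x))"
  proof (rule integral_cong_AE)
    have AEq: "AE x in unit_ball_measure. indicator (sphere c R) (?h x) *\<^sub>R g (?h x) = g (?h x)"
      using AE_unit_ball_nonzero by eventually_elim (use R in \<open>simp add: dist_norm norm_sgn\<close>)
    then show "AE x in unit_ball_measure. indicator (sphere c R) (?h x) *\<^sub>R g (?h x) = g (?h x)" .
    show m1: "(\<lambda>x. indicator (sphere c R) (?h x) *\<^sub>R g (?h x)) \<in> borel_measurable unit_ball_measure"
      using measurable_compose[OF h ind] .
    \<comment> \<open>Measurability of \<open>g\<close> is known on the sphere only. Changing the
      composite at the single point 0 restores the value of \<open>g\<close> at the centre.\<close>
    have "(\<lambda>x. if x = 0 then g (?h 0) else indicator (sphere c R) (?h x) *\<^sub>R g (?h x)) \<in> borel_measurable unit_ball_measure"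
      using m1 by (intro measurable_If) auto
    then show "(\<lambda>x. g (?h x)) \<in> borel_measurable unit_ball_measure"
      by (rule measurable_cong[THEN iffD1, rotated]) (use R in \<open>simp add: dist_norm norm_sgn\<close>)
  qed
  finally show ?thesis by (simp add: smult_of_real_vec)
qed

lemma space_sphere_measure: "space (sphere_measure c R) = sphere c R"
  by (simp add: sphere_measure_def space_restrict_space)

lemma finite_measure_sphere: "finite_measure (sphere_measure c R)"
proof -
  have h: "(\<lambda>x. c + R *\<^sub>R sgn x) \<in> measurable unit_ball_measure borel" by measurable
  have "finite_measure (distr unit_ball_measure borel (\<lambda>x. c + R *\<^sub>R sgn x))"
    by (rule unit_ball.finite_measure_distr[OF h])
  then show ?thesis
    unfolding sphere_measure_def unit_ball_measure_def[symmetric]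
    by (intro finite_measure_restrict_space) auto
qed

lemma measurable_on_sphere:
  assumes "continuous_on (sphere c R) f"
  shows "(f :: complex ^ 'n \<Rightarrow> complex) \<in> borel_measurable (sphere_measure c R)"
proof -
  have "f \<in> borel_measurable (restrict_space borel (sphere c R))"
    using assms by (rule borel_measurable_continuous_on_restrict)
  then show ?thesis
    by (rule measurable_cong_sets[THEN equalityD1, THEN subsetD, rotated 2])
       (simp_all add: sphere_measure_def sets_restrict_space)
qed

lemma L2_sphere_bounded:
  fixes f :: "complex ^ 'n \<Rightarrow> complex"
  assumes "f \<in> borel_measurable (sphere_measure c R)" "\<And>x. x \<in> sphere c R \<Longrightarrow> cmod (f x) \<le> B"
  shows "f \<in> L2 (sphere_measure c R)"
  unfolding L2_def
proof (intro CollectI conjI)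
  show "integrable (sphere_measure c R) (\<lambda>x. (cmod (f x))\<^sup>2)"
    using assms
    by (intro finite_measure.integrable_const_bound[OF finite_measure_sphere, where B = "B\<^sup>2"])
       (auto intro!: AE_I2 power_mono simp: space_sphere_measure)
qed (use assms in auto)

lemma continuous_in_L2:
  assumes c: "continuous_on (cball c R) f"
  shows "f \<in> L2 (sphere_measure c R)"
proof -
  have "bounded (f ` cball c R)" by (intro compact_imp_bounded compact_continuous_image c compact_cball)
  then obtain B where "\<forall>y\<in>f ` cball c R. cmod y \<le> B" unfolding bounded_iff by (elim exE)
  then have "\<And>x. x \<in> sphere c R \<Longrightarrow> cmod (f x) \<le> B" by auto
  then show ?thesis
    by (rule L2_sphere_bounded[OF measurable_on_sphere[OF continuous_on_subset[OF c]], rotated]) auto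
qed

lemma L2_norm_continuous:
  assumes c: "continuous_on (cball c R) f"
  shows "(L2_norm (sphere_measure c R) f)\<^sup>2 = sphere_norm2 (to_unit c R f)"
proof -
  have "f \<in> borel_measurable (sphere_measure c R)" using continuous_in_L2[OF c] by (simp add: L2_def)
  then have "(\<lambda>x. (cmod (f x))\<^sup>2) \<in> borel_measurable (sphere_measure c R)" by measurable
  from sphere_measure_integral[OF this]
  show ?thesis by (simp add: L2_norm_def sphere_norm2_def to_unit_def)
qed

lemma ball_algebraD:
  assumes "p \<in> ball_algebra c R"
  shows "p cholomorphic_on ball c R" "continuous_on (cball c R) p"
  using assms by (auto simp: ball_algebra_def Hinfty_def)

lemma ball_algebra_diff:
  assumes "p \<in> ball_algebra c R" "q \<in> ball_algebra c R"
  shows "(\<lambda>x. p x - q x) \<in> ball_algebra c R"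
  using assms unfolding ball_algebra_def Hinfty_def
  by (auto intro!: cholomorphic_on_diff continuous_intros bounded_minus_comp)

text \<open>The bound holds for the approximating elements of the ball algebra. It passes to the
  limit because their norms converge on the sphere and their values converge inside.\<close>

lemma hardy_point_bound:
  assumes f: "hardy_boundary c R f g" and \<rho>: "0 \<le> \<rho>" "\<rho> < 1" and z: "dist c z \<le> \<rho> * R"
  shows "(cmod (f z))\<^sup>2 \<le> 1 / (1 - \<rho>\<^sup>2) ^ CARD('n) * (L2_norm (sphere_measure c R) g)\<^sup>2"
proof -
  let ?M = "sphere_measure c R"
  from f obtain p where g: "g \<in> L2 ?M" and p: "\<And>k. p k \<in> ball_algebra c R"
    and lim: "(\<lambda>k. L2_norm ?M (\<lambda>x. p k x - g x)) \<longlonglongrightarrow> 0"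
    and unif: "\<And>K. compact K \<Longrightarrow> K \<subseteq> ball c R \<Longrightarrow> uniform_limit K p f sequentially"
    unfolding hardy_boundary_def by blast
  have "\<rho> * R < R" using \<rho> R by simp
  then have "uniform_limit {z} p f sequentially" using z by (intro unif) auto
  then have pz: "(\<lambda>k. p k z) \<longlonglongrightarrow> f z" by (rule tendsto_uniform_limitI) simp
  let ?w = "complex_of_real (1 / R) *s (z - c)"
  have w: "norm ?w \<le> \<rho>" using z R unfolding norm_affine_inverse by (simp add: divide_le_eq)
  have bound: "(cmod (p k z))\<^sup>2 \<le> 1 / (1 - \<rho>\<^sup>2) ^ CARD('n) * (L2_norm ?M (\<lambda>x. p k x - g x) + L2_norm ?M g)\<^sup>2" for k
  proof -
    note pk = ball_algebraD[OF p[of k]]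
    have "(cmod (to_unit c R (p k) ?w))\<^sup>2 \<le> 1 / (1 - \<rho>\<^sup>2) ^ CARD('n) * sphere_norm2 (to_unit c R (p k))"
      by (rule ball_algebra_point_bound[OF to_unit_cholomorphic[OF pk(1)] to_unit_continuous[OF pk(2)] \<rho> w])
    then have "(cmod (p k z))\<^sup>2 \<le> 1 / (1 - \<rho>\<^sup>2) ^ CARD('n) * (L2_norm ?M (p k))\<^sup>2"
      unfolding L2_norm_continuous[OF pk(2)] by (simp only: to_unit_def affine_inverse)
    also have "\<dots> \<le> 1 / (1 - \<rho>\<^sup>2) ^ CARD('n) * (L2_norm ?M (\<lambda>x. p k x - g x) + L2_norm ?M g)\<^sup>2"
    proof (rule mult_left_mono)
      show "(L2_norm ?M (p k))\<^sup>2 \<le> (L2_norm ?M (\<lambda>x. p k x - g x) + L2_norm ?M g)\<^sup>2"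
        by (intro power_mono L2_norm_triangle_diff continuous_in_L2 pk g L2_norm_nonneg)
      have "\<rho>\<^sup>2 \<le> 1" using \<rho> by (simp add: power_le_one)
      then show "0 \<le> 1 / (1 - \<rho>\<^sup>2) ^ CARD('n)" by simp
    qed
    finally show ?thesis .
  qed
  have "(\<lambda>k. (cmod (p k z))\<^sup>2) \<longlonglongrightarrow> (cmod (f z))\<^sup>2" by (intro tendsto_intros pz)
  moreover have "(\<lambda>k. 1 / (1 - \<rho>\<^sup>2) ^ CARD('n) * (L2_norm ?M (\<lambda>x. p k x - g x) + L2_norm ?M g)\<^sup>2)
    \<longlonglongrightarrow> 1 / (1 - \<rho>\<^sup>2) ^ CARD('n) * (0 + L2_norm ?M g)\<^sup>2" by (intro tendsto_intros lim)
  ultimately have "(cmod (f z))\<^sup>2 \<le> 1 / (1 - \<rho>\<^sup>2) ^ CARD('n) * (0 + L2_norm ?M g)\<^sup>2"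
    by (rule LIMSEQ_le) (use bound in auto)
  then show ?thesis by simp
qed

lemma hardy_boundary_cholomorphic:
  assumes f: "hardy_boundary c R f g"
  shows "f cholomorphic_on ball c R"
proof -
  from f obtain p where p: "\<And>k. p k \<in> ball_algebra c R"
    and unif: "\<And>K. compact K \<Longrightarrow> K \<subseteq> ball c R \<Longrightarrow> uniform_limit K p f sequentially"
    unfolding hardy_boundary_def by blast
  show ?thesis
  proof (rule cholomorphic_locally_uniform_limit[OF open_ball])
    fix z assume "z \<in> ball c R"
    then have "\<exists>\<delta>>0. cball z \<delta> \<subseteq> ball c R"
      using open_contains_cball[THEN iffD1, OF open_ball] by (rule bspec[rotated])
    then obtain \<delta> where \<delta>: "\<delta> > 0" "cball z \<delta> \<subseteq> ball c R" by (elim exE conjE)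
    have sub: "ball z \<delta> \<subseteq> cball z \<delta>" by (rule ball_subset_cball)
    have "uniform_limit (ball z \<delta>) p f sequentially"
      using uniform_limit_on_subset[OF unif[OF compact_cball \<delta>(2)] sub] .
    moreover have "p k cholomorphic_on ball z \<delta>" for k
      using ball_algebraD(1)[OF p] sub \<delta>(2) by (blast intro: cholomorphic_on_subset)
    ultimately show "\<exists>\<delta>>0. (\<forall>k. p k cholomorphic_on ball z \<delta>) \<and> uniform_limit (ball z \<delta>) p f sequentially"
      using \<delta>(1) by blast
  qed
qed

lemma to_unit_dilate_norm:
  assumes "p \<in> ball_algebra c R" "0 \<le> s" "s < 1"
  shows "sphere_norm2 (\<lambda>x. to_unit c R p (complex_of_real s *s x)) \<le> (L2_norm (sphere_measure c R) p)\<^sup>2"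
  unfolding L2_norm_continuous[OF ball_algebraD(2)[OF assms(1)]]
  by (rule sphere_norm2_dilate_le[OF to_unit_cholomorphic to_unit_continuous assms(2,3)])
     (rule ball_algebraD[OF assms(1)])+

text \<open>The approximants \<open>p k\<close> are close to \<open>f\<close>, and hence bounded by
  about \<open>B\<close>, only on compact subsets, while \<open>g\<close> lives on the boundary. A
  dilation by \<open>s < 1\<close> bridges the gap: it changes a fixed approximant little in norm,
  contracts norms, and takes its values from \<open>cball c (s * R)\<close>.\<close>

lemma hardy_boundary_norm_le:
  assumes f: "hardy_boundary c R f g" and B: "\<And>z. z \<in> ball c R \<Longrightarrow> cmod (f z) \<le> B"
  shows "L2_norm (sphere_measure c R) g \<le> B"
proof -
  let ?M = "sphere_measure c R"
  from f obtain p where g: "g \<in> L2 ?M" and p: "\<And>k. p k \<in> ball_algebra c R"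
    and lim: "(\<lambda>k. L2_norm ?M (\<lambda>x. p k x - g x)) \<longlonglongrightarrow> 0"
    and unif: "\<And>K. compact K \<Longrightarrow> K \<subseteq> ball c R \<Longrightarrow> uniform_limit K p f sequentially"
    unfolding hardy_boundary_def by blast
  note pL2 = continuous_in_L2[OF ball_algebraD(2)[OF p]]
  have B0: "B \<ge> 0" using B[of c] R norm_ge_zero[of "f c"] by (simp del: norm_ge_zero)
  define dil where "dil s q x = q (c + complex_of_real s *s (x - c))" for s and q :: "complex ^ 'n \<Rightarrow> complex" and x
  have dil_in: "c + complex_of_real s *s (x - c) \<in> cball c (s * R)" if "x \<in> cball c R" "0 \<le> s" for s x
    using that by (simp add: dist_dilate mult_left_mono del: vector_ssub_ldistrib)
  have dil_cont: "continuous_on (cball c R) (dil s (p k))" if s: "0 \<le> s" "s < 1" for s k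
    unfolding dil_def[abs_def]
  proof (rule continuous_on_compose2[OF ball_algebraD(2)[OF p]])
    have "s * R \<le> R" using s R by simp
    then show "(\<lambda>x. c + complex_of_real s *s (x - c)) ` cball c R \<subseteq> cball c R"
      using dil_in[OF _ s(1)] subset_cball[of "s * R" R c] by blast
  qed (intro continuous_intros)
  have dil_unit: "to_unit c R (dil s q) = (\<lambda>x. to_unit c R q (complex_of_real s *s x))" for s q
    by (rule ext) (simp add: to_unit_def dil_def vector_smult_assoc mult.commute)
  \<comment> \<open>The chain costs \<open>e\<close> from \<open>g\<close> to \<open>p l\<close>,
    \<open>e\<close> from \<open>p l\<close> to its dilate, \<open>2 * e\<close> from there to the
    dilate of \<open>p k\<close>, and \<open>e\<close> from \<open>p k\<close> to \<open>f\<close>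
    on the smaller ball.\<close>
  have main: "L2_norm ?M g \<le> B + 6 * e" if e: "e > 0" for e
  proof -
    obtain l where l: "\<And>k. k \<ge> l \<Longrightarrow> L2_norm ?M (\<lambda>x. p k x - g x) < e"
      using order_tendstoD(2)[OF lim e] unfolding eventually_sequentially by blast
    have "(\<lambda>k. sphere_norm2 (\<lambda>x. to_unit c R (p l) x - to_unit c R (p l) (complex_of_real (radius k) *s x))) \<longlonglongrightarrow> 0"
      by (rule sphere_norm2_dilate_tendsto(2)[OF to_unit_continuous[OF ball_algebraD(2)[OF p]]])
    from order_tendstoD(2)[OF this, of "e\<^sup>2"] e obtain j where
      j: "sphere_norm2 (\<lambda>x. to_unit c R (p l) x - to_unit c R (p l) (complex_of_real (radius j) *s x)) < e\<^sup>2"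
      unfolding eventually_sequentially by auto
    define s where "s = radius j"
    have s: "0 \<le> s" "s < 1" using radius by (auto simp: s_def)
    have d1: "L2_norm ?M (\<lambda>x. p l x - dil s (p l) x) \<le> e"
    proof -
      have "to_unit c R (\<lambda>x. p l x - dil s (p l) x) = (\<lambda>x. to_unit c R (p l) x - to_unit c R (dil s (p l)) x)"
        by (simp add: to_unit_def[abs_def])
      then have "(L2_norm ?M (\<lambda>x. p l x - dil s (p l) x))\<^sup>2 \<le> e\<^sup>2"
        unfolding L2_norm_continuous[OF continuous_on_diff[OF ball_algebraD(2)[OF p] dil_cont[OF s]]]
        using j by (simp add: dil_unit s_def)
      then show ?thesis using e by (simp add: power2_le_iff_abs_le L2_norm_nonneg)
    qed
    have "s * R < R" using s R by simp
    then have "cball c (s * R) \<subseteq> ball c R" by auto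
    from uniform_limitD[OF unif[OF compact_cball this] e]
    obtain k0 where k0: "\<And>k x. k \<ge> k0 \<Longrightarrow> x \<in> cball c (s * R) \<Longrightarrow> dist (p k x) (f x) < e"
      unfolding eventually_sequentially by blast
    define k where "k = max k0 l"
    have k: "k \<ge> k0" "k \<ge> l" by (auto simp: k_def)
    have d3: "L2_norm ?M (dil s (p k)) \<le> B + e"
    proof -
      have "(L2_norm ?M (dil s (p k)))\<^sup>2 \<le> (B + e)\<^sup>2"
        unfolding L2_norm_continuous[OF dil_cont[OF s]]
      proof (rule sphere_norm2_le[OF to_unit_continuous[OF dil_cont[OF s]]])
        fix x :: "complex ^ 'n" assume "norm x \<le> 1"
        then have "c + complex_of_real R *s x \<in> cball c R" by (simp only: affine_cball)
        from dil_in[OF this s(1)] have y: "c + complex_of_real s *s (c + complex_of_real R *s x - c) \<in> cball c (s * R)" (is "?y \<in> _") .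
        have "cmod (p k ?y) \<le> cmod (f ?y) + dist (p k ?y) (f ?y)"
          using norm_triangle_ineq2[of "p k ?y" "f ?y"] by (simp add: dist_norm)
        also have "\<dots> \<le> B + e"
          using B[of ?y] k0[OF k(1) y] y \<open>cball c (s * R) \<subseteq> ball c R\<close> by (intro add_mono) auto
        finally show "cmod (to_unit c R (dil s (p k)) x) \<le> B + e" by (simp add: to_unit_def dil_def)
      qed
      then show ?thesis using e B0 by (simp add: power2_le_iff_abs_le L2_norm_nonneg)
    qed
    have d2: "L2_norm ?M (\<lambda>x. dil s (p l) x - dil s (p k) x) \<le> e + e"
    proof -
      have "to_unit c R (\<lambda>x. dil s (p l) x - dil s (p k) x) = (\<lambda>x. to_unit c R (dil s (p l)) x - to_unit c R (dil s (p k)) x)"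
        by (simp add: to_unit_def[abs_def])
      then have "(L2_norm ?M (\<lambda>x. dil s (p l) x - dil s (p k) x))\<^sup>2
          = sphere_norm2 (\<lambda>x. to_unit c R (\<lambda>x. p l x - p k x) (complex_of_real s *s x))"
        unfolding L2_norm_continuous[OF continuous_on_diff[OF dil_cont[OF s] dil_cont[OF s]]]
        unfolding dil_unit by (simp add: to_unit_def[abs_def])
      also have "\<dots> \<le> (L2_norm ?M (\<lambda>x. p l x - p k x))\<^sup>2"
        by (rule to_unit_dilate_norm[OF ball_algebra_diff[OF p p] s])
      finally have "L2_norm ?M (\<lambda>x. dil s (p l) x - dil s (p k) x) \<le> L2_norm ?M (\<lambda>x. p l x - p k x)"
        by (simp add: power2_le_iff_abs_le L2_norm_nonneg)
      also have "\<dots> \<le> L2_norm ?M (\<lambda>x. p l x - g x) + L2_norm ?M (\<lambda>x. g x - p k x)"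
        by (rule L2_norm_triangle[OF pL2 g pL2])
      also have "\<dots> \<le> e + e"
        using l[of l] l[OF k(2)] L2_norm_commute[of ?M g "p k"] by (intro add_mono) auto
      finally show ?thesis .
    qed
    note dL2 = continuous_in_L2[OF dil_cont[OF s]]
    have "L2_norm ?M g \<le> L2_norm ?M (\<lambda>x. g x - p l x) + L2_norm ?M (p l)"
      by (rule L2_norm_triangle_diff[OF g pL2])
    moreover have "L2_norm ?M (p l) \<le> L2_norm ?M (\<lambda>x. p l x - dil s (p l) x) + L2_norm ?M (dil s (p l))"
      by (rule L2_norm_triangle_diff[OF pL2 dL2])
    moreover have "L2_norm ?M (dil s (p l)) \<le> L2_norm ?M (\<lambda>x. dil s (p l) x - dil s (p k) x) + L2_norm ?M (dil s (p k))"
      by (rule L2_norm_triangle_diff[OF dL2 dL2])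
    ultimately show ?thesis
      using d1 d2 d3 l[of l] L2_norm_commute[of ?M g "p l"] e by linarith
  qed
  show ?thesis
  proof (rule field_le_epsilon)
    fix e :: real assume "e > 0"
    then show "L2_norm ?M g \<le> B + e" using main[of "e / 6"] by simp
  qed
qed

text \<open>The dilates of a bounded \<open>f\<close> belong to the ball algebra and have
  increasing, bounded norms, so they form an L2-Cauchy sequence. A subsequence converges almost
  everywhere on the sphere; its limit is the boundary function, with convergence in norm by
  domination.\<close>

lemma hardy_boundary_exists:
  assumes f: "f cholomorphic_on ball c R" and B: "\<And>z. z \<in> ball c R \<Longrightarrow> cmod (f z) \<le> B"
  obtains g where "hardy_boundary c R f g"
proof -
  let ?M = "sphere_measure c R"
  interpret M: finite_measure ?M by (rule finite_measure_sphere)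
  let ?u = "to_unit c R f"
  have u: "?u cholomorphic_on ball 0 1" by (rule to_unit_cholomorphic[OF f])
  define p where "p k x = f (c + complex_of_real (radius k) *s (x - c))" for k x
  have in_c: "c + complex_of_real (radius k) *s (x - c) \<in> cball c (radius k * R)" if "x \<in> cball c R" for k x
    using that radius(1)[of k] by (simp add: dist_dilate mult_left_mono del: vector_ssub_ldistrib)
  have rR: "radius k * R < R" for k using R radius(2)[of k] by simp
  have in_b: "c + complex_of_real (radius k) *s (x - c) \<in> ball c R" if "x \<in> cball c R" for k x
    using in_c[OF that, of k] rR[of k] by auto
  have p_cont: "continuous_on (cball c R) (p k)" for k
    unfolding p_def[abs_def]
    by (rule continuous_on_compose2[OF cholomorphic_on_imp_continuous_on[OF f]])
       (use in_b in \<open>auto intro!: continuous_intros\<close>)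
  have p_bd: "cmod (p k x) \<le> B" if "x \<in> cball c R" for k x
    unfolding p_def by (rule B[OF in_b[OF that]])
  have p_alg: "p k \<in> ball_algebra c R" for k
  proof -
    have "(\<lambda>x. f ((c - complex_of_real (radius k) *s c) + complex_of_real (radius k) *s x)) cholomorphic_on ball c R"
      by (rule cholomorphic_on_compose[OF cholomorphic_map_affine f])
         (use in_b[of _ k] in \<open>auto simp: vector_ssub_ldistrib algebra_simps\<close>)
    then have "p k cholomorphic_on ball c R"
      by (simp add: p_def[abs_def] vector_ssub_ldistrib algebra_simps)
    moreover have "bounded (p k ` ball c R)" unfolding bounded_iff using p_bd by (intro exI[of _ B]) auto
    ultimately show ?thesis using p_cont by (simp add: ball_algebra_def Hinfty_def)
  qed
  define \<phi> where "\<phi> k = sphere_norm2 (\<lambda>x. ?u (complex_of_real (radius k) *s x))" for k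
  have p_unit: "to_unit c R (\<lambda>x. p k x - p j x)
      = (\<lambda>x. ?u (complex_of_real (radius k) *s x) - ?u (complex_of_real (radius j) *s x))" for k j
    by (rule ext) (simp add: to_unit_def p_def vector_smult_assoc mult.commute)
  have dist_le: "(L2_norm ?M (\<lambda>x. p k x - p j x))\<^sup>2 \<le> \<phi> k - \<phi> j" if "j \<le> k" for j k
  proof -
    have "(L2_norm ?M (\<lambda>x. p k x - p j x))\<^sup>2
      = sphere_norm2 (\<lambda>x. ?u (complex_of_real (radius k) *s x) - ?u (complex_of_real (radius j) *s x))"
      unfolding L2_norm_continuous[OF continuous_on_diff[OF p_cont p_cont]] p_unit ..
    also have "\<dots> \<le> \<phi> k - \<phi> j"
      unfolding \<phi>_def by (rule sphere_norm2_dilate_mono[OF u radius(1) radius(3)[OF that] radius(2)])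
    finally show ?thesis .
  qed
  have "incseq \<phi>"
  proof (rule incseq_SucI)
    fix j show "\<phi> j \<le> \<phi> (Suc j)" using order_trans[OF zero_le_power2 dist_le[of j "Suc j"]] by simp
  qed
  moreover have "\<phi> k \<le> B\<^sup>2" for k
    unfolding \<phi>_def
  proof (rule sphere_norm2_le[OF continuous_on_dilate[OF u radius(1,2)]])
    fix x :: "complex ^ 'n" assume "norm x \<le> 1"
    from dilate_in_ball[OF this radius(1,2), of k]
    show "cmod (?u (complex_of_real (radius k) *s x)) \<le> B" unfolding to_unit_def by (intro B) (simp only: affine_ball)
  qed
  ultimately obtain \<phi>0 where "\<phi> \<longlonglongrightarrow> \<phi>0" using incseq_convergent[of \<phi> "B\<^sup>2"] by blast
  then have "Cauchy \<phi>" by (rule LIMSEQ_imp_Cauchy)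
  have cauchy: "\<exists>N. \<forall>i\<ge>N. \<forall>j\<ge>N. L2_norm ?M (\<lambda>x. p i x - p j x) < e" if e: "e > 0" for e
  proof -
    obtain N where N: "\<And>i j. i \<ge> N \<Longrightarrow> j \<ge> N \<Longrightarrow> norm (\<phi> i - \<phi> j) < e\<^sup>2"
      using CauchyD[OF \<open>Cauchy \<phi>\<close>, of "e\<^sup>2"] e by auto
    have *: "L2_norm ?M (\<lambda>x. p i x - p j x) < e" if "i \<ge> N" "j \<ge> N" "j \<le> i" for i j
    proof -
      have "(L2_norm ?M (\<lambda>x. p i x - p j x))\<^sup>2 < e\<^sup>2"
        using dist_le[OF that(3)] N[OF that(1,2)] by (simp add: abs_less_iff)
      then show ?thesis using e by (simp add: power2_less_imp_less)
    qed
    show ?thesis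
    proof (intro exI[of _ N] allI impI)
      fix i j assume "N \<le> i" "N \<le> j"
      then show "L2_norm ?M (\<lambda>x. p i x - p j x) < e"
        using *[of i j] *[of j i] L2_norm_commute[of ?M "p i" "p j"] by (cases "j \<le> i") auto
    qed
  qed
  have pm [measurable]: "p k \<in> borel_measurable ?M" for k
    using continuous_in_L2[OF p_cont] by (simp add: L2_def)
  have int: "integrable ?M (p k)" for k
    by (rule M.integrable_const_bound[where B = B]) (use p_bd in \<open>auto intro!: AE_I2 simp: space_sphere_measure\<close>)
  \<comment> \<open>Nonnegativity of the variance of \<open>cmod (p i x - p j x)\<close> under a
    probability measure. The almost everywhere convergent subsequence is extracted from a sequence
    that is Cauchy in L1.\<close>
  have L1: "(LINT x|?M. norm (p i x - p j x)) \<le> L2_norm ?M (\<lambda>x. p i x - p j x)" for i j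
  proof -
    let ?h = "\<lambda>x. p i x - p j x"
    have hc: "continuous_on (cball c R) ?h" by (intro continuous_intros p_cont)
    have h: "(\<lambda>x. cmod (?h x)) \<in> borel_measurable ?M" by measurable
    let ?v = "to_unit c R ?h"
    have vi: "integrable unit_ball_measure (\<lambda>x. cmod (?v (sgn x)))"
      by (rule integrable_sgn_continuous[of "\<lambda>x. cmod (?v x)"]) (intro continuous_intros to_unit_continuous[OF hc])
    have vi2: "integrable unit_ball_measure (\<lambda>x. (cmod (?v (sgn x)))\<^sup>2)"
      by (rule integrable_sgn_continuous[of "\<lambda>x. (cmod (?v x))\<^sup>2"]) (intro continuous_intros to_unit_continuous[OF hc])
    define A where "A = (LINT x|unit_ball_measure. cmod (?v (sgn x)))"
    have "0 \<le> (LINT x|unit_ball_measure. (cmod (?v (sgn x)) - A)\<^sup>2)" by simp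
    also have "\<dots> = (LINT x|unit_ball_measure. (cmod (?v (sgn x)))\<^sup>2 - 2 * A * cmod (?v (sgn x)) + A\<^sup>2)"
      by (simp add: power2_diff algebra_simps)
    also have "\<dots> = sphere_norm2 ?v - 2 * A * A + A\<^sup>2"
      using vi vi2 by (simp add: sphere_norm2_def A_def)
    finally have "A\<^sup>2 \<le> (L2_norm ?M ?h)\<^sup>2" unfolding L2_norm_continuous[OF hc] by (simp add: power2_eq_square)
    then have "A \<le> L2_norm ?M ?h" using L2_norm_nonneg power2_le_imp_le by blast
    then show ?thesis using sphere_measure_integral[OF h] by (simp add: A_def to_unit_def)
  qed
  obtain r where r: "strict_mono r" and ae: "AE x in ?M. Cauchy (\<lambda>i. p (r i) x)"
  proof (rule cauchy_L1_AE_cauchy_subseq[of ?M p])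
    fix e :: real assume "e > 0"
    from cauchy[OF this] L1 show "\<exists>N. \<forall>i\<ge>N. \<forall>j\<ge>N. LINT x|?M. norm (p i x - p j x) < e"
      by (meson le_less_trans)
  qed (use int that in auto)
  \<comment> \<open>Where the subsequence diverges \<open>lim\<close> is an arbitrary value; this
    happens on a null set only.\<close>
  define g where "g x = lim (\<lambda>i. p (r i) x)" for x
  have gm [measurable]: "g \<in> borel_measurable ?M" unfolding g_def[abs_def] by measurable
  have gl: "AE x in ?M. (\<lambda>i. p (r i) x) \<longlonglongrightarrow> g x"
    using ae by eventually_elim (simp add: g_def Cauchy_convergent convergent_LIMSEQ_iff[symmetric])
  have gB: "AE x in ?M. cmod (g x) \<le> B"
    using gl AE_space
  proof eventually_elim
    case (elim x)
    show ?case
      by (rule LIMSEQ_le_const2[OF tendsto_norm[OF elim(1)]])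
         (use p_bd elim(2) in \<open>auto simp: space_sphere_measure\<close>)
  qed
  have gL2: "g \<in> L2 ?M"
    unfolding L2_def
  proof (intro CollectI conjI gm)
    show "integrable ?M (\<lambda>x. (cmod (g x))\<^sup>2)"
    proof (rule M.integrable_const_bound[where B = "B\<^sup>2"])
      show "AE x in ?M. norm ((cmod (g x))\<^sup>2) \<le> B\<^sup>2" using gB by eventually_elim (auto intro: power_mono)
    qed measurable
  qed
  have "(\<lambda>k. LINT x|?M. (cmod (p (r k) x - g x))\<^sup>2) \<longlonglongrightarrow> (LINT x|?M. 0)"
  proof (rule integral_dominated_convergence[where w = "\<lambda>_. (B + B)\<^sup>2"])
    show "AE x in ?M. (\<lambda>k. (cmod (p (r k) x - g x))\<^sup>2) \<longlonglongrightarrow> 0"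
      using gl by eventually_elim (auto intro!: tendsto_eq_intros simp: LIM_zero_iff)
    show "AE x in ?M. norm ((cmod (p (r k) x - g x))\<^sup>2) \<le> (B + B)\<^sup>2" for k
      using gB AE_space
    proof eventually_elim
      case (elim x)
      have "cmod (p (r k) x - g x) \<le> B + B"
        by (rule order_trans[OF norm_triangle_ineq4 add_mono]) (use p_bd elim in \<open>auto simp: space_sphere_measure\<close>)
      then have "(cmod (p (r k) x - g x))\<^sup>2 \<le> (B + B)\<^sup>2" by (rule power_mono) simp
      then show ?case by (simp only: real_norm_def abs_power2)
    qed
  qed auto
  then have "(\<lambda>k. sqrt (LINT x|?M. (cmod (p (r k) x - g x))\<^sup>2)) \<longlonglongrightarrow> sqrt 0"
    by (intro tendsto_intros) simp
  then have l2: "(\<lambda>k. L2_norm ?M (\<lambda>x. p (r k) x - g x)) \<longlonglongrightarrow> 0" by (simp add: L2_norm_def)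
  have unif: "uniform_limit K p f sequentially" if K: "compact K" "K \<subseteq> ball c R" for K
  proof (rule uniform_limitI)
    fix e :: real assume e: "e > 0"
    obtain \<rho> where \<rho>: "0 < \<rho>" "\<rho> < R" "K \<subseteq> cball c \<rho>"
    proof (cases "K = {}")
      case True
      then show ?thesis using that[of "R / 2"] R by simp
    next
      case False
      obtain x where x: "x \<in> K" "\<And>y. y \<in> K \<Longrightarrow> dist c y \<le> dist c x"
        using distance_attains_sup[OF K(1) False, of c] by blast
      have "dist c x < R" using x(1) K(2) by auto
      then show ?thesis using that[of "max (dist c x) (R / 2)"] x R by fastforce
    qed
    have "uniformly_continuous_on (cball c \<rho>) f"
      using \<rho> cholomorphic_on_imp_continuous_on[OF f]
      by (intro compact_uniformly_continuous compact_cball) (auto intro: continuous_on_subset)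
    then obtain d where d: "d > 0"
      "\<And>x y. x \<in> cball c \<rho> \<Longrightarrow> y \<in> cball c \<rho> \<Longrightarrow> dist y x < d \<Longrightarrow> dist (f y) (f x) < e"
      using e unfolding uniformly_continuous_on_def by metis
    have "(\<lambda>k. (1 - radius k) * R) \<longlonglongrightarrow> (1 - 1) * R" by (intro tendsto_intros radius(4))
    then have "(\<lambda>k. (1 - radius k) * R) \<longlonglongrightarrow> 0" by simp
    from order_tendstoD(2)[OF this d(1)]
    show "\<forall>\<^sub>F k in sequentially. \<forall>x\<in>K. dist (p k x) (f x) < e"
    proof eventually_elim
      case (elim k)
      show ?case
      proof
        fix x assume x: "x \<in> K"
        then have x\<rho>: "x \<in> cball c \<rho>" using \<rho> by blast
        let ?y = "c + complex_of_real (radius k) *s (x - c)"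
        have "dist c ?y = radius k * dist c x"
          by (rule dist_dilate[OF radius(1)])
        also have "\<dots> \<le> 1 * dist c x" using radius(2)[of k] by (intro mult_right_mono) auto
        finally have y: "?y \<in> cball c \<rho>" using x\<rho> by simp
        have "x - ?y = complex_of_real (1 - radius k) *s (x - c)"
          by (simp add: vector_sub_rdistrib)
        then have "norm (x - ?y) = cmod (complex_of_real (1 - radius k)) * norm (x - c)"
          by (simp only: norm_smult_vec)
        then have "dist ?y x = (1 - radius k) * dist c x"
          unfolding norm_of_real using radius(2)[of k]
          by (simp only: dist_norm norm_minus_commute[of _ x] norm_minus_commute[of c] abs_of_nonneg diff_ge_0_iff_ge less_imp_le)
        also have "\<dots> \<le> (1 - radius k) * R"
          using radius(2)[of k] x\<rho> \<rho> by (intro mult_left_mono) auto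
        finally have "dist ?y x < d" using elim by simp
        from d(2)[OF x\<rho> y this] show "dist (p k x) (f x) < e" by (simp add: p_def)
      qed
    qed
  qed
  have "uniform_limit K (\<lambda>k. p (r k)) f sequentially" if K: "compact K" "K \<subseteq> ball c R" for K
    using filterlim_compose[OF unif[OF K] filterlim_subseq[OF r]] .
  then have "hardy_boundary c R f g"
    unfolding hardy_boundary_def using gL2 p_alg l2 by (intro conjI exI[of _ "\<lambda>k. p (r k)"]) auto
  then show ?thesis by (rule that)
qed

lemma bounded_in_hardy_space:
  assumes f: "f cholomorphic_on ball c R" and B: "\<And>z. z \<in> ball c R \<Longrightarrow> cmod (f z) \<le> B"
    and 0: "\<And>z. z \<notin> ball c R \<Longrightarrow> f z = 0"
  shows "f \<in> hardy_space c R" "hardy_norm c R f \<le> B"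
proof -
  obtain g where g: "hardy_boundary c R f g" using hardy_boundary_exists[OF f B] .
  then show "f \<in> hardy_space c R" using 0 by (auto simp: hardy_space_def)
  have "hardy_boundary c R f (SOME g. hardy_boundary c R f g)" using g by (rule someI[where P = "hardy_boundary c R f"])
  from hardy_boundary_norm_le[OF this B] show "hardy_norm c R f \<le> B" by (simp add: hardy_norm_def)
qed

lemma hardy_space_point_bound:
  assumes f: "f \<in> hardy_space c R" and \<rho>: "0 \<le> \<rho>" "\<rho> < 1" and z: "dist c z \<le> \<rho> * R"
  shows "(cmod (f z))\<^sup>2 \<le> 1 / (1 - \<rho>\<^sup>2) ^ CARD('n) * (hardy_norm c R f)\<^sup>2"
proof -
  obtain g where "hardy_boundary c R f g" using f by (auto simp: hardy_space_def)
  then have "hardy_boundary c R f (SOME g. hardy_boundary c R f g)" by (rule someI[where P = "hardy_boundary c R f"])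
  from hardy_point_bound[OF this \<rho> z] show ?thesis by (simp add: hardy_norm_def)
qed

lemma hardy_space_cholomorphic: "f \<in> hardy_space c R \<Longrightarrow> f cholomorphic_on ball c R"
  using hardy_boundary_cholomorphic by (auto simp: hardy_space_def)

lemma hardy_norm_nonneg: "hardy_norm c R f \<ge> 0"
  by (simp add: hardy_norm_def L2_norm_nonneg)

end

subsection \<open>A Weyl inequality for triangular matrices\<close>

text \<open>Padding the fewer than \<open>n\<close> equations with zero rows gives a square matrix
  with vanishing last row. Its determinant is 0 by expansion along that row, so it has a nonzero
  kernel vector.\<close>

lemma underdetermined_system:
  fixes C :: "(nat \<Rightarrow> complex) set"
  assumes C: "finite C" "card C < n"
  obtains x :: "nat \<Rightarrow> complex" where "\<exists>i<n. x i \<noteq> 0" "\<And>c. c \<in> C \<Longrightarrow> (\<Sum>j<n. c j * x j) = 0"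
proof -
  obtain cs where cs: "bij_betw cs {0..<card C} C" using ex_bij_betw_nat_finite[OF C(1)] by blast
  define A where "A = mat n n (\<lambda>(i, j). if i < card C then cs i j else 0)"
  have A: "A \<in> carrier_mat n n" by (simp add: A_def)
  have n: "n - 1 < n" "\<not> n - 1 < card C" using C by auto
  have "Determinant.det A = (\<Sum>j<n. A $$ (n - 1, j) * cofactor A (n - 1) j)"
    by (rule laplace_expansion_row[OF A n(1)])
  also have "\<dots> = 0" by (rule sum.neutral) (use n in \<open>auto simp: A_def\<close>)
  finally obtain v where v: "v \<in> carrier_vec n" "v \<noteq> 0\<^sub>v n" "A *\<^sub>v v = 0\<^sub>v n"
    using det_0_iff_vec_prod_zero[OF A] by blast
  show ?thesis
  proof (rule that[of "\<lambda>i. Matrix.vec_index v i"])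
    show "\<exists>i<n. Matrix.vec_index v i \<noteq> 0"
    proof (rule ccontr)
      assume "\<not> (\<exists>i<n. Matrix.vec_index v i \<noteq> 0)"
      then have "v = 0\<^sub>v n" using v(1) by (intro eq_vecI) auto
      with v(2) show False by simp
    qed
    fix c assume "c \<in> C"
    then have "c \<in> cs ` {0..<card C}" using cs by (simp add: bij_betw_def)
    then obtain k where k: "k < card C" "c = cs k" by auto
    then have kn: "k < n" using C(2) by simp
    have "Matrix.vec_index (A *\<^sub>v v) k = (\<Sum>j<n. c j * Matrix.vec_index v j)"
      using kn k v(1) by (simp add: A_def scalar_prod_def lessThan_atLeast0)
    then show "(\<Sum>j<n. c j * Matrix.vec_index v j) = 0" using v(3) kn by simp
  qed
qed

lemma det_mult3:
  assumes "A \<in> carrier_mat n n" "B \<in> carrier_mat n n" "D \<in> carrier_mat n n"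
  shows "Determinant.det (A * (B * D)) = Determinant.det A * (Determinant.det B * Determinant.det (D :: complex mat))"
  using assms Determinant.det_mult[of A n "B * D"] Determinant.det_mult[of B n D] by simp

text \<open>Coordinates on a finite-dimensional inner product space: \<open>\<Gamma>\<close> is the
  Gram matrix of a basis that is not assumed orthonormal, because the triangular basis of
  generalised eigenvectors is not.\<close>

locale gram =
  fixes n :: nat and \<Gamma> :: "nat \<Rightarrow> nat \<Rightarrow> complex"
  assumes \<Gamma>_hermitian: "\<And>i j. i < n \<Longrightarrow> j < n \<Longrightarrow> \<Gamma> i j = cnj (\<Gamma> j i)"
    and \<Gamma>_pos: "\<And>x. \<exists>i<n. x i \<noteq> 0 \<Longrightarrow> 0 < Re (\<Sum>i<n. \<Sum>j<n. x i * cnj (x j) * \<Gamma> i j)"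
begin

definition form :: "(nat \<Rightarrow> complex) \<Rightarrow> (nat \<Rightarrow> complex) \<Rightarrow> complex"
  where "form x y = (\<Sum>i<n. \<Sum>j<n. x i * cnj (y j) * \<Gamma> i j)"

lemma cnj_form: "cnj (form x y) = form y x"
proof -
  have "cnj (form x y) = (\<Sum>i<n. \<Sum>j<n. y j * cnj (x i) * \<Gamma> j i)"
    unfolding form_def by (auto intro!: sum.cong simp: \<Gamma>_hermitian[symmetric])
  also have "\<dots> = form y x" unfolding form_def by (rule sum.swap)
  finally show ?thesis .
qed

lemma form_diff_scale_left: "form (\<lambda>i. x i - s * z i) y = form x y - s * form z y"
  unfolding form_def by (simp add: algebra_simps sum_subtractf sum_distrib_left)

lemma form_diff_scale_right: "form y (\<lambda>i. x i - s * z i) = form y x - cnj s * form y z"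
  using arg_cong[OF form_diff_scale_left[of x s z y], of cnj] by (simp add: cnj_form)

lemma form_scale: "form (\<lambda>i. s * x i) y = s * form x y" "form y (\<lambda>i. s * x i) = cnj s * form y x"
  unfolding form_def by (simp_all add: algebra_simps sum_distrib_left)

lemma form_real: "form x x = of_real (Re (form x x))"
  using cnj_form[of x x] by (metis Reals_cnj_iff of_real_Re)

lemma form_nonneg: "Re (form x x) \<ge> 0"
proof (cases "\<exists>i<n. x i \<noteq> 0")
  case True
  then show ?thesis using \<Gamma>_pos[OF True] by (simp add: form_def)
next
  case False
  then have "form x x = 0" unfolding form_def by (intro sum.neutral ballI) auto
  then show ?thesis by simp
qed

lemma form_cauchy_schwarz:
  assumes y: "form y y = 1"
  shows "(cmod (form x y))\<^sup>2 \<le> Re (form x x)"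
proof -
  define s where "s = form x y"
  have "form (\<lambda>i. x i - s * y i) (\<lambda>i. x i - s * y i) = form x x - s * cnj s"
    unfolding form_diff_scale_left form_diff_scale_right y cnj_form[of x y, symmetric] s_def[symmetric] by simp
  then have "Re (form (\<lambda>i. x i - s * y i) (\<lambda>i. x i - s * y i)) = Re (form x x) - (cmod s)\<^sup>2"
    by (simp add: complex_norm_square[symmetric] del: of_real_power)
  then show ?thesis using form_nonneg[of "\<lambda>i. x i - s * y i"] by (simp add: s_def)
qed

text \<open>The vectors are built from the last index downwards. The \<open>k\<close>-th has to
  satisfy at most \<open>k\<close> prescribed equations and be orthogonal to the
  \<open>n - 1 - k\<close> later vectors; this is one condition fewer than there are
  unknowns.\<close>

lemma orthonormal_flag:
  assumes C: "\<And>k. k < n \<Longrightarrow> finite (C k) \<and> card (C k) \<le> k"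
  obtains e :: "nat \<Rightarrow> nat \<Rightarrow> complex" where
    "\<And>k. k < n \<Longrightarrow> form (e k) (e k) = 1"
    "\<And>k c. k < n \<Longrightarrow> c \<in> C k \<Longrightarrow> (\<Sum>j<n. c j * e k j) = 0"
    "\<And>k j. k < n \<Longrightarrow> j < n \<Longrightarrow> k \<noteq> j \<Longrightarrow> form (e k) (e j) = 0"
proof -
  let ?P = "\<lambda>e k. form (e k) (e k) = 1 \<and> (\<forall>c\<in>C k. (\<Sum>j<n. c j * e k j) = 0) \<and>
     (\<forall>j. k < j \<and> j < n \<longrightarrow> form (e k) (e j) = 0)"
  have "\<exists>e. \<forall>k. n - m \<le> k \<and> k < n \<longrightarrow> ?P e k" if "m \<le> n" for m
    using that
  proof (induction m)
    case 0
    then show ?case by auto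
  next
    case (Suc m)
    then obtain e where e: "\<And>k. n - m \<le> k \<Longrightarrow> k < n \<Longrightarrow> ?P e k" by auto
    define k where "k = n - Suc m"
    have k: "k < n" "Suc k = n - m" using Suc.prems by (auto simp: k_def)
    \<comment> \<open>The second part expresses orthogonality to the vectors already chosen as
      linear functionals of the coordinates.\<close>
    define D where "D = C k \<union> (\<lambda>j i. \<Sum>l<n. cnj (e j l) * \<Gamma> i l) ` {k<..<n}"
    have "card D \<le> card (C k) + card ((\<lambda>j i. \<Sum>l<n. cnj (e j l) * \<Gamma> i l) ` {k<..<n})"
      unfolding D_def by (rule card_Un_le)
    also have "\<dots> \<le> k + card {k<..<n}" using C[OF k(1)] by (intro add_mono card_image_le) auto
    also have "\<dots> < n" using k by simp
    finally have "card D < n" .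
    moreover have "finite D" using C[OF k(1)] by (simp add: D_def)
    ultimately obtain x where x: "\<exists>i<n. x i \<noteq> 0" "\<And>c. c \<in> D \<Longrightarrow> (\<Sum>j<n. c j * x j) = 0"
      using underdetermined_system by blast
    define q where "q = Re (form x x)"
    have q: "q > 0" using \<Gamma>_pos[OF x(1)] by (simp add: q_def form_def)
    define y where "y i = complex_of_real (1 / sqrt q) * x i" for i
    have yD: "(\<Sum>j<n. c j * y j) = 0" if "c \<in> D" for c
    proof -
      have "(\<Sum>j<n. c j * y j) = complex_of_real (1 / sqrt q) * (\<Sum>j<n. c j * x j)"
        by (simp add: y_def sum_distrib_left mult_ac)
      then show ?thesis using x(2)[OF that] by simp
    qed
    have "form y y = complex_of_real (1 / sqrt q) * complex_of_real (1 / sqrt q) * of_real q"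
      unfolding y_def[abs_def] form_scale q_def form_real[symmetric] by simp
    also have "\<dots> = complex_of_real (1 / sqrt q * (1 / sqrt q) * q)" by (simp only: of_real_mult)
    also have "1 / sqrt q * (1 / sqrt q) * q = 1" using q by simp
    finally have yy: "form y y = 1" by simp
    have yo: "form y (e j) = 0" if "k < j" "j < n" for j
    proof -
      have "form y (e j) = (\<Sum>i<n. (\<Sum>l<n. cnj (e j l) * \<Gamma> i l) * y i)"
        by (simp add: form_def sum_distrib_right sum_distrib_left mult_ac)
      also have "\<dots> = 0" by (rule yD) (use that in \<open>auto simp: D_def\<close>)
      finally show ?thesis .
    qed
    have "?P (e(k := y)) i" if "n - Suc m \<le> i" "i < n" for i
    proof (cases "i = k")
      case True
      then show ?thesis using yy yo yD by (auto simp: D_def)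
    next
      case False
      then have "k < i" "n - m \<le> i" using that k by (auto simp: k_def)
      then show ?thesis using e[of i] that by auto
    qed
    then show ?case by blast
  qed
  from this[of n] obtain e where e: "\<And>k. k < n \<Longrightarrow> ?P e k" by auto
  show ?thesis
  proof (rule that[of e])
    fix k j assume kj: "k < n" "j < n" "k \<noteq> j"
    show "form (e k) (e j) = 0"
    proof (cases "k < j")
      case True
      then show ?thesis using e[of k] kj by auto
    next
      case False
      then have "form (e j) (e k) = 0" using e[of j] kj by auto
      then show ?thesis using cnj_form[of "e j" "e k"] by simp
    qed
  qed (use e in auto)
qed

lemma form_matrix:
  assumes "k < n" "l < n"
  shows "(mat n n (\<lambda>(k, j). cnj (y k j)) * (mat n n (\<lambda>(j, i). \<Gamma> i j) * mat n n (\<lambda>(i, l). x l i))) $$ (k, l) = form (x l) (y k)"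
proof -
  have "(mat n n (\<lambda>(k, j). cnj (y k j)) * (mat n n (\<lambda>(j, i). \<Gamma> i j) * mat n n (\<lambda>(i, l). x l i))) $$ (k, l)
     = (\<Sum>j<n. cnj (y k j) * (\<Sum>i<n. \<Gamma> i j * x l i))"
    using assms by (simp add: scalar_prod_def lessThan_atLeast0)
  also have "\<dots> = (\<Sum>j<n. \<Sum>i<n. x l i * cnj (y k j) * \<Gamma> i j)"
    by (simp add: sum_distrib_left mult_ac)
  also have "\<dots> = form (x l) (y k)" unfolding form_def by (rule sum.swap)
  finally show ?thesis .
qed

lemma det_adjoint: "cmod (Determinant.det (mat n n (\<lambda>(k, j). cnj (y k j)))) = cmod (Determinant.det (mat n n (\<lambda>(i, l). y l i)))"
proof -
  interpret cnj: comm_ring_hom cnj by unfold_locales auto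
  have "mat n n (\<lambda>(k, j). cnj (y k j)) = map_mat cnj (transpose_mat (mat n n (\<lambda>(i, l). y l i)))"
    by (rule eq_matI) auto
  then have "Determinant.det (mat n n (\<lambda>(k, j). cnj (y k j))) = cnj (Determinant.det (transpose_mat (mat n n (\<lambda>(i, l). y l i))))"
    by (simp add: cnj.hom_det)
  also have "Determinant.det (transpose_mat (mat n n (\<lambda>(i, l). y l i))) = Determinant.det (mat n n (\<lambda>(i, l). y l i))"
    by (rule Determinant.det_transpose[of _ n]) simp
  finally show ?thesis by simp
qed

text \<open>
  With \<open>e\<close> adapted to the flag of the functionals and \<open>h\<close> to the flag spanned by the vectors
  \<open>T (e i)\<close>, the matrix of \<open>T\<close> with respect to \<open>e\<close> and \<open>h\<close> is triangular, and its determinant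
  has the same modulus as that of \<open>T\<close> because both bases are orthonormal.
\<close>

lemma weyl_triangular:
  fixes T :: "nat \<Rightarrow> nat \<Rightarrow> complex" and a :: "nat \<Rightarrow> real"
  assumes T: "\<And>i j. j < i \<Longrightarrow> i < n \<Longrightarrow> T i j = 0"
    and C: "\<And>k. k < n \<Longrightarrow> finite (C k) \<and> card (C k) \<le> k"
    and a: "\<And>k x. k < n \<Longrightarrow> (\<And>c. c \<in> C k \<Longrightarrow> (\<Sum>j<n. c j * x j) = 0) \<Longrightarrow>
      Re (form (\<lambda>i. \<Sum>j<n. T i j * x j) (\<lambda>i. \<Sum>j<n. T i j * x j)) \<le> (a k)\<^sup>2 * Re (form x x)"
    and a0: "\<And>k. k < n \<Longrightarrow> 0 \<le> a k"
  shows "(\<Prod>j<n. cmod (T j j)) \<le> (\<Prod>k<n. a k)"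
proof -
  obtain e where e: "\<And>k. k < n \<Longrightarrow> form (e k) (e k) = 1"
    "\<And>k c. k < n \<Longrightarrow> c \<in> C k \<Longrightarrow> (\<Sum>j<n. c j * e k j) = 0"
    "\<And>k j. k < n \<Longrightarrow> j < n \<Longrightarrow> k \<noteq> j \<Longrightarrow> form (e k) (e j) = 0"
    using orthonormal_flag[of C] C by blast
  define Te where "Te l i = (\<Sum>j<n. T i j * e l j)" for l i
  \<comment> \<open>The functionals demand that \<open>h k\<close> be orthogonal to
    \<open>Te j\<close> for \<open>j < k\<close>. There are at most \<open>k\<close> of them, so the
    same flag construction applies.\<close>
  define C' where "C' k = (\<lambda>j i. \<Sum>l<n. cnj (Te j l) * \<Gamma> i l) ` {..<k}" for k
  have C': "finite (C' k) \<and> card (C' k) \<le> k" for k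
    using card_image_le[of "{..<k}"] unfolding C'_def by force
  obtain h where h: "\<And>k. k < n \<Longrightarrow> form (h k) (h k) = 1"
    "\<And>k c. k < n \<Longrightarrow> c \<in> C' k \<Longrightarrow> (\<Sum>j<n. c j * h k j) = 0"
    "\<And>k j. k < n \<Longrightarrow> j < n \<Longrightarrow> k \<noteq> j \<Longrightarrow> form (h k) (h j) = 0"
    using orthonormal_flag[of C'] C' by blast
  have ortho: "form (h k) (Te i) = 0" if "i < k" "k < n" for i k
  proof -
    have "form (h k) (Te i) = (\<Sum>i'<n. (\<Sum>l<n. cnj (Te i l) * \<Gamma> i' l) * h k i')"
      by (simp add: form_def sum_distrib_right sum_distrib_left mult_ac)
    also have "\<dots> = 0" by (rule h(2)) (use that in \<open>auto simp: C'_def\<close>)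
    finally show ?thesis .
  qed
  let ?adj = "\<lambda>y :: nat \<Rightarrow> nat \<Rightarrow> complex. mat n n (\<lambda>(k, j). cnj (y k j))"
  let ?col = "\<lambda>x :: nat \<Rightarrow> nat \<Rightarrow> complex. mat n n (\<lambda>(i, l). x l i)"
  let ?G = "mat n n (\<lambda>(j, i). \<Gamma> i j)"
  let ?T = "mat n n (\<lambda>(i, j). T i j)"
  let ?det = "Determinant.det"
  \<comment> \<open>The Gram matrix of an orthonormal family is the identity. Thus the determinants
    of \<open>e\<close> and \<open>h\<close> have the same modulus, determined by
    \<open>\<Gamma>\<close>.\<close>
  have unit: "(cmod (?det (?col x)))\<^sup>2 * cmod (?det ?G) = 1"
    if x: "\<And>k. k < n \<Longrightarrow> form (x k) (x k) = 1" "\<And>k j. k < n \<Longrightarrow> j < n \<Longrightarrow> k \<noteq> j \<Longrightarrow> form (x k) (x j) = 0" for x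
  proof -
    have "?adj x * (?G * ?col x) = 1\<^sub>m n"
    proof (rule eq_matI)
      fix k l assume "k < dim_row (1\<^sub>m n)" "l < dim_col (1\<^sub>m n)"
      then have kl: "k < n" "l < n" by auto
      show "(?adj x * (?G * ?col x)) $$ (k, l) = 1\<^sub>m n $$ (k, l)"
        unfolding form_matrix[OF kl] using kl x by auto
    qed auto
    then have "?det (?adj x * (?G * ?col x)) = 1" by simp
    moreover have "?det (?adj x * (?G * ?col x)) = ?det (?adj x) * (?det ?G * ?det (?col x))"
      by (rule det_mult3) auto
    ultimately have "cmod (?det (?adj x)) * (cmod (?det ?G) * cmod (?det (?col x))) = 1"
      by (metis norm_mult norm_one)
    then show ?thesis unfolding det_adjoint by (simp add: power2_eq_square mult_ac)
  qed
  have ue: "(cmod (?det (?col e)))\<^sup>2 * cmod (?det ?G) = 1" by (rule unit) (use e in auto)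
  have uh: "(cmod (?det (?col h)))\<^sup>2 * cmod (?det ?G) = 1" by (rule unit) (use h in auto)
  have "cmod (?det ?G) > 0" using ue by (metis mult_zero_right norm_ge_zero order_le_less zero_neq_one)
  with ue uh have "(cmod (?det (?col e)))\<^sup>2 = (cmod (?det (?col h)))\<^sup>2"
    by (metis mult_right_cancel less_irrefl)
  then have same: "cmod (?det (?col e)) = cmod (?det (?col h))" by simp
  let ?A = "?adj h * (?G * ?col Te)"
  have TX: "?col Te = ?T * ?col e"
    by (rule eq_matI) (auto simp: Te_def scalar_prod_def lessThan_atLeast0)
  have "?det ?A = ?det (?adj h) * (?det ?G * (?det ?T * ?det (?col e)))"
    unfolding TX
    by (subst det_mult3[where n = n])
       (auto simp del: mult_carrier_mat simp: Determinant.det_mult[of _ n] intro: mult_carrier_mat[of _ n n])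
  then have "cmod (?det ?A) = cmod (?det (?col h)) * (cmod (?det ?G) * (cmod (?det ?T) * cmod (?det (?col e))))"
    by (simp add: norm_mult det_adjoint)
  also have "\<dots> = cmod (?det ?T) * ((cmod (?det (?col e)))\<^sup>2 * cmod (?det ?G))"
    unfolding same by (simp add: power2_eq_square)
  finally have detA: "cmod (?det ?A) = cmod (?det ?T)" unfolding ue by simp
  have "upper_triangular ?T" using T by (auto simp: upper_triangular_def)
  from det_upper_triangular[OF this, of n] have "?det ?T = prod_list (diag_mat ?T)" by simp
  also have "\<dots> = (\<Prod>j<n. T j j)"
    by (simp add: prod_list_diag_prod lessThan_atLeast0)
  finally have "cmod (?det ?T) = (\<Prod>j<n. cmod (T j j))" by (simp add: prod_norm[symmetric])
  moreover
  have up: "upper_triangular ?A"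
  proof (rule upper_triangularI)
    fix k i assume "i < k" "k < dim_row ?A"
    then have ik: "i < k" "k < n" "i < n" by auto
    have "form (Te i) (h k) = 0" using ortho[OF ik(1,2)] cnj_form[of "h k" "Te i"] by simp
    then show "?A $$ (k, i) = 0" unfolding form_matrix[OF ik(2,3)] .
  qed
  have carr: "?A \<in> carrier_mat n n" by (intro mult_carrier_mat[of _ n n]) auto
  have "?det ?A = prod_list (diag_mat ?A)" by (rule det_upper_triangular[OF up carr])
  then have "?det ?A = (\<Prod>k<n. ?A $$ (k, k))"
    unfolding prod_list_diag_prod carrier_matD(1)[OF carr] lessThan_atLeast0 .
  then have "cmod (?det ?A) = (\<Prod>k<n. cmod (form (Te k) (h k)))"
    by (simp add: prod_norm[symmetric] form_matrix del: index_mult_mat)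
  moreover have "(\<Prod>k<n. cmod (form (Te k) (h k))) \<le> (\<Prod>k<n. a k)"
  proof (rule prod_mono, intro conjI)
    fix k assume "k \<in> {..<n}"
    then have k: "k < n" by simp
    \<comment> \<open>A diagonal entry is at most the norm of the image of \<open>e k\<close>, and
      \<open>e k\<close> is annihilated by \<open>C k\<close>, so the hypothesis on
      \<open>a k\<close> applies.\<close>
    have "(cmod (form (Te k) (h k)))\<^sup>2 \<le> Re (form (Te k) (Te k))" by (rule form_cauchy_schwarz[OF h(1)[OF k]])
    also have "\<dots> \<le> (a k)\<^sup>2 * Re (form (e k) (e k))"
      unfolding Te_def[abs_def] by (rule a[OF k e(2)[OF k]])
    finally have "(cmod (form (Te k) (h k)))\<^sup>2 \<le> (a k)\<^sup>2" using e(1)[OF k] by simp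
    then show "cmod (form (Te k) (h k)) \<le> a k" using a0[OF k] power2_le_imp_le by blast
  qed simp
  ultimately show ?thesis using detA by simp
qed

end

subsection \<open>Triangular families of generalised eigenvectors\<close>

lemma cfun_span_combination:
  fixes b :: "nat \<Rightarrow> 'a \<Rightarrow> complex"
  assumes "f \<in> cfun_span (b ` {..<n})"
  obtains t where "f = (\<lambda>z. \<Sum>i<n. t i * b i z)"
proof -
  have "\<exists>t. f = (\<lambda>z. \<Sum>i<n. t i * b i z)" using assms
  proof (induction n arbitrary: f)
    case 0
    then show ?case by (simp add: zero_fun_def)
  next
    case (Suc n)
    then have "f \<in> cfun_span (insert (b n) (b ` {..<n}))" by (simp add: lessThan_Suc)
    then obtain k where "f - (\<lambda>z. k * b n z) \<in> cfun_span (b ` {..<n})" using cfun.span_breakdown_eq by blast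
    with Suc.IH obtain t where t: "f - (\<lambda>z. k * b n z) = (\<lambda>z. \<Sum>i<n. t i * b i z)" by blast
    have "f = (\<lambda>z. \<Sum>i<Suc n. (t(n := k)) i * b i z)"
    proof
      fix z
      have "f z - k * b n z = (\<Sum>i<n. t i * b i z)" using fun_cong[OF t, of z] by simp
      then show "f z = (\<Sum>i<Suc n. (t(n := k)) i * b i z)" by (simp add: algebra_simps)
    qed
    then show ?case by (intro exI[of _ "t(n := k)"])
  qed
  then show ?thesis using that by blast
qed

lemma cfun_combination_in_span:
  "(\<lambda>z. \<Sum>i<n. t i * b i z) \<in> cfun_span (b ` {..<n})" for b :: "nat \<Rightarrow> 'a \<Rightarrow> complex"
proof -
  have "(\<Sum>i<n. (\<lambda>z. t i * b i z)) \<in> cfun_span (b ` {..<n})"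
    by (intro cfun.span_sum cfun.span_scale cfun.span_base) auto
  moreover have "(\<Sum>i<n. (\<lambda>z. t i * b i z)) = (\<lambda>z. \<Sum>i<n. t i * b i z)" by (rule ext) (simp add: sum_fun_apply)
  ultimately show ?thesis by simp
qed

lemma sum_fun_eq: "(\<Sum>i\<in>A. (\<lambda>z. f i z)) = (\<lambda>z. \<Sum>i\<in>A. f i z)"
  for f :: "'i \<Rightarrow> 'a \<Rightarrow> complex"
  by (rule ext) (simp add: sum_fun_apply)

locale linear_op =
  fixes X :: "('a \<Rightarrow> complex) set" and L :: "('a \<Rightarrow> complex) \<Rightarrow> 'a \<Rightarrow> complex"
  assumes zero: "(\<lambda>_. 0) \<in> X"
    and closed: "\<And>f g a b. f \<in> X \<Longrightarrow> g \<in> X \<Longrightarrow> (\<lambda>x. a * f x + b * g x) \<in> X"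
    and L_in: "\<And>f. f \<in> X \<Longrightarrow> L f \<in> X"
    and L_linear: "\<And>f g a b. f \<in> X \<Longrightarrow> g \<in> X \<Longrightarrow> L (\<lambda>x. a * f x + b * g x) = (\<lambda>x. a * L f x + b * L g x)"
begin

definition shift :: "complex \<Rightarrow> ('a \<Rightarrow> complex) \<Rightarrow> 'a \<Rightarrow> complex"
  where "shift \<nu> = (\<lambda>g x. L g x - \<nu> * g x)"

lemma shift_in: "f \<in> X \<Longrightarrow> shift \<nu> f \<in> X"
  using closed[OF L_in, of f f 1 "- \<nu>"] by (simp add: shift_def)

lemma shift_linear: "f \<in> X \<Longrightarrow> g \<in> X \<Longrightarrow> shift \<nu> (\<lambda>x. a * f x + b * g x) = (\<lambda>x. a * shift \<nu> f x + b * shift \<nu> g x)"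
  by (simp add: shift_def L_linear algebra_simps)

lemma shift_pow_in: "f \<in> X \<Longrightarrow> (shift \<nu> ^^ k) f \<in> X"
  by (induction k) (auto intro: shift_in)

lemma shift_pow_linear:
  "f \<in> X \<Longrightarrow> g \<in> X \<Longrightarrow> (shift \<nu> ^^ k) (\<lambda>x. a * f x + b * g x) = (\<lambda>x. a * (shift \<nu> ^^ k) f x + b * (shift \<nu> ^^ k) g x)"
  by (induction k) (simp_all add: shift_linear shift_pow_in)

lemma shift_zero: "shift \<nu> (\<lambda>_. 0) = (\<lambda>_. 0)"
  using shift_linear[OF zero zero, of \<nu> 0 0] by simp

lemma gen_eigenspace_eq: "gen_eigenspace X L \<nu> = {f \<in> X. \<exists>k. (shift \<nu> ^^ k) f = (\<lambda>_. 0)}"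
  by (simp add: gen_eigenspace_def shift_def)

lemma shift_pow_zero_mono:
  assumes "(shift \<nu> ^^ k) f = (\<lambda>_. 0)" "k \<le> l"
  shows "(shift \<nu> ^^ l) f = (\<lambda>_. 0)"
  using assms(2,1) by (induction l rule: dec_induct) (auto simp: shift_zero)

lemma gen_eigenspace_closed:
  assumes f: "f \<in> gen_eigenspace X L \<nu>" and g: "g \<in> gen_eigenspace X L \<nu>"
  shows "(\<lambda>x. a * f x + b * g x) \<in> gen_eigenspace X L \<nu>"
proof -
  from f g obtain k l where fg: "f \<in> X" "g \<in> X"
    and kl: "(shift \<nu> ^^ k) f = (\<lambda>_. 0)" "(shift \<nu> ^^ l) g = (\<lambda>_. 0)"
    by (auto simp: gen_eigenspace_eq)
  have "(shift \<nu> ^^ max k l) f = (\<lambda>_. 0)" "(shift \<nu> ^^ max k l) g = (\<lambda>_. 0)"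
    using shift_pow_zero_mono[OF kl(1)] shift_pow_zero_mono[OF kl(2)] by auto
  then have "(shift \<nu> ^^ max k l) (\<lambda>x. a * f x + b * g x) = (\<lambda>_. 0)"
    by (simp add: shift_pow_linear[OF fg])
  then show ?thesis using closed[OF fg] by (auto simp: gen_eigenspace_eq)
qed

text \<open>The vectors \<open>b\<close> are independent, their initial segments span
  \<open>L\<close>-invariant subspaces, and \<open>L\<close> acts on them by an upper triangular
  matrix with diagonal \<open>\<mu>\<close>.\<close>

definition triangular_family :: "nat \<Rightarrow> (nat \<Rightarrow> 'a \<Rightarrow> complex) \<Rightarrow> (nat \<Rightarrow> complex) \<Rightarrow> bool"
  where "triangular_family n b \<mu> \<longleftrightarrow> (\<forall>j<n. b j \<in> X \<and> b j \<notin> cfun_span (b ` {..<j}) \<and>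
    shift (\<mu> j) (b j) \<in> cfun_span (b ` {..<j}))"

lemma sum_in_X: fixes n :: nat shows "(\<And>i. i < n \<Longrightarrow> b i \<in> X) \<Longrightarrow> (\<lambda>z. \<Sum>i<n. x i * b i z) \<in> X"
proof (induction n)
  case (Suc n)
  have "(\<lambda>z. 1 * (\<Sum>i<n. x i * b i z) + x n * b n z) \<in> X"
    using Suc by (intro closed) auto
  then show ?case by simp
qed (simp add: zero)

lemma linear_sum:
  fixes F :: "('a \<Rightarrow> complex) \<Rightarrow> complex" and n :: nat
  assumes F: "\<And>f g a b. f \<in> X \<Longrightarrow> g \<in> X \<Longrightarrow> F (\<lambda>x. a * f x + b * g x) = a * F f + b * F g"
    and b: "\<And>i. i < n \<Longrightarrow> b i \<in> X"
  shows "F (\<lambda>z. \<Sum>i<n. x i * b i z) = (\<Sum>i<n. x i * F (b i))"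
  using b
proof (induction n)
  case 0
  then show ?case using F[OF zero zero, of 0 0] by simp
next
  case (Suc n)
  have "F (\<lambda>z. 1 * (\<Sum>i<n. x i * b i z) + x n * b n z) = 1 * F (\<lambda>z. \<Sum>i<n. x i * b i z) + x n * F (b n)"
    using Suc.prems by (intro F sum_in_X) auto
  then show ?case using Suc by simp
qed

lemma L_sum:
  fixes n :: nat
  assumes "\<And>i. i < n \<Longrightarrow> b i \<in> X"
  shows "L (\<lambda>z. \<Sum>i<n. x i * b i z) = (\<lambda>z. \<Sum>i<n. x i * L (b i) z)"
proof
  fix z show "L (\<lambda>z. \<Sum>i<n. x i * b i z) z = (\<Sum>i<n. x i * L (b i) z)"
    by (rule linear_sum[of "\<lambda>f. L f z"]) (use L_linear assms in auto)
qed

lemma triangular_family_shift: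
  assumes tf: "triangular_family n b \<mu>" and v: "v \<in> cfun_span (b ` {..<n})"
  shows "shift \<nu> v \<in> cfun_span (b ` {..<n})"
proof -
  from v obtain t where t: "v = (\<lambda>z. \<Sum>i<n. t i * b i z)" by (rule cfun_span_combination)
  have bX: "\<And>i. i < n \<Longrightarrow> b i \<in> X" using tf by (simp add: triangular_family_def)
  have Lb: "L (b i) \<in> cfun_span (b ` {..<n})" if "i < n" for i
  proof -
    have "shift (\<mu> i) (b i) \<in> cfun_span (b ` {..<n})"
    proof -
      have "b ` {..<i} \<subseteq> b ` {..<n}" using that by (intro image_mono) auto
      from cfun.span_mono[OF this] show ?thesis using tf that by (auto simp: triangular_family_def)
    qed
    moreover have "(\<lambda>x. \<mu> i * b i x) \<in> cfun_span (b ` {..<n})"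
      using that by (intro cfun.span_scale cfun.span_base) auto
    ultimately have "shift (\<mu> i) (b i) + (\<lambda>x. \<mu> i * b i x) \<in> cfun_span (b ` {..<n})" by (rule cfun.span_add)
    then show ?thesis by (simp add: shift_def plus_fun_def)
  qed
  have "(\<Sum>i<n. (\<lambda>z. t i * L (b i) z)) \<in> cfun_span (b ` {..<n})"
    by (intro cfun.span_sum cfun.span_scale Lb) simp
  moreover have "L v = (\<lambda>z. \<Sum>i<n. t i * L (b i) z)" unfolding t by (rule L_sum[OF bX])
  ultimately have "L v \<in> cfun_span (b ` {..<n})" by (simp only: sum_fun_eq)
  from cfun.span_diff[OF this cfun.span_scale[OF v, of \<nu>]]
  show ?thesis by (simp add: shift_def fun_diff_def)
qed

text \<open>A value contributes no more to the generalised eigenspace than it occurs on the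
  diagonal. Adding \<open>b n\<close> enlarges the intersection by at most one dimension, and only
  if \<open>\<mu> n = \<nu>\<close>: modulo the earlier vectors, \<open>shift \<nu>\<close>
  multiplies \<open>b n\<close> by \<open>\<mu> n - \<nu>\<close>.\<close>

lemma gen_eigenspace_in_triangular_span:
  assumes tf: "triangular_family n b \<mu>"
  shows "\<exists>B. finite B \<and> card B \<le> card {i. i < n \<and> \<mu> i = \<nu>} \<and>
    gen_eigenspace X L \<nu> \<inter> cfun_span (b ` {..<n}) \<subseteq> cfun_span B"
  using tf
proof (induction n)
  case 0
  then show ?case by (intro exI[of _ "{}"]) auto
next
  case (Suc n)
  let ?E = "gen_eigenspace X L \<nu>" and ?S = "cfun_span (b ` {..<n})" and ?S' = "cfun_span (b ` {..<Suc n})"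
  have tfn: "triangular_family n b \<mu>" using Suc.prems by (simp add: triangular_family_def)
  have bn: "b n \<in> X" "b n \<notin> ?S" "shift (\<mu> n) (b n) \<in> ?S" using Suc.prems by (simp_all add: triangular_family_def)
  obtain B where B: "finite B" "card B \<le> card {i. i < n \<and> \<mu> i = \<nu>}" "?E \<inter> ?S \<subseteq> cfun_span B"
    using Suc.IH[OF tfn] by blast
  have S': "\<exists>k. f - (\<lambda>z. k * b n z) \<in> ?S" if "f \<in> ?S'" for f
    using that cfun.span_breakdown_eq[of f "b n" "b ` {..<n}"] by (simp add: lessThan_Suc)
  show ?case
  proof (cases "?E \<inter> ?S' \<subseteq> ?S")
    case True
    have "card {i. i < n \<and> \<mu> i = \<nu>} \<le> card {i. i < Suc n \<and> \<mu> i = \<nu>}" by (intro card_mono) auto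
    with B True show ?thesis by (intro exI[of _ B]) auto
  next
    case False
    then obtain v where v: "v \<in> ?E" "v \<in> ?S'" "v \<notin> ?S" by blast
    obtain c where c: "v - (\<lambda>z. c * b n z) \<in> ?S" using S'[OF v(2)] by blast
    have c0: "c \<noteq> 0"
    proof
      assume "c = 0"
      then have "v - (\<lambda>z. c * b n z) = v" by (simp add: fun_eq_iff)
      with c v(3) show False by simp
    qed
    have \<mu>n: "\<mu> n = \<nu>"
    proof (rule ccontr)
      assume ne: "\<mu> n \<noteq> \<nu>"
      \<comment> \<open>Iterating \<open>shift \<nu>\<close> on \<open>v\<close> multiplies its
        \<open>b n\<close> coefficient by \<open>\<mu> n - \<nu>\<close> each time. If this factor
        were nonzero, no power of the shift could annihilate \<open>v\<close>.\<close>
      have step: "(shift \<nu> ^^ k) v - (\<lambda>z. c * (\<mu> n - \<nu>) ^ k * b n z) \<in> ?S" for k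
      proof (induction k)
        case 0
        then show ?case using c by (simp add: fun_diff_def)
      next
        case (Suc k)
        let ?p = "(shift \<nu> ^^ k) v" and ?d = "c * (\<mu> n - \<nu>) ^ k"
        have vX: "?p \<in> X" using v(1) shift_pow_in by (simp add: gen_eigenspace_eq)
        have "shift \<nu> (?p - (\<lambda>z. ?d * b n z)) \<in> ?S" by (rule triangular_family_shift[OF tfn Suc.IH])
        also have "?p - (\<lambda>z. ?d * b n z) = (\<lambda>z. 1 * ?p z + (- ?d) * b n z)" by (simp add: fun_diff_def)
        also have "shift \<nu> \<dots> = (\<lambda>z. 1 * shift \<nu> ?p z + (- ?d) * shift \<nu> (b n) z)"
          by (rule shift_linear[OF vX bn(1)])
        finally have "(\<lambda>z. 1 * shift \<nu> ?p z + (- ?d) * shift \<nu> (b n) z) + (\<lambda>z. ?d * shift (\<mu> n) (b n) z) \<in> ?S"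
          by (rule cfun.span_add[OF _ cfun.span_scale[OF bn(3)]])
        moreover have "(\<lambda>z. 1 * shift \<nu> ?p z + (- ?d) * shift \<nu> (b n) z) + (\<lambda>z. ?d * shift (\<mu> n) (b n) z)
           = (shift \<nu> ^^ Suc k) v - (\<lambda>z. c * (\<mu> n - \<nu>) ^ Suc k * b n z)"
          by (rule ext) (simp add: shift_def algebra_simps)
        ultimately show ?case by (simp only:)
      qed
      obtain k where "(shift \<nu> ^^ k) v = (\<lambda>_. 0)" using v(1) by (auto simp: gen_eigenspace_eq)
      with step[of k] have "(\<lambda>z. (- 1 / (c * (\<mu> n - \<nu>) ^ k)) * ((\<lambda>_. 0) - (\<lambda>z. c * (\<mu> n - \<nu>) ^ k * b n z)) z) \<in> ?S"
        by (metis cfun.span_scale)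
      moreover have "(\<lambda>z. (- 1 / (c * (\<mu> n - \<nu>) ^ k)) * ((\<lambda>_. 0) - (\<lambda>z. c * (\<mu> n - \<nu>) ^ k * b n z)) z) = b n"
        using c0 ne by (simp add: fun_eq_iff)
      ultimately show False using bn(2) by simp
    qed
    \<comment> \<open>A suitable multiple of \<open>v\<close> removes the \<open>b n\<close>
      coefficient of any further element and leaves it in the intersection covered by
      \<open>B\<close>.\<close>
    have "?E \<inter> ?S' \<subseteq> cfun_span (insert v B)"
    proof
      fix u assume u: "u \<in> ?E \<inter> ?S'"
      then obtain c' where c': "u - (\<lambda>z. c' * b n z) \<in> ?S" using S' by blast
      let ?w = "\<lambda>z. 1 * u z + (- (c' / c)) * v z"
      have "?w \<in> ?E" using u v(1) by (intro gen_eigenspace_closed) auto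
      moreover have "?w \<in> ?S"
      proof -
        have "(u - (\<lambda>z. c' * b n z)) - (\<lambda>z. (c' / c) * (v - (\<lambda>z. c * b n z)) z) \<in> ?S"
          by (intro cfun.span_diff c' cfun.span_scale c)
        moreover have "(u - (\<lambda>z. c' * b n z)) - (\<lambda>z. (c' / c) * (v - (\<lambda>z. c * b n z)) z) = ?w"
          using c0 by (simp add: fun_eq_iff field_simps)
        ultimately show ?thesis by simp
      qed
      ultimately have "?w \<in> cfun_span B" using B(3) by blast
      moreover have "u - (\<lambda>z. (c' / c) * v z) = ?w" by (simp add: fun_eq_iff)
      ultimately show "u \<in> cfun_span (insert v B)" using cfun.span_breakdown_eq[of u v B] by metis
    qed
    moreover have "card (insert v B) \<le> card {i. i < Suc n \<and> \<mu> i = \<nu>}"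
    proof -
      have "{i. i < Suc n \<and> \<mu> i = \<nu>} = insert n {i. i < n \<and> \<mu> i = \<nu>}" using \<mu>n by auto
      then have "card {i. i < Suc n \<and> \<mu> i = \<nu>} = Suc (card {i. i < n \<and> \<mu> i = \<nu>})" by simp
      moreover have "card (insert v B) \<le> Suc (card B)" by (rule card_insert_le_m1) (auto simp: B)
      ultimately show ?thesis using B(2) by simp
    qed
    ultimately show ?thesis using B(1) by (intro exI[of _ "insert v B"]) auto
  qed
qed

text \<open>The dimension is larger than \<open>q\<close>, infinite dimension included. Spanning
  sets are used because \<open>cfun_dim\<close> does not tell infinite dimension from zero.\<close>

definition dim_exceeds :: "complex \<Rightarrow> nat \<Rightarrow> bool"
  where "dim_exceeds \<nu> q \<longleftrightarrow> \<not> (\<exists>B. finite B \<and> card B \<le> q \<and> gen_eigenspace X L \<nu> \<subseteq> cfun_span B)"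

text \<open>If \<open>\<mu> n\<close> occurs less often than the dimension of its generalised
  eigenspace, some generalised eigenvector lies outside the span. Its last iterate under the shift
  that is still outside can be appended.\<close>

lemma triangular_family_extend:
  assumes tf: "triangular_family n b \<mu>" and ex: "dim_exceeds (\<mu> n) (card {i. i < n \<and> \<mu> i = \<mu> n})"
  shows "\<exists>v. triangular_family (Suc n) (b(n := v)) \<mu>"
proof -
  let ?E = "gen_eigenspace X L (\<mu> n)" and ?S = "cfun_span (b ` {..<n})"
  have "\<not> ?E \<subseteq> ?S"
  proof
    assume "?E \<subseteq> ?S"
    with gen_eigenspace_in_triangular_span[OF tf, of "\<mu> n"] show False
      using ex unfolding dim_exceeds_def by (simp add: Int_absorb2)
  qed
  then obtain v where v: "v \<in> ?E" "v \<notin> ?S" by blast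
  then obtain k where k: "v \<in> X" "(shift (\<mu> n) ^^ k) v = (\<lambda>_. 0)" by (auto simp: gen_eigenspace_eq)
  \<comment> \<open>The first iterate inside the span; the one before it is the new vector, and its
    shift is in the span as required.\<close>
  define m where "m = (LEAST m. (shift (\<mu> n) ^^ m) v \<in> ?S)"
  have "(shift (\<mu> n) ^^ k) v \<in> ?S" using k(2) cfun.span_zero by (simp add: zero_fun_def)
  then have m: "(shift (\<mu> n) ^^ m) v \<in> ?S" unfolding m_def by (rule LeastI)
  have "m \<noteq> 0" using m v(2) by (metis funpow_0)
  then obtain j where j: "m = Suc j" by (cases m) auto
  have nj: "(shift (\<mu> n) ^^ j) v \<notin> ?S" using not_less_Least[of j "\<lambda>m. (shift (\<mu> n) ^^ m) v \<in> ?S"] j by (simp add: m_def)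
  have img: "(b(n := w)) ` {..<i} = b ` {..<i}" if "i \<le> n" for i w using that by (intro image_cong) auto
  have "triangular_family (Suc n) (b(n := (shift (\<mu> n) ^^ j) v)) \<mu>"
    unfolding triangular_family_def
  proof (intro allI impI)
    fix i assume "i < Suc n"
    then consider "i < n" | "i = n" by linarith
    then show "(b(n := (shift (\<mu> n) ^^ j) v)) i \<in> X \<and>
       (b(n := (shift (\<mu> n) ^^ j) v)) i \<notin> cfun_span ((b(n := (shift (\<mu> n) ^^ j) v)) ` {..<i}) \<and>
       shift (\<mu> i) ((b(n := (shift (\<mu> n) ^^ j) v)) i) \<in> cfun_span ((b(n := (shift (\<mu> n) ^^ j) v)) ` {..<i})"
    proof cases
      case 1
      then show ?thesis using tf img[of i] by (simp add: triangular_family_def)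
    next
      case 2
      then show ?thesis using img[of n] nj m j shift_pow_in[OF k(1)] by simp
    qed
  qed
  then show ?thesis by blast
qed

lemma triangular_family_exists:
  assumes "\<And>j. j < n \<Longrightarrow> dim_exceeds (\<mu> j) (card {i. i < j \<and> \<mu> i = \<mu> j})"
  shows "\<exists>b. triangular_family n b \<mu>"
  using assms
proof (induction n)
  case 0
  then show ?case by (simp add: triangular_family_def)
next
  case (Suc n)
  then obtain b where "triangular_family n b \<mu>" by auto
  from triangular_family_extend[OF this] Suc.prems[of n] show ?case by blast
qed

text \<open>Passes to coordinates: the inner product becomes a Gram form, \<open>L\<close> an upper
  triangular matrix and the functionals in \<open>C k\<close> rows of coefficients. The bound is
  required only on the common kernel of \<open>C k\<close>.\<close>

lemma triangular_family_weyl: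
  fixes ip :: "('a \<Rightarrow> complex) \<Rightarrow> ('a \<Rightarrow> complex) \<Rightarrow> complex" and a :: "nat \<Rightarrow> real"
  assumes tf: "triangular_family n b \<mu>"
    and ip_linear: "\<And>f g h a b. f \<in> X \<Longrightarrow> g \<in> X \<Longrightarrow> h \<in> X \<Longrightarrow> ip (\<lambda>x. a * f x + b * g x) h = a * ip f h + b * ip g h"
    and ip_cnj: "\<And>f g. f \<in> X \<Longrightarrow> g \<in> X \<Longrightarrow> ip f g = cnj (ip g f)"
    and ip_pos: "\<And>f. f \<in> X \<Longrightarrow> f \<noteq> (\<lambda>_. 0) \<Longrightarrow> 0 < Re (ip f f)"
    and C: "\<And>k. finite (C k) \<and> card (C k) \<le> k"
    and C_linear: "\<And>\<phi> k f g a b. \<phi> \<in> C k \<Longrightarrow> f \<in> X \<Longrightarrow> g \<in> X \<Longrightarrow> \<phi> (\<lambda>x. a * f x + b * g x) = a * \<phi> f + b * \<phi> g"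
    and a: "\<And>k f. f \<in> X \<Longrightarrow> (\<And>\<phi>. \<phi> \<in> C k \<Longrightarrow> \<phi> f = 0) \<Longrightarrow> Re (ip (L f) (L f)) \<le> (a k)\<^sup>2 * Re (ip f f)"
    and a0: "\<And>k. 0 \<le> a k"
  shows "(\<Prod>j<n. cmod (\<mu> j)) \<le> (\<Prod>k<n. a k)"
proof -
  have bX: "\<And>i. i < n \<Longrightarrow> b i \<in> X" using tf by (simp add: triangular_family_def)
  define comb where "comb x = (\<lambda>z. \<Sum>i<n. x i * b i z)" for x :: "nat \<Rightarrow> complex"
  have combX: "comb x \<in> X" for x unfolding comb_def by (rule sum_in_X[OF bX])
  define \<Gamma> where "\<Gamma> i j = ip (b i) (b j)" for i j
  have ip_comb: "ip (comb x) (comb y) = (\<Sum>i<n. \<Sum>j<n. x i * cnj (y j) * \<Gamma> i j)" for x y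
  proof -
    have right: "ip (b i) (comb y) = (\<Sum>j<n. cnj (y j) * \<Gamma> i j)" if i: "i < n" for i
    proof -
      have "ip (comb y) (b i) = (\<Sum>j<n. y j * ip (b j) (b i))"
        unfolding comb_def by (rule linear_sum[of "\<lambda>f. ip f (b i)"]) (use ip_linear bX i in auto)
      then have "cnj (ip (comb y) (b i)) = (\<Sum>j<n. cnj (y j) * cnj (ip (b j) (b i)))" by simp
      also have "\<dots> = (\<Sum>j<n. cnj (y j) * \<Gamma> i j)"
      proof (rule sum.cong)
        fix j assume "j \<in> {..<n}"
        then have "ip (b i) (b j) = cnj (ip (b j) (b i))" by (intro ip_cnj bX i) simp
        then show "cnj (y j) * cnj (ip (b j) (b i)) = cnj (y j) * \<Gamma> i j" by (simp only: \<Gamma>_def)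
      qed simp
      finally show ?thesis by (simp only: ip_cnj[OF bX[OF i] combX[of y]])
    qed
    have "ip (comb x) (comb y) = (\<Sum>i<n. x i * ip (b i) (comb y))"
      unfolding comb_def[of x] by (rule linear_sum[of "\<lambda>f. ip f (comb y)"]) (use ip_linear combX bX in auto)
    also have "\<dots> = (\<Sum>i<n. \<Sum>j<n. x i * cnj (y j) * \<Gamma> i j)"
      by (rule sum.cong) (auto simp: right sum_distrib_left mult.assoc)
    finally show ?thesis .
  qed
  have indep: "comb x \<noteq> (\<lambda>_. 0)" if "\<exists>i<n. x i \<noteq> 0" for x
  proof
    assume c0: "comb x = (\<lambda>_. 0)"
    \<comment> \<open>The last nonzero coefficient of a vanishing combination would express
      \<open>b m\<close> through earlier vectors.\<close>
    define m where "m = Max {i. i < n \<and> x i \<noteq> 0}"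
    have fin: "finite {i. i < n \<and> x i \<noteq> 0}" by simp
    have "m \<in> {i. i < n \<and> x i \<noteq> 0}" unfolding m_def by (rule Max_in[OF fin]) (use that in blast)
    then have m: "m < n" "x m \<noteq> 0" by auto
    have above: "x i = 0" if "i < n" "m < i" for i
      using Max_ge[OF fin, of i] that unfolding m_def[symmetric] by force
    have "(\<Sum>i<n. x i * b i z) = (\<Sum>i<m. x i * b i z) + x m * b m z" for z
    proof -
      have "(\<Sum>i<n. x i * b i z) = (\<Sum>i<Suc m. x i * b i z)"
        by (rule sum.mono_neutral_right) (use m above in \<open>auto simp: not_less\<close>)
      then show ?thesis by simp
    qed
    then have "(\<Sum>i<m. x i * b i z) + x m * b m z = 0" for z using fun_cong[OF c0, of z] by (simp add: comb_def)
    then have "x m * b m z = - (\<Sum>i<m. x i * b i z)" for z by (simp add: eq_neg_iff_add_eq_0 add.commute)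
    then have "b m z = (\<Sum>i<m. (- x i / x m) * b i z)" for z
      using m(2) by (simp add: sum_divide_distrib[symmetric] sum_negf field_simps)
    then have "b m = (\<lambda>z. \<Sum>i<m. (- x i / x m) * b i z)" by (rule ext)
    also have "\<dots> \<in> cfun_span (b ` {..<m})" by (rule cfun_combination_in_span)
    finally show False using tf m(1) by (simp add: triangular_family_def)
  qed
  interpret gram n \<Gamma>
  proof
    show "\<Gamma> i j = cnj (\<Gamma> j i)" if "i < n" "j < n" for i j
      unfolding \<Gamma>_def by (rule ip_cnj) (use bX that in auto)
    show "0 < Re (\<Sum>i<n. \<Sum>j<n. x i * cnj (x j) * \<Gamma> i j)" if "\<exists>i<n. x i \<noteq> 0" for x
      using ip_pos[OF combX indep[OF that]] by (simp add: ip_comb)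
  qed
  have form_eq: "form x y = ip (comb x) (comb y)" for x y by (simp add: form_def ip_comb)
  have "\<forall>j. \<exists>t. j < n \<longrightarrow> shift (\<mu> j) (b j) = (\<lambda>z. \<Sum>i<j. t i * b i z)"
    using tf cfun_span_combination unfolding triangular_family_def by metis
  then obtain t where t: "\<And>j. j < n \<Longrightarrow> shift (\<mu> j) (b j) = (\<lambda>z. \<Sum>i<j. t j i * b i z)" by metis
  define T where "T i j = (if i < j then t j i else if i = j then \<mu> j else 0)" for i j
  have Lb: "L (b j) z = (\<Sum>i<n. T i j * b i z)" if j: "j < n" for j z
  proof -
    have "L (b j) z = (\<Sum>i<j. t j i * b i z) + \<mu> j * b j z"
      using fun_cong[OF t[OF j], of z] by (simp add: shift_def algebra_simps)
    also have "\<dots> = (\<Sum>i<Suc j. T i j * b i z)" by (simp add: T_def)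
    also have "\<dots> = (\<Sum>i<n. T i j * b i z)"
      by (rule sum.mono_neutral_left) (use j in \<open>auto simp: T_def\<close>)
    finally show ?thesis .
  qed
  have Lcomb: "L (comb x) = comb (\<lambda>i. \<Sum>j<n. T i j * x j)" for x
  proof
    fix z
    have "L (comb x) = (\<lambda>z. \<Sum>j<n. x j * L (b j) z)" unfolding comb_def by (rule L_sum[OF bX])
    then have "L (comb x) z = (\<Sum>j<n. x j * (\<Sum>i<n. T i j * b i z))" by (simp add: Lb)
    also have "\<dots> = (\<Sum>j<n. \<Sum>i<n. T i j * x j * b i z)" by (simp add: sum_distrib_left mult_ac)
    also have "\<dots> = (\<Sum>i<n. \<Sum>j<n. T i j * x j * b i z)" by (rule sum.swap)
    also have "\<dots> = comb (\<lambda>i. \<Sum>j<n. T i j * x j) z" by (simp add: comb_def sum_distrib_right)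
    finally show "L (comb x) z = comb (\<lambda>i. \<Sum>j<n. T i j * x j) z" .
  qed
  have "(\<Prod>j<n. cmod (T j j)) \<le> (\<Prod>k<n. a k)"
  proof (rule weyl_triangular[where C = "\<lambda>k. (\<lambda>\<phi> j. \<phi> (b j)) ` C k" and T = T])
    show "T i j = 0" if "j < i" "i < n" for i j using that by (simp add: T_def)
    show "finite ((\<lambda>\<phi> j. \<phi> (b j)) ` C k) \<and> card ((\<lambda>\<phi> j. \<phi> (b j)) ` C k) \<le> k" if "k < n" for k
      using C[of k] card_image_le[of "C k" "\<lambda>\<phi> j. \<phi> (b j)"] by auto
    show "Re (form (\<lambda>i. \<Sum>j<n. T i j * x j) (\<lambda>i. \<Sum>j<n. T i j * x j)) \<le> (a k)\<^sup>2 * Re (form x x)"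
      if "k < n" and 0: "\<And>c. c \<in> (\<lambda>\<phi> j. \<phi> (b j)) ` C k \<Longrightarrow> (\<Sum>j<n. c j * x j) = 0" for k x
      unfolding form_eq Lcomb[symmetric]
    proof (rule a[OF combX])
      fix \<phi> assume \<phi>: "\<phi> \<in> C k"
      have "\<phi> (comb x) = (\<Sum>j<n. x j * \<phi> (b j))"
        unfolding comb_def by (rule linear_sum) (use C_linear[OF \<phi>] bX in auto)
      also have "\<dots> = (\<Sum>j<n. \<phi> (b j) * x j)" by (simp add: mult.commute)
      also have "\<dots> = 0" by (rule 0) (use \<phi> in auto)
      finally show "\<phi> (comb x) = 0" .
    qed
  qed (rule a0)
  then show ?thesis by (simp add: T_def)
qed

end

subsection \<open>Enumeration of the eigenvalues\<close>

definition max_choice :: "('c \<Rightarrow> real) \<Rightarrow> 'c set \<Rightarrow> 'c option"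
  where "max_choice h S = (if S = {} then None else Some (SOME a. a \<in> S \<and> (\<forall>b\<in>S. h b \<le> h a)))"

text \<open>What is left after \<open>k\<close> greedy removals of an element with maximal
  \<open>h\<close>. Once the set is exhausted, \<open>max_choice\<close> returns \<open>None\<close>
  and nothing changes.\<close>

primrec remaining :: "('c \<Rightarrow> real) \<Rightarrow> 'c set \<Rightarrow> nat \<Rightarrow> 'c set"
  where "remaining h A 0 = A"
  | "remaining h A (Suc k) = remaining h A k - set_option (max_choice h (remaining h A k))"

text \<open>Finiteness above every positive level serves twice: it supplies the maximum to be
  removed at each stage, and it guarantees that every element has its turn.\<close>

lemma decreasing_enumeration:
  fixes h :: "'c \<Rightarrow> real"
  assumes pos: "\<And>a. a \<in> A \<Longrightarrow> 0 < h a" and fin: "\<And>\<epsilon>. 0 < \<epsilon> \<Longrightarrow> finite {a \<in> A. \<epsilon> \<le> h a}"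
  obtains s :: "nat \<Rightarrow> 'c option" where
    "\<And>k a. s k = Some a \<Longrightarrow> a \<in> A" "\<And>a. a \<in> A \<Longrightarrow> \<exists>k. s k = Some a"
    "\<And>j k a. s j = Some a \<Longrightarrow> s k = Some a \<Longrightarrow> j = k"
    "\<And>j k b. j \<le> k \<Longrightarrow> s k = Some b \<Longrightarrow> \<exists>a. s j = Some a \<and> h b \<le> h a"
proof -
  let ?R = "remaining h A"
  define s where "s k = max_choice h (?R k)" for k
  have mono: "?R k \<subseteq> ?R j" if "j \<le> k" for j k using that by (induction k rule: dec_induct) auto
  have sub: "?R k \<subseteq> A" for k using mono[of 0 k] by simp
  have choice: "a \<in> ?R k \<and> (\<forall>b\<in>?R k. h b \<le> h a)" if "s k = Some a" for k a
  proof -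
    have ne: "?R k \<noteq> {}" using that by (auto simp: s_def max_choice_def)
    then obtain b where b: "b \<in> ?R k" by blast
    define F where "F = {a \<in> ?R k. h b \<le> h a}"
    have "finite F"
      by (rule finite_subset[OF _ fin[of "h b"]]) (use b sub[of k] pos in \<open>auto simp: F_def\<close>)
    moreover have "F \<noteq> {}" using b by (auto simp: F_def)
    ultimately have "Max (h ` F) \<in> h ` F" by (intro Max_in) auto
    then obtain m where m: "m \<in> F" "h m = Max (h ` F)" by auto
    have "h c \<le> h m" if "c \<in> ?R k" for c
    proof (cases "h b \<le> h c")
      case True
      then have "h c \<in> h ` F" using that by (auto simp: F_def)
      then show ?thesis using \<open>finite F\<close> m(2) by simp
    next
      case False
      then show ?thesis using m(1) by (auto simp: F_def)
    qed
    then have "m \<in> ?R k \<and> (\<forall>c\<in>?R k. h c \<le> h m)" using m(1) by (auto simp: F_def)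
    then have "(\<lambda>a. a \<in> ?R k \<and> (\<forall>b\<in>?R k. h b \<le> h a)) (SOME a. a \<in> ?R k \<and> (\<forall>b\<in>?R k. h b \<le> h a))"
      by (rule someI)
    moreover have "a = (SOME a. a \<in> ?R k \<and> (\<forall>b\<in>?R k. h b \<le> h a))"
      using that ne by (simp add: s_def max_choice_def)
    ultimately show ?thesis by simp
  qed
  have gone: "a \<notin> ?R l" if "s k = Some a" "k < l" for k l a
    using mono[of "Suc k" l] that by (auto simp: s_def)
  have inj: "j = k" if "s j = Some a" "s k = Some a" for j k a
    using that gone[of j a k] gone[of k a j] choice by (metis linorder_neqE_nat)
  show ?thesis
  proof (rule that[of s])
    show "a \<in> A" if "s k = Some a" for k a using choice[OF that] sub by blast
    show "\<exists>k. s k = Some a" if a: "a \<in> A" for a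
    proof (rule ccontr)
      assume none: "\<nexists>k. s k = Some a"
      have aR: "a \<in> ?R k" for k
        by (induction k) (use a none in \<open>auto simp: s_def\<close>)
      then have "\<exists>b. s k = Some b" for k by (auto simp: s_def max_choice_def)
      then obtain p where p: "\<And>k. s k = Some (p k)" by metis
      \<comment> \<open>An element that is never chosen would be outranked by infinitely many
        distinct choices.\<close>
      have "inj p" by (rule injI) (metis inj p)
      moreover have "range p \<subseteq> {b \<in> A. h a \<le> h b}" using choice[OF p] aR sub by blast
      ultimately show False using fin[OF pos[OF a]] finite_subset finite_imageD infinite_UNIV_nat by metis
    qed
    show "\<exists>a. s j = Some a \<and> h b \<le> h a" if "j \<le> k" "s k = Some b" for j k b
    proof -
      have "b \<in> ?R j" using choice[OF that(2)] mono[OF that(1)] by blast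
      then have "s j \<noteq> None" by (auto simp: s_def max_choice_def)
      then obtain a where a: "s j = Some a" by auto
      then show ?thesis using choice[OF a] \<open>b \<in> ?R j\<close> by blast
    qed
  qed (rule inj)
qed

text \<open>From some index on the factors are below \<open>\<epsilon> / 2\<close>, so the powers of
  2 gained eventually outweigh the fixed product of the initial factors.\<close>

lemma eventually_prod_less_power:
  fixes a :: "nat \<Rightarrow> real"
  assumes a0: "\<And>k. 0 \<le> a k" and lim: "a \<longlonglongrightarrow> 0" and \<epsilon>: "0 < \<epsilon>"
  shows "\<exists>n. (\<Prod>k<n. a k) < \<epsilon> ^ n"
proof -
  have "\<epsilon> / 2 > 0" using \<epsilon> by simp
  from order_tendstoD(2)[OF lim this] obtain K where K: "\<And>k. k \<ge> K \<Longrightarrow> a k < \<epsilon> / 2"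
    unfolding eventually_sequentially by blast
  define P where "P = (\<Prod>k<K. a k)"
  have P0: "P \<ge> 0" by (simp add: P_def a0 prod_nonneg)
  obtain m where m: "P / \<epsilon> ^ K < 2 ^ m" using real_arch_pow[of 2 "P / \<epsilon> ^ K"] by auto
  have "(\<Prod>k<K + l. a k) \<le> P * (\<epsilon> / 2) ^ l" for l
  proof (induction l)
    case (Suc l)
    have "(\<Prod>k<K + Suc l. a k) = (\<Prod>k<K + l. a k) * a (K + l)" by simp
    also have "\<dots> \<le> (P * (\<epsilon> / 2) ^ l) * (\<epsilon> / 2)"
      using K[of "K + l"] \<epsilon> P0 by (intro mult_mono Suc) (auto simp: a0)
    finally show ?case by (simp add: mult_ac)
  qed (simp add: P_def)
  then have "(\<Prod>k<K + m. a k) \<le> P * (\<epsilon> / 2) ^ m" .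
  also have "\<dots> < \<epsilon> ^ (K + m)"
  proof -
    have "P < 2 ^ m * \<epsilon> ^ K" using m \<epsilon> by (simp add: divide_less_eq)
    then have "P * (\<epsilon> / 2) ^ m < 2 ^ m * \<epsilon> ^ K * (\<epsilon> / 2) ^ m" using \<epsilon> by (intro mult_strict_right_mono) auto
    also have "\<dots> = \<epsilon> ^ (K + m)" by (simp add: power_divide power_add)
    finally show ?thesis .
  qed
  finally show ?thesis by blast
qed

text \<open>Isolates the input of the counting arguments: diagonals of triangular families are
  bounded by products of a null sequence.\<close>

locale weyl_op = linear_op +
  fixes a :: "nat \<Rightarrow> real"
  assumes a_nonneg: "\<And>k. 0 \<le> a k" and a_lim: "a \<longlonglongrightarrow> 0"
    and weyl: "\<And>n b \<mu>. triangular_family n b \<mu> \<Longrightarrow> (\<And>j. j < n \<Longrightarrow> \<mu> j \<noteq> 0) \<Longrightarrow> (\<Prod>j<n. cmod (\<mu> j)) \<le> (\<Prod>k<n. a k)"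
begin

abbreviation "multiplicity_of \<nu> \<equiv> cfun_dim (gen_eigenspace X L \<nu>)"

lemma prod_bound:
  assumes "\<And>j. j < n \<Longrightarrow> dim_exceeds (\<mu> j) (card {i. i < j \<and> \<mu> i = \<mu> j})" "\<And>j. j < n \<Longrightarrow> \<mu> j \<noteq> 0"
  shows "(\<Prod>j<n. cmod (\<mu> j)) \<le> (\<Prod>k<n. a k)"
  using triangular_family_exists[of n \<mu>] weyl assms by blast

text \<open>In infinite dimension the constant diagonal \<open>\<nu>\<close> of any length would be
  admissible, and the powers of \<open>cmod \<nu>\<close> would be bounded by products that decay
  faster.\<close>

lemma gen_eigenspace_finite_dim:
  assumes "\<nu> \<noteq> 0"
  shows "\<exists>B. finite B \<and> gen_eigenspace X L \<nu> \<subseteq> cfun_span B"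
proof (rule ccontr)
  assume "\<not> ?thesis"
  then have "dim_exceeds \<nu> q" for q by (auto simp: dim_exceeds_def)
  then have "(\<Prod>j<n. cmod \<nu>) \<le> (\<Prod>k<n. a k)" for n
    using prod_bound[of n "\<lambda>_. \<nu>"] assms by simp
  moreover obtain n where "(\<Prod>k<n. a k) < cmod \<nu> ^ n"
    using eventually_prod_less_power[OF a_nonneg a_lim, of "cmod \<nu>"] assms by auto
  ultimately show False by (metis card_lessThan not_less prod_constant)
qed

lemma dim_exceeds_of_less:
  assumes "q < multiplicity_of \<nu>"
  shows "dim_exceeds \<nu> q"
  unfolding dim_exceeds_def
proof (rule notI, elim exE conjE)
  fix B assume "finite B" "card B \<le> q" "gen_eigenspace X L \<nu> \<subseteq> cfun_span B"
  then show False using cfun.dim_le_card[of "gen_eigenspace X L \<nu>" B] assms by simp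
qed

text \<open>By monotonicity the \<open>n\<close>-th power of the modulus is at most the product of
  the first \<open>n\<close> moduli. These values form an admissible diagonal, since an entry is
  preceded by fewer equal entries than its multiplicity.\<close>

lemma eigenvalue_sequence_bound:
  assumes lam: "eigenvalue_sequence X L lam" and n: "1 \<le> n"
  shows "cmod (lam n) ^ n \<le> (\<Prod>k<n. a k)"
proof (cases "lam n = 0")
  case True
  then show ?thesis using n by (simp add: power_0_left prod_nonneg a_nonneg)
next
  case False
  have le: "cmod (lam n) \<le> cmod (lam (Suc j))" if "j < n" for j
    using lam that by (simp add: eigenvalue_sequence_def)
  have nz: "lam (Suc j) \<noteq> 0" if "j < n" for j using le[OF that] False by auto
  have "cmod (lam n) ^ n = (\<Prod>j<n. cmod (lam n))" by simp
  also have "\<dots> \<le> (\<Prod>j<n. cmod (lam (Suc j)))" by (rule prod_mono) (use le in auto)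
  also have "\<dots> \<le> (\<Prod>k<n. a k)"
  proof (rule prod_bound[of n "\<lambda>j. lam (Suc j)"])
    fix j assume j: "j < n"
    let ?S = "{m. 1 \<le> m \<and> lam m = lam (Suc j)}"
    have fin: "finite ?S" and card: "card ?S = multiplicity_of (lam (Suc j))"
      using lam nz[OF j] by (auto simp: eigenvalue_sequence_def)
    have "card {i. i < j \<and> lam (Suc i) = lam (Suc j)} < card ?S"
    proof -
      have "card {i. i < j \<and> lam (Suc i) = lam (Suc j)} = card (Suc ` {i. i < j \<and> lam (Suc i) = lam (Suc j)})"
        by (simp add: card_image)
      also have "\<dots> < card ?S"
      proof (rule psubset_card_mono[OF fin])
        have "Suc j \<in> ?S" "Suc j \<notin> Suc ` {i. i < j \<and> lam (Suc i) = lam (Suc j)}" by auto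
        then show "Suc ` {i. i < j \<and> lam (Suc i) = lam (Suc j)} \<subset> ?S" by auto
      qed
      finally show ?thesis .
    qed
    then show "dim_exceeds (lam (Suc j)) (card {i. i < j \<and> lam (Suc i) = lam (Suc j)})"
      unfolding card by (rule dim_exceeds_of_less)
  qed (rule nz)
  finally show ?thesis .
qed

text \<open>Eigenvalues with multiplicity are encoded as pairs \<open>(\<nu>, i)\<close> with
  \<open>i\<close> below the multiplicity. Infinitely many pairs of modulus at least
  \<open>\<epsilon>\<close> would contradict the product bound, so they can be enumerated by
  decreasing modulus.\<close>

lemma eigenvalue_sequence_exists: "\<exists>lam. eigenvalue_sequence X L lam"
proof -
  define A where "A = {(\<nu>, i). \<nu> \<noteq> 0 \<and> i < multiplicity_of \<nu>}"
  have fin: "finite {p \<in> A. \<epsilon> \<le> cmod (fst p)}" if \<epsilon>: "0 < \<epsilon>" for \<epsilon>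
  proof (rule ccontr)
    assume inf: "infinite {p \<in> A. \<epsilon> \<le> cmod (fst p)}"
    obtain n where n: "(\<Prod>k<n. a k) < \<epsilon> ^ n" using eventually_prod_less_power[OF a_nonneg a_lim \<epsilon>] by blast
    obtain S where S: "S \<subseteq> {p \<in> A. \<epsilon> \<le> cmod (fst p)}" "finite S" "card S = n"
      using infinite_arbitrarily_large[OF inf] by blast
    obtain s where s: "bij_betw s {0..<n} S" using ex_bij_betw_nat_finite[OF S(2)] S(3) by blast
    have sA: "s j \<in> A" "\<epsilon> \<le> cmod (fst (s j))" if "j < n" for j
    proof -
      have "s j \<in> S" using bij_betwE[OF s] that by simp
      with S(1) show "s j \<in> A" "\<epsilon> \<le> cmod (fst (s j))" by blast+
    qed
    have inj: "i = j" if "s i = s j" "i < n" "j < n" for i j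
      using bij_betw_imp_inj_on[OF s] that by (simp add: inj_on_def)
    have "(\<Prod>j<n. cmod (fst (s j))) \<le> (\<Prod>k<n. a k)"
    proof (rule prod_bound[of n "\<lambda>j. fst (s j)"])
      fix j assume j: "j < n"
      let ?I = "{i. i < j \<and> fst (s i) = fst (s j)}"
      \<comment> \<open>Pairs with equal first entry differ in the second, which stays below the
        multiplicity. Hence the \<open>j\<close>-th value has fewer predecessors equal to it than
        its multiplicity.\<close>
      have "inj_on (\<lambda>i. snd (s i)) (insert j ?I)"
      proof (rule inj_onI)
        fix i k assume ik: "i \<in> insert j ?I" "k \<in> insert j ?I" "snd (s i) = snd (s k)"
        then have "fst (s i) = fst (s k)" by auto
        with ik(3) have "s i = s k" by (simp add: prod_eq_iff)
        then show "i = k" by (rule inj) (use ik j in auto)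
      qed
      moreover have "(\<lambda>i. snd (s i)) ` insert j ?I \<subseteq> {..<multiplicity_of (fst (s j))}"
      proof
        fix x assume "x \<in> (\<lambda>i. snd (s i)) ` insert j ?I"
        then obtain i where i: "x = snd (s i)" "i < n" "fst (s i) = fst (s j)" using j by auto
        then show "x \<in> {..<multiplicity_of (fst (s j))}" using sA(1)[OF i(2)] by (auto simp: A_def)
      qed
      ultimately have "card (insert j ?I) \<le> card {..<multiplicity_of (fst (s j))}"
        using card_inj_on_le finite_lessThan by blast
      moreover have "card (insert j ?I) = Suc (card ?I)" by (subst card_insert_disjoint) auto
      ultimately have "card ?I < multiplicity_of (fst (s j))" by simp
      then show "dim_exceeds (fst (s j)) (card ?I)" by (rule dim_exceeds_of_less)
    next
      fix j assume "j < n"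
      then show "fst (s j) \<noteq> 0" using sA(1)[of j] by (auto simp: A_def)
    qed
    moreover have "\<epsilon> ^ n \<le> (\<Prod>j<n. cmod (fst (s j)))"
      using prod_mono[of "{..<n}" "\<lambda>_. \<epsilon>" "\<lambda>j. cmod (fst (s j))"] sA(2) \<epsilon> by simp
    ultimately show False using n by simp
  qed
  have pos: "0 < cmod (fst p)" if "p \<in> A" for p using that by (auto simp: A_def)
  obtain s :: "nat \<Rightarrow> (complex \<times> nat) option" where
    s: "\<And>k p. s k = Some p \<Longrightarrow> p \<in> A" "\<And>p. p \<in> A \<Longrightarrow> \<exists>k. s k = Some p"
      "\<And>j k p. s j = Some p \<Longrightarrow> s k = Some p \<Longrightarrow> j = k"
      "\<And>j k q. j \<le> k \<Longrightarrow> s k = Some q \<Longrightarrow> \<exists>p. s j = Some p \<and> cmod (fst q) \<le> cmod (fst p)"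
  proof (rule decreasing_enumeration[of A "\<lambda>p. cmod (fst p)"])
    fix s :: "nat \<Rightarrow> (complex \<times> nat) option"
    assume "\<And>k p. s k = Some p \<Longrightarrow> p \<in> A" "\<And>p. p \<in> A \<Longrightarrow> \<exists>k. s k = Some p"
      "\<And>j k p. s j = Some p \<Longrightarrow> s k = Some p \<Longrightarrow> j = k"
      "\<And>j k q. j \<le> k \<Longrightarrow> s k = Some q \<Longrightarrow> \<exists>p. s j = Some p \<and> cmod (fst q) \<le> cmod (fst p)"
    then show thesis by (rule that)
  qed (use pos fin in auto)
  \<comment> \<open>The sequence counts from 1 and the enumeration from 0; an exhausted enumeration
    is continued by zeros.\<close>
  define lam where "lam n = (case s (n - 1) of None \<Rightarrow> 0 | Some p \<Rightarrow> fst p)" for n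
  have "eigenvalue_sequence X L lam"
    unfolding eigenvalue_sequence_def
  proof (intro conjI allI impI)
    fix m n :: nat assume mn: "1 \<le> m \<and> m \<le> n"
    show "cmod (lam n) \<le> cmod (lam m)"
    proof (cases "s (n - 1)")
      case None
      then show ?thesis by (simp add: lam_def)
    next
      case (Some q)
      have "m - 1 \<le> n - 1" using mn by linarith
      from s(4)[OF this Some] show ?thesis using Some by (auto simp: lam_def)
    qed
  next
    fix \<mu> :: complex assume \<mu>: "\<mu> \<noteq> 0"
    show "\<exists>b. finite b \<and> gen_eigenspace X L \<mu> \<subseteq> cfun_span b" by (rule gen_eigenspace_finite_dim[OF \<mu>])
    have "bij_betw (\<lambda>n. snd (the (s (n - 1)))) {n. 1 \<le> n \<and> lam n = \<mu>} {..<multiplicity_of \<mu>}"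
    proof (rule bij_betw_imageI)
      have some: "\<exists>i. s (n - 1) = Some (\<mu>, i) \<and> i < multiplicity_of \<mu>" if "lam n = \<mu>" for n
      proof (cases "s (n - 1)")
        case None
        then show ?thesis using that \<mu> by (simp add: lam_def)
      next
        case (Some p)
        then show ?thesis using that s(1)[OF Some] by (cases p) (auto simp: lam_def A_def)
      qed
      show "inj_on (\<lambda>n. snd (the (s (n - 1)))) {n. 1 \<le> n \<and> lam n = \<mu>}"
      proof (rule inj_onI)
        fix m n assume m: "m \<in> {n. 1 \<le> n \<and> lam n = \<mu>}" and n: "n \<in> {n. 1 \<le> n \<and> lam n = \<mu>}"
          and eq: "snd (the (s (m - 1))) = snd (the (s (n - 1)))"
        from some[of m] some[of n] m n obtain i j where "s (m - 1) = Some (\<mu>, i)" "s (n - 1) = Some (\<mu>, j)" by auto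
        with eq have "m - 1 = n - 1" by (intro s(3)) auto
        then show "m = n" using m n by (simp, linarith)
      qed
      show "(\<lambda>n. snd (the (s (n - 1)))) ` {n. 1 \<le> n \<and> lam n = \<mu>} = {..<multiplicity_of \<mu>}"
      proof (intro equalityI subsetI)
        fix x assume "x \<in> (\<lambda>n. snd (the (s (n - 1)))) ` {n. 1 \<le> n \<and> lam n = \<mu>}"
        then show "x \<in> {..<multiplicity_of \<mu>}" using some by fastforce
      next
        fix i assume "i \<in> {..<multiplicity_of \<mu>}"
        then have "(\<mu>, i) \<in> A" using \<mu> by (simp add: A_def)
        then obtain k where k: "s k = Some (\<mu>, i)" using s(2) by blast
        then show "i \<in> (\<lambda>n. snd (the (s (n - 1)))) ` {n. 1 \<le> n \<and> lam n = \<mu>}"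
          by (intro image_eqI[of _ _ "Suc k"]) (auto simp: lam_def)
      qed
    qed
    then show "finite {n. 1 \<le> n \<and> lam n = \<mu>}" "card {n. 1 \<le> n \<and> lam n = \<mu>} = multiplicity_of \<mu>"
      using bij_betw_finite bij_betw_same_card by fastforce+
  qed
  then show ?thesis by blast
qed

end

subsection \<open>Compactness of the transfer operator\<close>

lemma bounded_cmult_image: "bounded (f ` S) \<Longrightarrow> bounded ((\<lambda>x. a * f x) ` S)"
  for f :: "'a \<Rightarrow> complex"
  using bounded_linear_image[OF _ bounded_linear_mult_right, of "f ` S" a] by (simp add: image_image)

lemma hardy_space_closed:
  fixes c :: "complex ^ 'n"
  assumes R: "0 < R" and f: "f \<in> hardy_space c R" and g: "g \<in> hardy_space c R"
  shows "(\<lambda>x. a * f x + b * g x) \<in> hardy_space c R"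
proof -
  let ?M = "sphere_measure c R"
  obtain f' g' where "hardy_boundary c R f f'" "hardy_boundary c R g g'"
    using f g by (auto simp: hardy_space_def)
  note fb = this(1) and gb = this(2)
  from fb obtain p where f': "f' \<in> L2 ?M" and p: "\<And>k. p k \<in> ball_algebra c R"
    and lp: "(\<lambda>k. L2_norm ?M (\<lambda>x. p k x - f' x)) \<longlonglongrightarrow> 0"
    and up: "\<And>K. compact K \<Longrightarrow> K \<subseteq> ball c R \<Longrightarrow> uniform_limit K p f sequentially"
    unfolding hardy_boundary_def by blast
  from gb obtain q where g': "g' \<in> L2 ?M" and q: "\<And>k. q k \<in> ball_algebra c R"
    and lq: "(\<lambda>k. L2_norm ?M (\<lambda>x. q k x - g' x)) \<longlonglongrightarrow> 0"
    and uq: "\<And>K. compact K \<Longrightarrow> K \<subseteq> ball c R \<Longrightarrow> uniform_limit K q g sequentially"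
    unfolding hardy_boundary_def by blast
  note fg = f' g'
  note pc = ball_algebraD[OF R p] and qc = ball_algebraD[OF R q]
  note pL = continuous_in_L2[OF R pc(2)] and qL = continuous_in_L2[OF R qc(2)]
  have "hardy_boundary c R (\<lambda>x. a * f x + b * g x) (\<lambda>x. a * f' x + b * g' x)"
    unfolding hardy_boundary_def
  proof (intro conjI exI[of _ "\<lambda>k x. a * p k x + b * q k x"] allI impI)
    show "(\<lambda>x. a * f' x + b * g' x) \<in> L2 ?M" by (intro L2_add(1) L2_cmult(1) fg)
    show "(\<lambda>x. a * p k x + b * q k x) \<in> ball_algebra c R" for k
      using p[of k] q[of k] unfolding ball_algebra_def Hinfty_def
      by (auto intro!: cholomorphic_on_add cholomorphic_on_cmult continuous_intros bounded_plus_comp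
        bounded_cmult_image)
    show "uniform_limit K (\<lambda>k x. a * p k x + b * q k x) (\<lambda>x. a * f x + b * g x) sequentially"
      if "compact K \<and> K \<subseteq> ball c R" for K
    proof -
      have mult: "uniform_limit K (\<lambda>k x. e * P k x) (\<lambda>x. e * F x) sequentially"
        if "uniform_limit K P F sequentially" for e :: complex and P F
        using bounded_linear.uniform_limit[OF bounded_linear_mult_right that, of e] .
      show ?thesis using that by (intro uniform_limit_add mult up uq) auto
    qed
    have "(\<lambda>k. cmod a * L2_norm ?M (\<lambda>x. p k x - f' x) + cmod b * L2_norm ?M (\<lambda>x. q k x - g' x)) \<longlonglongrightarrow> cmod a * 0 + cmod b * 0"
      by (intro tendsto_intros lp lq)
    then have lim: "(\<lambda>k. cmod a * L2_norm ?M (\<lambda>x. p k x - f' x) + cmod b * L2_norm ?M (\<lambda>x. q k x - g' x)) \<longlonglongrightarrow> 0" by simp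
    show "(\<lambda>k. L2_norm ?M (\<lambda>x. a * p k x + b * q k x - (a * f' x + b * g' x))) \<longlonglongrightarrow> 0"
    proof (rule tendsto_sandwich[OF _ _ tendsto_const lim])
      have "L2_norm ?M (\<lambda>x. a * p k x + b * q k x - (a * f' x + b * g' x))
        \<le> cmod a * L2_norm ?M (\<lambda>x. p k x - f' x) + cmod b * L2_norm ?M (\<lambda>x. q k x - g' x)" for k
      proof -
        have d: "(\<lambda>x. p k x - f' x) \<in> L2 ?M" "(\<lambda>x. q k x - g' x) \<in> L2 ?M"
          by (intro L2_diff(1) pL qL fg)+
        have "L2_norm ?M (\<lambda>x. a * (p k x - f' x) + b * (q k x - g' x))
          \<le> L2_norm ?M (\<lambda>x. a * (p k x - f' x)) + L2_norm ?M (\<lambda>x. b * (q k x - g' x))"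
          by (intro L2_add(2) L2_cmult(1) d)
        then show ?thesis unfolding L2_cmult(2)[OF d(1)] L2_cmult(2)[OF d(2)] by (simp add: algebra_simps)
      qed
      then show "\<forall>\<^sub>F k in sequentially. L2_norm ?M (\<lambda>x. a * p k x + b * q k x - (a * f' x + b * g' x))
        \<le> cmod a * L2_norm ?M (\<lambda>x. p k x - f' x) + cmod b * L2_norm ?M (\<lambda>x. q k x - g' x)" by simp
    qed (simp add: L2_norm_nonneg)
  qed
  then show ?thesis using f g by (auto simp: hardy_space_def)
qed

locale transfer =
  fixes c :: "complex ^ 'n" and R r W :: real and I :: "'i set"
    and w :: "'i \<Rightarrow> complex ^ 'n \<Rightarrow> complex"
    and T :: "'i \<Rightarrow> complex ^ 'n \<Rightarrow> complex ^ 'n"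
  assumes r: "0 < r" "r < 1" and R: "0 < R"
    and w_hol: "\<And>i. i \<in> I \<Longrightarrow> w i cholomorphic_on ball c R"
    and w_bdd: "\<And>i. i \<in> I \<Longrightarrow> bdd_above ((\<lambda>z. cmod (w i z)) ` ball c R)"
    and w_summable: "(\<lambda>i. SUP z\<in>ball c R. cmod (w i z)) summable_on I"
    and T_hol: "\<And>i. i \<in> I \<Longrightarrow> T i cholomorphic_map_on ball c R"
    and T_in: "(\<Union>i\<in>I. T i ` ball c R) \<subseteq> ball c (r * R)"
    and W: "W = (SUP z\<in>ball c R. \<Sum>\<^sub>\<infinity>i\<in>I. cmod (w i z))"
begin

abbreviation "B \<equiv> ball c R"
abbreviation "L \<equiv> transfer_operator B I w T"

definition "w_sup i = (SUP z\<in>B. cmod (w i z))"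

lemma rR: "r * R < R" "0 < r * R"
  using r R by simp_all

lemma w_le: "i \<in> I \<Longrightarrow> z \<in> B \<Longrightarrow> cmod (w i z) \<le> w_sup i"
  unfolding w_sup_def by (rule cSUP_upper[OF _ w_bdd])

lemma w_abs_summable: "z \<in> B \<Longrightarrow> (\<lambda>i. cmod (w i z)) summable_on I"
  by (rule summable_on_comparison_test[OF w_summable]) (use w_le in \<open>auto simp: w_sup_def\<close>)

lemma sum_w_le_W:
  assumes z: "z \<in> B"
  shows "(\<Sum>\<^sub>\<infinity>i\<in>I. cmod (w i z)) \<le> W"
  unfolding W
proof (rule cSUP_upper[OF z])
  show "bdd_above ((\<lambda>z. \<Sum>\<^sub>\<infinity>i\<in>I. cmod (w i z)) ` B)"
  proof (rule bdd_aboveI2)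
    fix z assume "z \<in> B"
    then show "(\<Sum>\<^sub>\<infinity>i\<in>I. cmod (w i z)) \<le> (\<Sum>\<^sub>\<infinity>i\<in>I. w_sup i)"
      using w_summable by (intro infsum_mono w_abs_summable) (auto simp: w_le w_sup_def[symmetric])
  qed
qed

lemma W_nonneg: "0 \<le> W"
  using sum_w_le_W[of c] infsum_nonneg[of I "\<lambda>i. cmod (w i c)"] R by simp

lemma T_in_ball: "i \<in> I \<Longrightarrow> z \<in> B \<Longrightarrow> T i z \<in> ball c (r * R)"
  using T_in by blast

lemma terms_summable:
  assumes f: "\<And>y. y \<in> ball c (r * R) \<Longrightarrow> cmod (f y) \<le> M" and z: "z \<in> B"
  shows "(\<lambda>i. cmod (w i z * f (T i z))) summable_on I"
proof (rule summable_on_comparison_test)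
  show "(\<lambda>i. cmod (w i z) * M) summable_on I" by (intro summable_on_cmult_left w_abs_summable z)
  show "cmod (w i z * f (T i z)) \<le> cmod (w i z) * M" if "i \<in> I" for i
    unfolding norm_mult by (intro mult_left_mono f T_in_ball that z) simp
qed simp

text \<open>Every \<open>T i\<close> maps into the ball of radius \<open>r * R\<close>, so only the
  values of \<open>f\<close> there enter. This gain of a smaller ball drives both compactness and
  the decay of the eigenvalues.\<close>

lemma L_norm_le:
  assumes f: "\<And>y. y \<in> ball c (r * R) \<Longrightarrow> cmod (f y) \<le> M"
  shows "cmod (L f z) \<le> W * M"
proof (cases "z \<in> B")
  case True
  have M: "0 \<le> M" using f[of c] rR(2) norm_ge_zero[of "f c"] by (simp del: norm_ge_zero)
  have "cmod (L f z) \<le> (\<Sum>\<^sub>\<infinity>i\<in>I. cmod (w i z * f (T i z)))"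
    using True norm_infsum_bound[OF terms_summable[of f M z]] f by (simp add: transfer_operator_def)
  also have "\<dots> \<le> (\<Sum>\<^sub>\<infinity>i\<in>I. cmod (w i z) * M)"
  proof (rule infsum_mono)
    show "(\<lambda>i. cmod (w i z * f (T i z))) summable_on I" using terms_summable[of f M z] f True by simp
    show "(\<lambda>i. cmod (w i z) * M) summable_on I" by (intro summable_on_cmult_left w_abs_summable True)
    show "cmod (w i z * f (T i z)) \<le> cmod (w i z) * M" if "i \<in> I" for i
      unfolding norm_mult by (intro mult_left_mono f T_in_ball that True) simp
  qed
  also have "\<dots> = (\<Sum>\<^sub>\<infinity>i\<in>I. cmod (w i z)) * M" by (rule infsum_cmult_left')
  also have "\<dots> \<le> W * M" by (rule mult_right_mono[OF sum_w_le_W[OF True] M])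
  finally show ?thesis .
next
  case False
  have M: "0 \<le> M" using f[of c] rR(2) norm_ge_zero[of "f c"] by (simp del: norm_ge_zero)
  then show ?thesis using False W_nonneg by (simp add: transfer_operator_def)
qed

lemma L_linear:
  assumes f: "\<And>y. y \<in> ball c (r * R) \<Longrightarrow> cmod (f y) \<le> M" and g: "\<And>y. y \<in> ball c (r * R) \<Longrightarrow> cmod (g y) \<le> M'"
  shows "L (\<lambda>x. a * f x + b * g x) = (\<lambda>x. a * L f x + b * L g x)"
proof
  fix z
  show "L (\<lambda>x. a * f x + b * g x) z = a * L f z + b * L g z"
  proof (cases "z \<in> B")
    case True
    have s: "(\<lambda>i. w i z * f (T i z)) summable_on I" "(\<lambda>i. w i z * g (T i z)) summable_on I"
      using terms_summable[of f M z] terms_summable[of g M' z] f g True by (auto intro: abs_summable_summable)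
    have "(\<Sum>\<^sub>\<infinity>i\<in>I. w i z * (a * f (T i z) + b * g (T i z)))
       = (\<Sum>\<^sub>\<infinity>i\<in>I. a * (w i z * f (T i z)) + b * (w i z * g (T i z)))"
      by (simp add: algebra_simps)
    also have "\<dots> = (\<Sum>\<^sub>\<infinity>i\<in>I. a * (w i z * f (T i z))) + (\<Sum>\<^sub>\<infinity>i\<in>I. b * (w i z * g (T i z)))"
      by (intro infsum_add summable_on_cmult_right s)
    also have "\<dots> = a * (\<Sum>\<^sub>\<infinity>i\<in>I. w i z * f (T i z)) + b * (\<Sum>\<^sub>\<infinity>i\<in>I. w i z * g (T i z))"
      by (simp only: infsum_cmult_right')
    finally show ?thesis using True by (simp add: transfer_operator_def)
  qed (simp add: transfer_operator_def)
qed

text \<open>The Weierstrass M-test gives uniform convergence of the series on the whole ball, with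
  majorants \<open>w_sup i * M\<close>.\<close>

lemma L_cholomorphic:
  assumes f: "f cholomorphic_on B" and M: "\<And>y. y \<in> ball c (r * R) \<Longrightarrow> cmod (f y) \<le> M"
  shows "L f cholomorphic_on B"
proof -
  let ?S = "\<lambda>F z. \<Sum>i\<in>F. w i z * f (T i z)"
  have lim: "uniform_limit B ?S (\<lambda>z. \<Sum>\<^sub>\<infinity>i\<in>I. w i z * f (T i z)) (finite_subsets_at_top I)"
  proof (rule Weierstrass_m_test_general)
    show "(\<lambda>i. w_sup i * M) summable_on I" using w_summable unfolding w_sup_def[symmetric] by (rule summable_on_cmult_left)
    have M0: "0 \<le> M" using M[of c] rR(2) norm_ge_zero[of "f c"] by (simp del: norm_ge_zero)
    show "cmod (w i z * f (T i z)) \<le> w_sup i * M" if "i \<in> I" "z \<in> B" for i z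
      unfolding norm_mult using w_le[OF that] M[OF T_in_ball[OF that]] M0
      by (intro mult_mono) (auto intro: order_trans[OF norm_ge_zero])
  qed
  \<comment> \<open>The M-test speaks of the net of finite subsets of \<open>I\<close>; finite sums
    with error below \<open>1 / (real k + 1)\<close> are picked to obtain a sequence.\<close>
  have "\<exists>F. finite F \<and> F \<subseteq> I \<and> (\<forall>z\<in>B. dist (?S F z) (\<Sum>\<^sub>\<infinity>i\<in>I. w i z * f (T i z)) < 1 / (real k + 1))" for k :: nat
  proof -
    have "0 < 1 / (real k + 1)" by simp
    from uniform_limitD[OF lim this] obtain X where "finite X" "X \<subseteq> I"
      "\<forall>Y. finite Y \<and> X \<subseteq> Y \<and> Y \<subseteq> I \<longrightarrow>
        (\<forall>z\<in>B. dist (?S Y z) (\<Sum>\<^sub>\<infinity>i\<in>I. w i z * f (T i z)) < 1 / (real k + 1))"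
      unfolding eventually_finite_subsets_at_top by (elim exE conjE)
    then show ?thesis by (intro exI[of _ X]) simp
  qed
  then have "\<exists>F. \<forall>k. finite (F k) \<and> F k \<subseteq> I \<and>
      (\<forall>z\<in>B. dist (?S (F k) z) (\<Sum>\<^sub>\<infinity>i\<in>I. w i z * f (T i z)) < 1 / (real k + 1))"
    by (intro choice allI)
  then obtain F where F': "\<forall>k. finite (F k) \<and> F k \<subseteq> I \<and>
      (\<forall>z\<in>B. dist (?S (F k) z) (\<Sum>\<^sub>\<infinity>i\<in>I. w i z * f (T i z)) < 1 / (real k + 1))" by (rule exE)
  then have F: "\<And>k. F k \<subseteq> I"
    "\<And>k z. z \<in> B \<Longrightarrow> dist (?S (F k) z) (\<Sum>\<^sub>\<infinity>i\<in>I. w i z * f (T i z)) < 1 / (real k + 1)" by simp_all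
  have conv: "uniform_limit B (\<lambda>k. ?S (F k)) (L f) sequentially"
  proof (rule uniform_limit_of_bound)
    fix k z assume z: "z \<in> B"
    show "cmod (?S (F k) z - L f z) \<le> 1 / (real k + 1)"
      using F(2)[OF z, of k] z by (simp add: dist_norm transfer_operator_def)
  qed
  have Sh: "?S (F k) cholomorphic_on B" for k
  proof (intro cholomorphic_on_sum cholomorphic_on_mult)
    fix i assume "i \<in> F k"
    then have i: "i \<in> I" using F(1) by blast
    show "w i cholomorphic_on B" by (rule w_hol[OF i])
    have "T i ` B \<subseteq> B" using T_in_ball[OF i] rR(1) by fastforce
    then show "(\<lambda>z. f (T i z)) cholomorphic_on B" by (rule cholomorphic_on_compose[OF T_hol[OF i] f])
  qed
  show ?thesis
  proof (rule cholomorphic_locally_uniform_limit[OF open_ball])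
    fix z assume "z \<in> B"
    then obtain \<delta> where \<delta>: "\<delta> > 0" "ball z \<delta> \<subseteq> B" using openE[OF open_ball] by blast
    then show "\<exists>\<delta>>0. (\<forall>k. ?S (F k) cholomorphic_on ball z \<delta>) \<and> uniform_limit (ball z \<delta>) (\<lambda>k. ?S (F k)) (L f) sequentially"
      using Sh conv by (intro exI[of _ \<delta>]) (auto intro: cholomorphic_on_subset uniform_limit_on_subset)
  qed
qed

lemma L_zero_outside: "z \<notin> B \<Longrightarrow> L f z = 0"
  by (simp add: transfer_operator_def)

lemma hardy_bounded:
  assumes f: "f \<in> hardy_space c R"
  obtains M where "\<And>y. y \<in> ball c (r * R) \<Longrightarrow> cmod (f y) \<le> M"
proof -
  have "cball c (r * R) \<subseteq> B" using rR(1) by auto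
  from bounded_on_cball[OF hardy_space_cholomorphic[OF R f] this]
  show ?thesis using that by (metis ball_subset_cball subsetD)
qed

lemma L_in_hardy:
  assumes f: "f \<in> hardy_space c R"
  shows "L f \<in> hardy_space c R"
proof -
  obtain M where M: "\<And>y. y \<in> ball c (r * R) \<Longrightarrow> cmod (f y) \<le> M" using hardy_bounded[OF f] by blast
  show ?thesis
    by (rule bounded_in_hardy_space(1)[OF R L_cholomorphic[OF hardy_space_cholomorphic[OF R f] M] L_norm_le[OF M] L_zero_outside])
qed

lemma L_linear_hardy:
  assumes "f \<in> hardy_space c R" "g \<in> hardy_space c R"
  shows "L (\<lambda>x. a * f x + b * g x) = (\<lambda>x. a * L f x + b * L g x)"
proof -
  obtain M where M: "\<And>y. y \<in> ball c (r * R) \<Longrightarrow> cmod (f y) \<le> M" using hardy_bounded[OF assms(1)] by blast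
  obtain M' where M': "\<And>y. y \<in> ball c (r * R) \<Longrightarrow> cmod (g y) \<le> M'" using hardy_bounded[OF assms(2)] by blast
  show ?thesis by (rule L_linear[OF M M'])
qed

text \<open>A Montel argument. Functions bounded in the Hardy norm are uniformly bounded on a ball
  of radius between \<open>r * R\<close> and \<open>R\<close>, hence equi-Lipschitz on
  \<open>cball c (r * R)\<close>. Arzela-Ascoli gives a uniform limit \<open>g0\<close> there, and
  \<open>L\<close> turns this into uniform convergence on the whole ball, which dominates the Hardy
  norm.\<close>

lemma L_compact: "compact_operator (hardy_space c R) (hardy_norm c R) L"
  unfolding compact_operator_def
proof (intro conjI ballI allI impI)
  fix F assume "(\<forall>k::nat. F k \<in> hardy_space c R) \<and> (\<exists>C. \<forall>k. hardy_norm c R (F k) \<le> C)"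
  then obtain C where F: "\<And>k. F k \<in> hardy_space c R" and C: "\<And>k. hardy_norm c R (F k) \<le> C" by blast
  note F_hol = hardy_space_cholomorphic[OF R F]
  \<comment> \<open>The margin between \<open>r\<close> and \<open>\<rho>\<close> is what Cauchy's
    estimate needs for the derivatives on the ball of radius \<open>r * R\<close>.\<close>
  define \<rho> where "\<rho> = (1 + r) / 2"
  have \<rho>: "0 \<le> \<rho>" "\<rho> < 1" "r < \<rho>" using r by (auto simp: \<rho>_def)
  define M where "M = sqrt (1 / (1 - \<rho>\<^sup>2) ^ CARD('n) * C\<^sup>2)"
  have FM: "cmod (F k z) \<le> M" if "dist c z \<le> \<rho> * R" for k z
    unfolding M_def
  proof (rule real_le_rsqrt)
    have "\<rho>\<^sup>2 \<le> 1" using \<rho> by (simp add: power_le_one)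
    then have "1 / (1 - \<rho>\<^sup>2) ^ CARD('n) * (hardy_norm c R (F k))\<^sup>2 \<le> 1 / (1 - \<rho>\<^sup>2) ^ CARD('n) * C\<^sup>2"
      using C[of k] by (intro mult_left_mono power_mono hardy_norm_nonneg R) auto
    with hardy_space_point_bound[OF R F \<rho>(1,2) that, of k]
    show "(cmod (F k z))\<^sup>2 \<le> 1 / (1 - \<rho>\<^sup>2) ^ CARD('n) * C\<^sup>2" by linarith
  qed
  let ?S = "cball c (r * R)"
  have rhoR: "r * R < \<rho> * R" "\<rho> * R < R" using \<rho> R by auto
  have S_sub: "?S \<subseteq> B" using rR(1) by auto
  define \<delta> where "\<delta> = (\<rho> - r) * R"
  have \<delta>: "\<delta> > 0" using \<rho> R by (simp add: \<delta>_def)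
  have lip: "cmod (F k x - F k y) \<le> 2 * M / \<delta> * norm (x - y)" if xy: "x \<in> ?S" "y \<in> ?S" for k x y
  proof -
    have "\<forall>z\<in>B. \<exists>D. (F k has_derivative D) (at z) \<and> (\<forall>a x. D (a *s x) = a * D x)"
      using F_hol[of k] by (simp add: cholomorphic_on_open_iff)
    then obtain D where D: "\<And>z. z \<in> B \<Longrightarrow> (F k has_derivative D z) (at z)"
      "\<And>z a x. z \<in> B \<Longrightarrow> D z (a *s x) = a * D z x" by metis
    show ?thesis
    proof (rule differentiable_bound[OF convex_cball _ _ xy])
      fix z assume z: "z \<in> ?S"
      then have zB: "z \<in> B" using S_sub by blast
      show "(F k has_derivative D z) (at z within ?S)" by (rule has_derivative_at_withinI[OF D(1)[OF zB]])
      have near: "dist c y \<le> \<rho> * R" if "y \<in> ball z \<delta>" for y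
        using dist_triangle[of c y z] that z by (simp add: \<delta>_def algebra_simps)
      then have sub: "ball z \<delta> \<subseteq> B" using rhoR(2) by fastforce
      show "onorm (D z) \<le> 2 * M / \<delta>"
      proof (rule onorm_le)
        fix v
        show "norm (D z v) \<le> 2 * M / \<delta> * norm v"
          by (rule cholomorphic_derivative_bound[OF cholomorphic_on_subset[OF F_hol sub] FM[OF near] \<delta> D(1)[OF zB] D(2)[OF zB]])
      qed
    qed
  qed
  have M0: "M \<ge> 0" using FM[of c 0] \<rho>(1) R order_trans[OF norm_ge_zero] by auto
  obtain g0 s where g0: "continuous_on ?S g0" and s: "strict_mono (s :: nat \<Rightarrow> nat)"
    and conv: "\<And>e. 0 < e \<Longrightarrow> \<exists>N. \<forall>n x. n \<ge> N \<and> x \<in> ?S \<longrightarrow> norm (F (s n) x - g0 x) < e"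
  proof (rule Arzela_Ascoli[OF compact_cball, of c "r * R" F M])
    show "cmod (F k x) \<le> M" if "x \<in> ?S" for k x using FM[of x k] that rhoR(1) by simp
    fix x and e :: real assume x: "x \<in> ?S" and e: "0 < e"
    have pos: "0 < 2 * M / \<delta> + 1" using M0 \<delta> by (simp add: add_nonneg_pos)
    show "\<exists>d>0. \<forall>k y. y \<in> ?S \<and> norm (x - y) < d \<longrightarrow> cmod (F k x - F k y) < e"
    proof (intro exI[of _ "e / (2 * M / \<delta> + 1)"] conjI allI impI)
      show "0 < e / (2 * M / \<delta> + 1)" using e pos by simp
      fix k y assume y: "y \<in> ?S \<and> norm (x - y) < e / (2 * M / \<delta> + 1)"
      have "cmod (F k x - F k y) \<le> 2 * M / \<delta> * norm (x - y)" using lip[OF x] y by blast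
      also have "\<dots> \<le> (2 * M / \<delta> + 1) * norm (x - y)" by (intro mult_right_mono) auto
      also have "\<dots> < e" using y pos by (simp add: pos_less_divide_eq mult.commute)
      finally show "cmod (F k x - F k y) < e" .
    qed
  qed (use that in auto)
  have ballS: "ball c (r * R) \<subseteq> ?S" by (rule ball_subset_cball)
  have "bounded (g0 ` ?S)" by (intro compact_imp_bounded compact_continuous_image g0 compact_cball)
  then obtain M' where M': "\<forall>y\<in>g0 ` ?S. cmod y \<le> M'" unfolding bounded_iff by (elim exE)
  have g0M: "cmod (g0 y) \<le> M'" if "y \<in> ball c (r * R)" for y using M' that ballS by blast
  have FMb: "cmod (F k y) \<le> M" if "y \<in> ball c (r * R)" for k y using FM[of y k] that rhoR(1) by simp
  have diff_le: "cmod (L (F (s k)) z - L g0 z) \<le> W * e"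
    if e: "\<And>x. x \<in> ?S \<Longrightarrow> norm (F (s k) x - g0 x) \<le> e" for k e z
  proof -
    have "L (\<lambda>x. 1 * F (s k) x + (- 1) * g0 x) = (\<lambda>x. 1 * L (F (s k)) x + (- 1) * L g0 x)"
      by (rule L_linear[OF FMb g0M])
    moreover have "cmod (L (\<lambda>x. 1 * F (s k) x + (- 1) * g0 x) z) \<le> W * e"
      by (rule L_norm_le) (use e ballS in auto)
    ultimately show ?thesis by simp
  qed
  have unif: "uniform_limit B (\<lambda>k. L (F (s k))) (L g0) sequentially"
  proof (rule uniform_limitI)
    fix e :: real assume e: "e > 0"
    then have "0 < e / (W + 1)" using W_nonneg by (simp add: add_nonneg_pos)
    from conv[OF this] obtain N where N: "\<And>n x. n \<ge> N \<Longrightarrow> x \<in> ?S \<Longrightarrow> norm (F (s n) x - g0 x) < e / (W + 1)" by blast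
    have "W * (e / (W + 1)) < e" using e W_nonneg by (simp add: field_simps add_pos_nonneg)
    have "dist (L (F (s n)) z) (L g0 z) < e" if "n \<ge> N" for n z
    proof -
      have "cmod (L (F (s n)) z - L g0 z) \<le> W * (e / (W + 1))"
        by (rule diff_le) (use N[OF that] in \<open>simp add: less_imp_le\<close>)
      with \<open>W * (e / (W + 1)) < e\<close> show ?thesis by (simp add: dist_norm)
    qed
    then show "\<forall>\<^sub>F n in sequentially. \<forall>x\<in>B. dist (L (F (s n)) x) (L g0 x) < e"
      unfolding eventually_sequentially by blast
  qed
  have LF_hol: "L (F k) cholomorphic_on B" for k by (rule L_cholomorphic[OF F_hol FMb])
  \<comment> \<open>The limit \<open>g0\<close> is known merely as a continuous function on
    \<open>cball c (r * R)\<close>; holomorphy of \<open>L g0\<close> comes from the uniform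
    convergence of \<open>L (F (s k))\<close>.\<close>
  have G_hol: "L g0 cholomorphic_on B"
  proof (rule cholomorphic_locally_uniform_limit[OF open_ball])
    fix z assume "z \<in> B"
    then obtain \<delta> where \<delta>: "\<delta> > 0" "ball z \<delta> \<subseteq> B" using openE[OF open_ball] by blast
    then show "\<exists>\<delta>>0. (\<forall>k. L (F (s k)) cholomorphic_on ball z \<delta>) \<and> uniform_limit (ball z \<delta>) (\<lambda>k. L (F (s k))) (L g0) sequentially"
      using LF_hol unif by (intro exI[of _ \<delta>]) (auto intro: cholomorphic_on_subset uniform_limit_on_subset)
  qed
  show "\<exists>g\<in>hardy_space c R. \<exists>s. strict_mono s \<and> (\<lambda>k. hardy_norm c R (\<lambda>x. L (F (s k)) x - g x)) \<longlonglongrightarrow> 0"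
  proof (intro bexI[of _ "L g0"] exI[of _ s] conjI s)
    show "L g0 \<in> hardy_space c R"
      by (rule bounded_in_hardy_space(1)[OF R G_hol L_norm_le[OF g0M] L_zero_outside])
    show "(\<lambda>k. hardy_norm c R (\<lambda>x. L (F (s k)) x - L g0 x)) \<longlonglongrightarrow> 0"
    proof (rule LIMSEQ_I)
      fix e :: real assume e: "e > 0"
      then have "0 < e / (W + 1)" using W_nonneg by (simp add: add_nonneg_pos)
      from conv[OF this] obtain N where N: "\<And>n x. n \<ge> N \<Longrightarrow> x \<in> ?S \<Longrightarrow> norm (F (s n) x - g0 x) < e / (W + 1)" by blast
      have lt: "W * (e / (W + 1)) < e" using e W_nonneg by (simp add: field_simps add_pos_nonneg)
      have "hardy_norm c R (\<lambda>x. L (F (s n)) x - L g0 x) \<le> W * (e / (W + 1))" if n: "n \<ge> N" for n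
      proof (rule bounded_in_hardy_space(2)[OF R])
        show "(\<lambda>x. L (F (s n)) x - L g0 x) cholomorphic_on B" by (intro cholomorphic_on_diff LF_hol G_hol)
        show "cmod (L (F (s n)) z - L g0 z) \<le> W * (e / (W + 1))" for z
          by (rule diff_le) (use N[OF n] in \<open>simp add: less_imp_le\<close>)
      qed (simp add: L_zero_outside)
      from order.strict_trans1[OF this lt]
      have "norm (hardy_norm c R (\<lambda>x. L (F (s n)) x - L g0 x) - 0) < e" if "n \<ge> N" for n
        using that by (simp add: hardy_norm_nonneg[OF R])
      then show "\<exists>N. \<forall>n\<ge>N. norm (hardy_norm c R (\<lambda>x. L (F (s n)) x - L g0 x) - 0) < e" by blast
    qed
  qed
qed (use L_in_hardy L_linear_hardy in auto)

sublocale hardy: linear_op "hardy_space c R" L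
proof
  show "(\<lambda>_. 0) \<in> hardy_space c R"
    by (rule bounded_in_hardy_space(1)[OF R cholomorphic_on_const, of _ _ 0]) auto
qed (use hardy_space_closed[OF R] L_in_hardy L_linear_hardy in auto)

end

subsection \<open>Eigenvalue estimates\<close>

definition hdim :: "nat \<Rightarrow> nat \<Rightarrow> nat"
  where "hdim d m = (m + d - 1) choose m"

definition hdim_sum :: "nat \<Rightarrow> nat \<Rightarrow> nat"
  where "hdim_sum d K = (\<Sum>m<K. hdim d m)"

text \<open>
  The number of degrees all of whose homogeneous components can be annihilated by \<open>k\<close> functionals.
\<close>

definition level :: "nat \<Rightarrow> nat \<Rightarrow> nat"
  where "level d k = (GREATEST K. hdim_sum d K \<le> k)"

lemma hdim_pos: "1 \<le> d \<Longrightarrow> 1 \<le> hdim d m"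
  unfolding hdim_def using zero_less_binomial[of m "m + d - 1"] by linarith

lemma hdim_sum_ge: "1 \<le> d \<Longrightarrow> K \<le> hdim_sum d K"
  using sum_mono[of "{..<K}" "\<lambda>_. 1" "hdim d"] hdim_pos by (simp add: hdim_sum_def)

lemma level:
  assumes d: "1 \<le> d"
  shows "hdim_sum d (level d k) \<le> k" "k < hdim_sum d (Suc (level d k))" "hdim_sum d K \<le> k \<Longrightarrow> K \<le> level d k"
proof -
  have bd: "K \<le> k" if "hdim_sum d K \<le> k" for K using hdim_sum_ge[OF d, of K] that by simp
  have "hdim_sum d 0 \<le> k" by (simp add: hdim_sum_def)
  then show "hdim_sum d (level d k) \<le> k"
    unfolding level_def using bd by (rule GreatestI_nat)
  show *: "K \<le> level d k" if "hdim_sum d K \<le> k" for K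
    unfolding level_def by (rule Greatest_le_nat[where P = "\<lambda>K. hdim_sum d K \<le> k", OF that bd])
  show "k < hdim_sum d (Suc (level d k))" using *[of "Suc (level d k)"] by linarith
qed

lemma hdim_Suc: "hdim (Suc p) m = (m + p) choose p"
  by (simp add: hdim_def binomial_symmetric[of m "m + p"])

text \<open>The hockey-stick identity; with \<open>d = Suc p\<close> it counts the polynomials of
  degree below \<open>K\<close> in \<open>d\<close> variables.\<close>

lemma hdim_sum_Suc: "hdim_sum (Suc p) K = (K + p) choose Suc p"
proof (cases K)
  case (Suc n)
  have "hdim_sum (Suc p) K = (\<Sum>k\<le>n. (p + k) choose k)"
    by (simp add: hdim_sum_def hdim_def Suc lessThan_Suc_atMost add.commute)
  also have "\<dots> = Suc (p + n) choose n" by (rule sum_choose_lower)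
  also have "\<dots> = (K + p) choose Suc p"
    using binomial_symmetric[of n "Suc (p + n)"] by (simp add: Suc add.commute)
  finally show ?thesis .
qed (simp add: hdim_sum_def)

lemma level_1: "level 1 k = k"
proof (rule antisym)
  have "hdim_sum 1 K = K" for K using hdim_sum_Suc[of 0 K] by simp
  then show "level 1 k \<le> k" "k \<le> level 1 k" using level(1)[of 1 k] level(3)[of 1 k k] by auto
qed

text \<open>The square root of the constant in \<open>tail_bound\<close>. Times \<open>W\<close>, it
  bounds \<open>L\<close> on functions whose components of degree below \<open>K\<close>
  vanish.\<close>

definition tail_factor :: "nat \<Rightarrow> nat \<Rightarrow> real \<Rightarrow> real"
  where "tail_factor d K y = sqrt (real (hdim d K) * y ^ K / (1 - y) ^ d)"

lemma tail_factor_nonneg: "0 \<le> y \<Longrightarrow> y \<le> 1 \<Longrightarrow> 0 \<le> tail_factor d K y"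
  by (simp add: tail_factor_def)

lemma tail_factor_power2:
  "0 \<le> y \<Longrightarrow> y \<le> 1 \<Longrightarrow> (tail_factor d K y)\<^sup>2 = real (hdim d K) * y ^ K / (1 - y) ^ d"
  unfolding tail_factor_def by (rule real_sqrt_pow2) simp

lemma tail_factor_level_tendsto:
  assumes d: "1 \<le> d" and y: "0 \<le> y" "y < 1"
  shows "(\<lambda>k. tail_factor d (level d k) y) \<longlonglongrightarrow> 0"
proof -
  have "summable (\<lambda>m. real (hdim d m) * y ^ m)"
  proof (rule summableI_nonneg_bounded)
    fix M show "(\<Sum>m<M. real (hdim d m) * y ^ m) \<le> 1 / (1 - y) ^ d"
      using tail_sum_bound[OF y d, of 0 M] by (simp add: hdim_def lessThan_atLeast0)
  qed (use y in simp)
  then have "(\<lambda>m. real (hdim d m) * y ^ m) \<longlonglongrightarrow> 0" by (rule summable_LIMSEQ_zero)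
  then have "(\<lambda>K. sqrt (real (hdim d K) * y ^ K / (1 - y) ^ d)) \<longlonglongrightarrow> sqrt (0 / (1 - y) ^ d)"
    by (intro tendsto_intros) (use y in auto)
  then have "(\<lambda>K. tail_factor d K y) \<longlonglongrightarrow> 0" by (simp add: tail_factor_def)
  moreover have "filterlim (level d) at_top sequentially"
    unfolding filterlim_at_top eventually_sequentially
    using level(3)[OF d] by (meson order_trans)
  ultimately show ?thesis by (rule filterlim_compose)
qed

context transfer
begin

text \<open>The functionals are the coefficients of the component of degree \<open>m\<close> with
  respect to an orthonormal basis of \<open>hpoly m\<close>.\<close>

lemma component_functionals:
  "\<exists>\<Phi>. finite \<Phi> \<and> card \<Phi> \<le> hdim CARD('n) m \<and>
    (\<forall>\<phi>\<in>\<Phi>. \<forall>f\<in>hardy_space c R. \<forall>g\<in>hardy_space c R. \<forall>a b. \<phi> (\<lambda>x. a * f x + b * g x) = a * \<phi> f + b * \<phi> g) \<and>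
    (\<forall>f\<in>hardy_space c R. (\<forall>\<phi>\<in>\<Phi>. \<phi> f = 0) \<longrightarrow> hcomp m (to_unit c R f) = (\<lambda>_. 0))"
proof -
  obtain N and e :: "nat \<Rightarrow> complex ^ 'n \<Rightarrow> complex" where
    N: "N \<le> (m + CARD('n) - 1) choose m" and "orthonormal N e" and e: "\<And>j. j < N \<Longrightarrow> e j \<in> hpoly m"
    and exp: "\<And>G z. G \<in> hpoly m \<Longrightarrow> G z = (\<Sum>j<N. sphere_inner G (e j) * e j z)"
    using hpoly_orthonormal_basis[where m = m and 'n = 'n] by blast
  define \<Phi> where "\<Phi> = (\<lambda>j f. sphere_inner (hcomp m (to_unit c R f)) (e j)) ` {..<N}"
  have hol: "to_unit c R f cholomorphic_on ball 0 1" if "f \<in> hardy_space c R" for f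
    by (rule to_unit_cholomorphic[OF R hardy_space_cholomorphic[OF R that]])
  show ?thesis
  proof (intro exI[of _ \<Phi>] conjI ballI allI impI)
    show "finite \<Phi>" by (simp add: \<Phi>_def)
    show "card \<Phi> \<le> hdim CARD('n) m"
      using card_image_le[of "{..<N}" "\<lambda>j f. sphere_inner (hcomp m (to_unit c R f)) (e j)"] N
      by (simp add: \<Phi>_def hdim_def)
    fix \<phi> f g and a b :: complex
    assume \<phi>: "\<phi> \<in> \<Phi>" and f: "f \<in> hardy_space c R" and g: "g \<in> hardy_space c R"
    from \<phi> obtain j where j: "j < N" "\<phi> = (\<lambda>f. sphere_inner (hcomp m (to_unit c R f)) (e j))"
      by (auto simp: \<Phi>_def)
    have "hcomp m (to_unit c R (\<lambda>x. a * f x + b * g x)) = (\<lambda>z. a * hcomp m (to_unit c R f) z + b * hcomp m (to_unit c R g) z)"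
      using hcomp_linear[OF hol[OF f] hol[OF g], of m a b] by (intro ext) (simp add: to_unit_def[abs_def])
    then show "\<phi> (\<lambda>x. a * f x + b * g x) = a * \<phi> f + b * \<phi> g"
      unfolding j(2)
      by (simp add: sphere_inner_add_left hpoly_imp_continuous_on[OF hcomp_in_hpoly[OF hol]] f g
          hpoly_imp_continuous_on[OF e[OF j(1)]])
  next
    fix f assume f: "f \<in> hardy_space c R" and 0: "\<forall>\<phi>\<in>\<Phi>. \<phi> f = 0"
    show "hcomp m (to_unit c R f) = (\<lambda>_. 0)"
    proof
      fix z
      have "hcomp m (to_unit c R f) z = (\<Sum>j<N. sphere_inner (hcomp m (to_unit c R f)) (e j) * e j z)"
        by (rule exp[OF hcomp_in_hpoly[OF hol[OF f]]])
      also have "\<dots> = 0" by (rule sum.neutral) (use 0 in \<open>auto simp: \<Phi>_def\<close>)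
      finally show "hcomp m (to_unit c R f) z = 0" .
    qed
  qed
qed

definition dilated_inner :: "real \<Rightarrow> (complex ^ 'n \<Rightarrow> complex) \<Rightarrow> (complex ^ 'n \<Rightarrow> complex) \<Rightarrow> complex"
  where "dilated_inner s f g = sphere_inner (\<lambda>x. to_unit c R f (complex_of_real s *s x)) (\<lambda>x. to_unit c R g (complex_of_real s *s x))"

text \<open>By Parseval's identity a vanishing norm on the inner sphere annihilates every
  homogeneous component, hence \<open>f\<close> on the ball; outside the ball \<open>f\<close> is 0
  by convention.\<close>

lemma dilated_inner_pos:
  assumes s: "0 < s" "s < 1" and f: "f \<in> hardy_space c R" and nz: "f \<noteq> (\<lambda>_. 0)"
  shows "0 < Re (dilated_inner s f f)"
proof (rule ccontr)
  let ?u = "to_unit c R f"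
  have u: "?u cholomorphic_on ball 0 1" by (rule to_unit_cholomorphic[OF R hardy_space_cholomorphic[OF R f]])
  assume "\<not> 0 < Re (dilated_inner s f f)"
  then have "sphere_norm2 (\<lambda>x. ?u (complex_of_real s *s x)) = 0"
    using sphere_norm2_nonneg[of "\<lambda>x. ?u (complex_of_real s *s x)"] by (simp add: dilated_inner_def sphere_inner_self)
  then have sums: "(\<lambda>m. s ^ (2 * m) * sphere_norm2 (hcomp m ?u)) sums 0"
    using sphere_norm2_dilate_sums[OF u, of s] s by simp
  have "s ^ (2 * m) * sphere_norm2 (hcomp m ?u) = 0" for m
    using suminf_eq_zero_iff[OF sums_summable[OF sums]] sums_unique[OF sums] s
    by (simp add: sphere_norm2_nonneg)
  then have "sphere_norm2 (hcomp m ?u) = 0" for m using s by simp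
  then have h0: "hcomp m ?u = (\<lambda>_. 0)" for m by (rule hpoly_norm2_eq_0[OF hcomp_in_hpoly[OF u]])
  have "f y = 0" for y
  proof (cases "y \<in> B")
    case True
    let ?z = "complex_of_real (1 / R) *s (y - c)"
    have "norm (1 *s ?z) < 1"
      using True norm_affine_inverse[OF R, where c = c and z = y] R by (simp del: vector_ssub_ldistrib)
    from hcomp_sums[OF u this] have "(\<lambda>m. 0) sums ?u ?z" by (simp add: h0 del: vector_ssub_ldistrib)
    then have "?u ?z = 0" using sums_unique2 sums_zero by blast
    then show ?thesis unfolding to_unit_def affine_inverse[OF R] .
  next
    case False
    then show ?thesis using f by (simp add: hardy_space_def)
  qed
  then show False using nz by blast
qed

text \<open>Spending \<open>k\<close> functionals kills all components of degree below
  \<open>level d k\<close>. The function is then small on the ball of radius \<open>r * R\<close>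
  relative to its norm at radius \<open>s * R\<close>, and \<open>L\<close> spreads this smallness
  over the whole ball, in particular over the sphere of radius \<open>s * R\<close>.\<close>

lemma dilated_weyl_op:
  assumes s: "r < s" "s < 1"
  shows "weyl_op (hardy_space c R) L (\<lambda>k. W * tail_factor CARD('n) (level CARD('n) k) ((r / s)\<^sup>2))"
proof
  let ?d = "CARD('n)"
  let ?y = "(r / s)\<^sup>2"
  have d: "1 \<le> ?d" by (simp add: Suc_le_eq)
  have s0: "0 < s" using s r by simp
  have "0 \<le> r / s" "r / s < 1" using s s0 r by auto
  then have y: "0 \<le> ?y" "?y < 1" using power_strict_mono[of "r / s" 1 2] by auto
  let ?a = "\<lambda>k. W * tail_factor ?d (level ?d k) ?y"
  show a0: "0 \<le> ?a k" for k using W_nonneg tail_factor_nonneg[of ?y] y by simp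
  show "?a \<longlonglongrightarrow> 0" using tendsto_mult_right_zero[OF tail_factor_level_tendsto[OF d y], of W] by simp
  have "\<forall>m. \<exists>\<Phi>. finite \<Phi> \<and> card \<Phi> \<le> hdim ?d m \<and>
    (\<forall>\<phi>\<in>\<Phi>. \<forall>f\<in>hardy_space c R. \<forall>g\<in>hardy_space c R. \<forall>a b. \<phi> (\<lambda>x. a * f x + b * g x) = a * \<phi> f + b * \<phi> g) \<and>
    (\<forall>f\<in>hardy_space c R. (\<forall>\<phi>\<in>\<Phi>. \<phi> f = 0) \<longrightarrow> hcomp m (to_unit c R f) = (\<lambda>_. 0))"
    using component_functionals by blast
  from choice[OF this] obtain \<Phi> where \<Phi>': "\<forall>m. finite (\<Phi> m) \<and> card (\<Phi> m) \<le> hdim ?d m \<and>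
    (\<forall>\<phi>\<in>\<Phi> m. \<forall>f\<in>hardy_space c R. \<forall>g\<in>hardy_space c R. \<forall>a b. \<phi> (\<lambda>x. a * f x + b * g x) = a * \<phi> f + b * \<phi> g) \<and>
    (\<forall>f\<in>hardy_space c R. (\<forall>\<phi>\<in>\<Phi> m. \<phi> f = 0) \<longrightarrow> hcomp m (to_unit c R f) = (\<lambda>_. 0))" by (rule exE)
  then have \<Phi>: "\<And>m. finite (\<Phi> m)" "\<And>m. card (\<Phi> m) \<le> hdim ?d m"
    "\<And>m \<phi> f g a b. \<phi> \<in> \<Phi> m \<Longrightarrow> f \<in> hardy_space c R \<Longrightarrow> g \<in> hardy_space c R \<Longrightarrow> \<phi> (\<lambda>x. a * f x + b * g x) = a * \<phi> f + b * \<phi> g"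
    "\<And>m f. f \<in> hardy_space c R \<Longrightarrow> (\<And>\<phi>. \<phi> \<in> \<Phi> m \<Longrightarrow> \<phi> f = 0) \<Longrightarrow> hcomp m (to_unit c R f) = (\<lambda>_. 0)"
    by blast+
  have hol: "to_unit c R f cholomorphic_on ball 0 1" if "f \<in> hardy_space c R" for f
    by (rule to_unit_cholomorphic[OF R hardy_space_cholomorphic[OF R that]])
  have cont: "continuous_on (cball 0 1) (\<lambda>x. to_unit c R f (complex_of_real s *s x))" if "f \<in> hardy_space c R" for f
    by (rule continuous_on_dilate[OF hol[OF that]]) (use s s0 in auto)
  define C where "C k = (\<Union>m<level ?d k. \<Phi> m)" for k
  fix n b \<mu> assume tf: "hardy.triangular_family n b \<mu>"
  show "(\<Prod>j<n. cmod (\<mu> j)) \<le> (\<Prod>k<n. ?a k)"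
  proof (rule hardy.triangular_family_weyl[OF tf, where ip = "dilated_inner s" and C = C])
    fix f g h and a b :: complex
    assume f: "f \<in> hardy_space c R" and g: "g \<in> hardy_space c R" and h: "h \<in> hardy_space c R"
    have "to_unit c R (\<lambda>x. a * f x + b * g x) = (\<lambda>z. a * to_unit c R f z + b * to_unit c R g z)"
      by (simp add: to_unit_def[abs_def])
    then show "dilated_inner s (\<lambda>x. a * f x + b * g x) h = a * dilated_inner s f h + b * dilated_inner s g h"
      by (simp add: dilated_inner_def sphere_inner_add_left cont f g h)
  next
    show "dilated_inner s f g = cnj (dilated_inner s g f)" for f g
      by (simp add: dilated_inner_def cnj_sphere_inner)
    show "f \<in> hardy_space c R \<Longrightarrow> f \<noteq> (\<lambda>_. 0) \<Longrightarrow> 0 < Re (dilated_inner s f f)" for f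
      by (rule dilated_inner_pos[OF s0 s(2)])
  next
    fix k
    have "card (C k) \<le> (\<Sum>m<level ?d k. card (\<Phi> m))" unfolding C_def by (rule card_UN_le) simp
    also have "\<dots> \<le> hdim_sum ?d (level ?d k)" unfolding hdim_sum_def by (rule sum_mono) (rule \<Phi>(2))
    also have "\<dots> \<le> k" by (rule level(1)[OF d])
    finally show "finite (C k) \<and> card (C k) \<le> k" using \<Phi>(1) by (auto simp: C_def)
  next
    fix k \<phi> f g and a b :: complex
    assume "\<phi> \<in> C k" "f \<in> hardy_space c R" "g \<in> hardy_space c R"
    then show "\<phi> (\<lambda>x. a * f x + b * g x) = a * \<phi> f + b * \<phi> g" using \<Phi>(3) by (auto simp: C_def)
  next
    fix k f assume f: "f \<in> hardy_space c R" and 0: "\<And>\<phi>. \<phi> \<in> C k \<Longrightarrow> \<phi> f = 0"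
    let ?u = "to_unit c R f"
    define K where "K = level ?d k"
    define Q where "Q = sphere_norm2 (\<lambda>x. ?u (complex_of_real s *s x))"
    have Q0: "0 \<le> Q" by (simp add: Q_def sphere_norm2_nonneg)
    define M where "M = tail_factor ?d K ?y * sqrt Q"
    have van: "hcomp m ?u = (\<lambda>_. 0)" if "m < K" for m
      by (rule \<Phi>(4)[OF f]) (use 0 that in \<open>auto simp: C_def K_def\<close>)
    have fM: "cmod (f y) \<le> M" if "y \<in> ball c (r * R)" for y
    proof -
      let ?z = "complex_of_real (1 / R) *s (y - c)"
      have "norm ?z \<le> r"
        using that R unfolding norm_affine_inverse[OF R] by (simp add: divide_le_eq)
      then have "(cmod (?u ?z))\<^sup>2 \<le> (tail_factor ?d K ?y)\<^sup>2 * Q"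
        unfolding tail_factor_power2[OF y(1) less_imp_le[OF y(2)]] hdim_def Q_def
        using r s by (intro tail_bound[OF hol[OF f] van]) auto
      also have "\<dots> = M\<^sup>2" using Q0 by (simp add: M_def power_mult_distrib)
      finally have "(cmod (?u ?z))\<^sup>2 \<le> M\<^sup>2" .
      moreover have "0 \<le> M" using tail_factor_nonneg[of ?y] y Q0 by (simp add: M_def)
      ultimately have "cmod (?u ?z) \<le> M" by (rule power2_le_imp_le)
      then show ?thesis unfolding to_unit_def affine_inverse[OF R] .
    qed
    have "Re (dilated_inner s (L f) (L f)) = sphere_norm2 (\<lambda>x. to_unit c R (L f) (complex_of_real s *s x))"
      by (simp add: dilated_inner_def sphere_inner_self)
    also have "\<dots> \<le> (W * M)\<^sup>2"
      by (rule sphere_norm2_le[OF cont[OF L_in_hardy[OF f]]]) (unfold to_unit_def, rule L_norm_le[OF fM])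
    also have "\<dots> = (?a k)\<^sup>2 * Q" using Q0 by (simp add: M_def K_def power_mult_distrib)
    also have "Q = Re (dilated_inner s f f)" by (simp add: Q_def dilated_inner_def sphere_inner_self)
    finally show "Re (dilated_inner s (L f) (L f)) \<le> (?a k)\<^sup>2 * Re (dilated_inner s f f)" .
  qed (rule a0)
qed

lemma eigenvalue_sequence_exists: "\<exists>lam. eigenvalue_sequence (hardy_space c R) L lam"
proof -
  interpret weyl_op "hardy_space c R" L "\<lambda>k. W * tail_factor CARD('n) (level CARD('n) k) ((r / ((1 + r) / 2))\<^sup>2)"
    by (rule dilated_weyl_op) (use r in auto)
  show ?thesis by (rule eigenvalue_sequence_exists)
qed

text \<open>The eigenvalue sequence is the same for every \<open>s\<close>, and the right-hand side
  is continuous in \<open>s\<close>, so \<open>s\<close> may tend to 1 in the inequality.\<close>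

lemma eigenvalue_product_bound:
  assumes lam: "eigenvalue_sequence (hardy_space c R) L lam" and n: "1 \<le> n"
  shows "cmod (lam n) ^ n \<le> (\<Prod>k<n. W * tail_factor CARD('n) (level CARD('n) k) (r\<^sup>2))"
proof (rule LIMSEQ_le_const)
  have r2: "r\<^sup>2 < 1" using power_strict_mono[of r 1 2] r by simp
  have "(\<lambda>j. \<Prod>k<n. W * tail_factor CARD('n) (level CARD('n) k) ((r / radius j)\<^sup>2)) \<longlonglongrightarrow>
    (\<Prod>k<n. W * tail_factor CARD('n) (level CARD('n) k) ((r / 1)\<^sup>2))"
    unfolding tail_factor_def by (intro tendsto_intros radius(4)) (use r2 in auto)
  then show "(\<lambda>j. \<Prod>k<n. W * tail_factor CARD('n) (level CARD('n) k) ((r / radius j)\<^sup>2)) \<longlonglongrightarrow>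
    (\<Prod>k<n. W * tail_factor CARD('n) (level CARD('n) k) (r\<^sup>2))" by simp
  have "\<forall>\<^sub>F j in sequentially. r < radius j" using order_tendstoD(1)[OF radius(4) r(2)] .
  then obtain N where N: "\<And>j. j \<ge> N \<Longrightarrow> r < radius j" unfolding eventually_sequentially by blast
  show "\<exists>N. \<forall>j\<ge>N. cmod (lam n) ^ n \<le> (\<Prod>k<n. W * tail_factor CARD('n) (level CARD('n) k) ((r / radius j)\<^sup>2))"
  proof (intro exI[of _ N] allI impI)
    fix j assume "j \<ge> N"
    interpret weyl_op "hardy_space c R" L "\<lambda>k. W * tail_factor CARD('n) (level CARD('n) k) ((r / radius j)\<^sup>2)"
      by (rule dilated_weyl_op[OF N[OF \<open>j \<ge> N\<close>] radius(2)])
    show "cmod (lam n) ^ n \<le> (\<Prod>k<n. W * tail_factor CARD('n) (level CARD('n) k) ((r / radius j)\<^sup>2))"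
      by (rule eigenvalue_sequence_bound[OF lam n])
  qed
qed

end

section \<open>Elementary estimates for dimensions, levels and products\<close>

lemma binomial_le_mult_power: "1 \<le> K \<Longrightarrow> real ((K + p) choose p) \<le> (real p + 1) * real K ^ p"
proof (induction p)
  case (Suc p)
  have "real ((K + Suc p) choose Suc p) = real ((K + p) choose p) * ((real K + real p + 1) / (real p + 1))"
    by (subst binomial_Suc_real) simp
  also have "\<dots> \<le> ((real p + 1) * real K ^ p) * ((real K + real p + 1) / (real p + 1))"
    by (intro mult_right_mono Suc.IH Suc.prems) auto
  also have "\<dots> = real K ^ p * (real K + (real p + 1) * 1)" by (simp add: field_simps)
  also have "\<dots> \<le> real K ^ p * (real K + (real p + 1) * real K)"
    using Suc.prems by (intro mult_left_mono add_left_mono) auto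
  also have "\<dots> = (real (Suc p) + 1) * real K ^ Suc p" by (simp add: algebra_simps)
  finally show ?case .
qed simp

lemma fact_binomial_le_power: "fact p * ((K + p) choose p) \<le> (K + p) ^ p"
proof (induction p)
  case (Suc p)
  have "fact (Suc p) * ((K + Suc p) choose Suc p) = fact p * (Suc p * (Suc (K + p) choose Suc p))"
    by (simp only: fact_Suc of_nat_id mult_ac add_Suc_right)
  also have "\<dots> = Suc (K + p) * (fact p * ((K + p) choose p))"
    using Suc_times_binomial_eq[of "K + p" p] by (simp add: mult_ac)
  also have "\<dots> \<le> Suc (K + p) * (K + p) ^ p" by (intro mult_left_mono Suc.IH) simp
  also have "\<dots> \<le> Suc (K + p) * Suc (K + p) ^ p" by (intro mult_left_mono power_mono) auto
  finally show ?case by simp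
qed simp

lemma power_le_imp_le_pos:
  fixes x y :: real
  assumes "1 \<le> n" "x ^ n \<le> y ^ n" "0 \<le> y"
  shows "x \<le> y"
  using assms power_le_imp_le_base[of x "n - 1" y] by simp

text \<open>With \<open>K\<close> the level, \<open>h\<close> the dimension of degree
  \<open>K\<close> and \<open>p = d - 1\<close>, two facts are combined so that \<open>K\<close>
  disappears: \<open>K * h \<le> d * (k + 1)\<close>, because \<open>K * h\<close> is
  \<open>d\<close> times the dimension of the lower degrees, and \<open>h \<le> d * K ^ p\<close>.
  Together they bound \<open>h ^ d = h * h ^ p\<close>.\<close>

lemma hdim_level_bound:
  assumes d: "1 \<le> d"
  shows "real (hdim d (level d k)) \<le> real d * real (k + 1) powr ((real d - 1) / real d)"
proof -
  obtain p where p: "d = Suc p" using d by (cases d) auto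
  define K where "K = level d k"
  define h where "h = real (hdim d K)"
  have h0: "0 \<le> h" by (simp add: h_def)
  have "h ^ d \<le> (real d) ^ d * real (k + 1) ^ p"
  \<comment> \<open>At level 0 the estimate of \<open>h\<close> by a power of \<open>K\<close>
    fails, but then \<open>h\<close> is 1.\<close>
  proof (cases "K = 0")
    case True
    then have "h = 1" by (simp add: h_def hdim_def)
    moreover have "1 \<le> (real d) ^ d * real (k + 1) ^ p"
      using mult_mono[of 1 "real d ^ d" 1 "real (k + 1) ^ p"] d by (simp add: one_le_power)
    ultimately show ?thesis by simp
  next
    case False
    then have K: "1 \<le> K" by simp
    then obtain b where b: "K = Suc b" by (cases K) auto
    have hp: "h = real ((K + p) choose p)" by (simp add: h_def p hdim_Suc)
    have "Suc p * ((K + p) choose Suc p) = K * ((K + p) choose p)"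
      using Suc_times_binomial_add[of p b] by (simp add: b add.commute)
    then have "real K * h = real d * real (hdim_sum d K)"
      unfolding hp p hdim_sum_Suc by (metis of_nat_mult)
    also have "\<dots> \<le> real d * real (k + 1)"
      using level(1)[OF d, of k] by (intro mult_left_mono) (auto simp: K_def)
    finally have Kh: "real K * h \<le> real d * real (k + 1)" .
    have "h ^ d = h * h ^ p" by (simp add: p)
    also have "\<dots> \<le> (real d * real K ^ p) * h ^ p"
      using binomial_le_mult_power[OF K, of p] h0 by (intro mult_right_mono) (auto simp: hp p add.commute)
    also have "\<dots> = real d * (real K * h) ^ p" by (simp add: power_mult_distrib)
    also have "\<dots> \<le> real d * (real d * real (k + 1)) ^ p"
      using h0 by (intro mult_left_mono power_mono Kh) auto
    finally show ?thesis by (simp add: p power_mult_distrib)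
  qed
  also have "\<dots> = (real d * real (k + 1) powr ((real d - 1) / real d)) ^ d"
  proof -
    have "(real (k + 1) powr ((real d - 1) / real d)) ^ d = real (k + 1) powr (real d * ((real d - 1) / real d))"
      by (rule powr_power) simp
    also have "real d * ((real d - 1) / real d) = real p" by (simp add: p)
    also have "real (k + 1) powr real p = real (k + 1) ^ p" by (rule powr_realpow) simp
    finally show ?thesis by (simp add: power_mult_distrib)
  qed
  finally show ?thesis
    unfolding h_def[symmetric] K_def[symmetric]
    by (rule power_le_imp_le_pos[OF d]) simp
qed

text \<open>By maximality of the level, \<open>k + 1\<close> is at most
  \<open>(level d k + d) choose d\<close>, and this is at most
  \<open>(level d k + d) ^ d / fact d\<close>.\<close>

lemma level_ge:
  assumes d: "1 \<le> d"
  shows "fact d powr (1 / real d) * real (k + 1) powr (1 / real d) \<le> real (level d k + d)"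
proof -
  obtain p where p: "d = Suc p" using d by (cases d) auto
  let ?K = "level d k"
  have "hdim_sum d (Suc ?K) = (?K + d) choose d" by (simp add: p hdim_sum_Suc)
  then have "k + 1 \<le> (?K + d) choose d" using level(2)[OF d, of k] by simp
  then have "fact d * (k + 1) \<le> fact d * ((?K + d) choose d)" by (rule mult_left_mono) simp
  also have "\<dots> \<le> (?K + d) ^ d" by (rule fact_binomial_le_power)
  finally have "real (fact d * (k + 1)) \<le> real ((?K + d) ^ d)" by (simp only: of_nat_le_iff)
  then have le: "fact d * real (k + 1) \<le> real (?K + d) ^ d" by (simp add: algebra_simps)
  have "fact d powr (1 / real d) * real (k + 1) powr (1 / real d) = (fact d * real (k + 1)) powr (1 / real d)"
    by (simp add: powr_mult)
  also have "\<dots> \<le> (real (?K + d) ^ d) powr (1 / real d)" by (rule powr_mono2[OF _ _ le]) auto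
  also have "\<dots> = real (?K + d)"
    using d by (subst powr_realpow[symmetric]) (auto simp: powr_powr)
  finally show ?thesis .
qed

text \<open>The factor \<open>r ^ d\<close> in the denominator compensates for replacing
  \<open>r ^ K\<close> by \<open>r ^ (K + d)\<close>, because \<open>level_ge\<close> bounds
  \<open>K + d\<close> from below rather than \<open>K\<close>.\<close>

lemma tail_factor_level_bound:
  assumes d: "1 \<le> d" and r: "0 < r" "r < 1"
  shows "tail_factor d (level d k) (r\<^sup>2) \<le> sqrt (real d) / (r ^ d * (1 - r\<^sup>2) powr (real d / 2))
     * real (k + 1) powr ((real d - 1) / (2 * real d))
     * r powr (fact d powr (1 / real d) * real (k + 1) powr (1 / real d))"
proof -
  let ?K = "level d k"
  let ?h = "real (hdim d ?K)"
  have r2: "0 < 1 - r\<^sup>2" using power_strict_mono[of r 1 2] r by simp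
  have pw: "sqrt ((1 - r\<^sup>2) ^ d) = (1 - r\<^sup>2) powr (real d / 2)"
    using r2 by (simp add: powr_half_sqrt[symmetric] powr_powr powr_realpow[symmetric])
  have "tail_factor d ?K (r\<^sup>2) = sqrt ?h * r ^ ?K / (1 - r\<^sup>2) powr (real d / 2)"
  proof -
    have "sqrt ((r\<^sup>2) ^ ?K) = r ^ ?K" using r by (simp add: real_sqrt_power)
    then show ?thesis by (simp only: tail_factor_def real_sqrt_divide real_sqrt_mult pw)
  qed
  also have "\<dots> = sqrt ?h * r ^ (?K + d) / (r ^ d * (1 - r\<^sup>2) powr (real d / 2))"
    using r by (simp add: power_add)
  also have "\<dots> \<le> (sqrt (real d) * real (k + 1) powr ((real d - 1) / (2 * real d)))
     * r powr (fact d powr (1 / real d) * real (k + 1) powr (1 / real d)) / (r ^ d * (1 - r\<^sup>2) powr (real d / 2))"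
  proof (intro divide_right_mono mult_mono)
    have "sqrt ?h \<le> sqrt (real d * real (k + 1) powr ((real d - 1) / real d))"
      using hdim_level_bound[OF d] by simp
    also have "\<dots> = sqrt (real d) * real (k + 1) powr ((real d - 1) / (2 * real d))"
      by (simp add: real_sqrt_mult powr_half_sqrt[symmetric] powr_powr mult.commute)
    finally show "sqrt ?h \<le> sqrt (real d) * real (k + 1) powr ((real d - 1) / (2 * real d))" .
    have "r ^ (?K + d) = r powr (real (?K + d))" using r by (simp only: powr_realpow)
    also have "\<dots> \<le> r powr (fact d powr (1 / real d) * real (k + 1) powr (1 / real d))"
      by (rule powr_mono') (use level_ge[OF d, of k] r in auto)
    finally show "r ^ (?K + d) \<le> r powr (fact d powr (1 / real d) * real (k + 1) powr (1 / real d))" .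
  qed (use r in auto)
  finally show ?thesis by (simp add: mult_ac)
qed

text \<open>Comparison of the sum with the integral of \<open>x powr q\<close>. It is strict from
  \<open>n = 1\<close> on, and this is the source of the strict inequality between the eigenvalues
  and the bound.\<close>

lemma sum_powr_gt:
  assumes q: "0 < q" and n: "1 \<le> n"
  shows "real n powr (q + 1) / (q + 1) < (\<Sum>k<n. real (k + 1) powr q)"
  using n
proof (induction n rule: dec_induct)
  case base
  then show ?case using q by simp
next
  case (step n)
  have "\<exists>z>real n. z < real n + 1 \<and> (real n + 1) powr (q + 1) - real n powr (q + 1) = (real n + 1 - real n) * ((q + 1) * z powr q)"
  proof (rule MVT2)
    fix x :: real assume "real n \<le> x"
    then have "x > 0" using step by simp
    then have "((\<lambda>x. x powr (q + 1)) has_real_derivative (q + 1) * x powr (q + 1 - 1)) (at x)"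
      by (rule has_real_derivative_powr)
    then show "((\<lambda>x. x powr (q + 1)) has_real_derivative (q + 1) * x powr q) (at x)" by simp
  qed simp
  then obtain z where z: "z > real n" "z < real n + 1"
    "(real n + 1) powr (q + 1) - real n powr (q + 1) = (q + 1) * z powr q" by auto
  have "z powr q < (real n + 1) powr q" using z q by (intro powr_less_mono2) auto
  then have "(real n + 1) powr (q + 1) < real n powr (q + 1) + (q + 1) * (real n + 1) powr q"
    using z(3) mult_strict_left_mono[of "z powr q" "(real n + 1) powr q" "q + 1"] q by linarith
  then have "(real n + 1) powr (q + 1) / (q + 1) < (real n powr (q + 1) + (q + 1) * (real n + 1) powr q) / (q + 1)"
    using q by (intro divide_strict_right_mono) auto
  also have "\<dots> = real n powr (q + 1) / (q + 1) + (real n + 1) powr q"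
    using q by (simp add: add_divide_distrib)
  also have "\<dots> < (\<Sum>k<n. real (k + 1) powr q) + (real n + 1) powr q" using step by simp
  finally show ?case by (simp add: add.commute)
qed

text \<open>In the polynomial factor \<open>k + 1\<close> is simply replaced by \<open>n\<close>,
  whereas the exponents of \<open>r\<close> are summed. With \<open>q = 1 / d\<close> the sum
  produces \<open>1 / (q + 1) = d / (d + 1)\<close>.\<close>

lemma explicit_product_bound:
  fixes a :: "nat \<Rightarrow> real"
  assumes d: "1 \<le> d" and r: "0 < r" "r < 1" and W: "0 \<le> W" and n: "1 \<le> n"
  defines "bound \<equiv> W * sqrt (real d) / (r ^ d * (1 - r\<^sup>2) powr (real d / 2))
       * real n powr ((real d - 1) / (2 * real d))
       * r powr (real d / (real d + 1) * fact d powr (1 / real d) * real n powr (1 / real d))"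
  shows "0 \<le> bound"
    and "(\<Prod>k<n. W * tail_factor d (level d k) (r\<^sup>2)) \<le> bound ^ n"
    and "0 < W \<Longrightarrow> (\<Prod>k<n. W * tail_factor d (level d k) (r\<^sup>2)) < bound ^ n"
proof -
  have r2: "0 < 1 - r\<^sup>2" using power_strict_mono[of r 1 2] r by simp
  define A where "A = W * sqrt (real d) / (r ^ d * (1 - r\<^sup>2) powr (real d / 2)) * real n powr ((real d - 1) / (2 * real d))"
  define \<beta> where "\<beta> = (fact d powr (1 / real d) :: real)"
  have \<beta>: "0 < \<beta>" by (simp add: \<beta>_def)
  define q where "q = 1 / real d"
  have q: "0 < q" using d by (simp add: q_def)
  have A0: "0 \<le> A" using W r r2 by (simp add: A_def)
  have bound: "bound = A * r powr (real d / (real d + 1) * \<beta> * real n powr q)"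
    by (simp add: bound_def A_def \<beta>_def q_def)
  show "0 \<le> bound" unfolding bound using A0 by simp
  have "(\<Prod>k<n. W * tail_factor d (level d k) (r\<^sup>2)) \<le> (\<Prod>k<n. A * r powr (\<beta> * real (k + 1) powr q))"
  proof (rule prod_mono, intro conjI)
    fix k assume k: "k \<in> {..<n}"
    show "0 \<le> W * tail_factor d (level d k) (r\<^sup>2)"
      using W r2 by (intro mult_nonneg_nonneg tail_factor_nonneg) auto
    let ?P = "sqrt (real d) / (r ^ d * (1 - r\<^sup>2) powr (real d / 2))"
    have "W * tail_factor d (level d k) (r\<^sup>2)
      \<le> W * (?P * real (k + 1) powr ((real d - 1) / (2 * real d)) * r powr (\<beta> * real (k + 1) powr q))"
      using tail_factor_level_bound[OF d r, of k] W unfolding \<beta>_def q_def by (intro mult_left_mono)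
    also have "\<dots> \<le> W * (?P * real n powr ((real d - 1) / (2 * real d)) * r powr (\<beta> * real (k + 1) powr q))"
      using W r r2 k d by (intro mult_left_mono mult_right_mono powr_mono2) auto
    also have "\<dots> = A * r powr (\<beta> * real (k + 1) powr q)" by (simp add: A_def)
    finally show "W * tail_factor d (level d k) (r\<^sup>2) \<le> A * r powr (\<beta> * real (k + 1) powr q)" .
  qed
  also have "\<dots> = A ^ n * r powr (\<beta> * (\<Sum>k<n. real (k + 1) powr q))"
    unfolding prod.distrib sum_distrib_left using r by (subst powr_sum) auto
  finally have le: "(\<Prod>k<n. W * tail_factor d (level d k) (r\<^sup>2)) \<le> A ^ n * r powr (\<beta> * (\<Sum>k<n. real (k + 1) powr q))" .
  have bn: "bound ^ n = A ^ n * r powr (\<beta> * (real n powr (q + 1) / (q + 1)))"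
  proof -
    have "bound ^ n = A ^ n * r powr (real n * (real d / (real d + 1) * \<beta> * real n powr q))"
      unfolding bound power_mult_distrib using r by (simp add: powr_power mult.commute)
    also have "real n * (real d / (real d + 1) * \<beta> * real n powr q) = \<beta> * (real d / (real d + 1)) * (real n powr q * real n powr 1)"
      using n by simp
    also have "real n powr q * real n powr 1 = real n powr (q + 1)" by (simp only: powr_add)
    also have "real d / (real d + 1) = 1 / (q + 1)" using d by (simp add: q_def field_simps)
    finally show ?thesis by simp
  qed
  have strict: "r powr (\<beta> * (\<Sum>k<n. real (k + 1) powr q)) < r powr (\<beta> * (real n powr (q + 1) / (q + 1)))"
    by (rule powr_less_mono'[OF r mult_strict_left_mono[OF sum_powr_gt[OF q n] \<beta>]])
  show "(\<Prod>k<n. W * tail_factor d (level d k) (r\<^sup>2)) \<le> bound ^ n"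
    unfolding bn using A0 by (intro order_trans[OF le] mult_left_mono less_imp_le[OF strict]) simp
  assume "0 < W"
  then have "0 < A" using d r r2 n by (simp add: A_def)
  then have "A ^ n * r powr (\<beta> * (\<Sum>k<n. real (k + 1) powr q)) < bound ^ n"
    unfolding bn using strict by (intro mult_strict_left_mono) auto
  with le show "(\<Prod>k<n. W * tail_factor d (level d k) (r\<^sup>2)) < bound ^ n" by simp
qed

text \<open>In one variable each degree has dimension 1 and the level is \<open>k\<close> itself, so
  the product is evaluated exactly: the exponents \<open>0, ..., n - 1\<close> have mean
  \<open>(n - 1) / 2\<close>.\<close>

lemma explicit_product_bound_1:
  assumes r: "0 < r" "r < 1" and n: "1 \<le> n"
  shows "(\<Prod>k<n. W * tail_factor 1 (level 1 k) (r\<^sup>2)) = (W / sqrt (1 - r\<^sup>2) * r powr ((real n - 1) / 2)) ^ n"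
proof -
  have "tail_factor 1 (level 1 k) (r\<^sup>2) = r powr (real k) / sqrt (1 - r\<^sup>2)" for k
    unfolding level_1
    using r by (simp add: tail_factor_def hdim_def real_sqrt_divide real_sqrt_power powr_realpow)
  then have "(\<Prod>k<n. W * tail_factor 1 (level 1 k) (r\<^sup>2)) = (\<Prod>k<n. (W / sqrt (1 - r\<^sup>2)) * r powr (real k))"
    by simp
  also have "\<dots> = (W / sqrt (1 - r\<^sup>2)) ^ n * r powr (\<Sum>k<n. real k)"
    unfolding prod.distrib using r by (subst powr_sum) auto
  also have "(\<Sum>k<n. real k) = real n * ((real n - 1) / 2)"
    by (induction n) (auto simp: field_simps)
  also have "r powr (real n * ((real n - 1) / 2)) = (r powr ((real n - 1) / 2)) ^ n"
    using r by (simp add: powr_power mult.commute)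
  finally show ?thesis unfolding power_mult_distrib .
qed

text \<open>Both estimates are \<open>n\<close>-th roots of the product bound. Strictness is tied to
  \<open>W \<noteq> 0\<close> because for \<open>W = 0\<close> the operator, its eigenvalues and the
  bound are all zero.\<close>

theorem theorem1:
  fixes c :: "complex ^ 'n" and R r W :: real and I :: "'i set"
    and w :: "'i \<Rightarrow> complex ^ 'n \<Rightarrow> complex"
    and T :: "'i \<Rightarrow> complex ^ 'n \<Rightarrow> complex ^ 'n"
    and d :: nat
    and L :: "(complex ^ 'n \<Rightarrow> complex) \<Rightarrow> (complex ^ 'n \<Rightarrow> complex)"
  assumes "d = CARD('n)"
    and "countable I"
    and "0 < r" and "r < 1"
    and "0 < R"
    and "\<And>i. i \<in> I \<Longrightarrow> w i cholomorphic_on ball c R"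
    and "\<And>i. i \<in> I \<Longrightarrow> bdd_above ((\<lambda>z. cmod (w i z)) ` ball c R)"
    and "(\<lambda>i. SUP z\<in>ball c R. cmod (w i z)) summable_on I"
    and "\<And>i. i \<in> I \<Longrightarrow> T i cholomorphic_map_on ball c R"
    and "\<And>i. i \<in> I \<Longrightarrow> T i ` ball c R \<subseteq> ball c R"
    and "(\<Union>i\<in>I. T i ` ball c R) \<subseteq> ball c (r * R)"
    and "L = transfer_operator (ball c R) I w T"
    and "W = (SUP z\<in>ball c R. \<Sum>\<^sub>\<infinity>i\<in>I. cmod (w i z))"
  shows "compact_operator (hardy_space c R) (hardy_norm c R) L \<and>
    (\<exists>lam. eigenvalue_sequence (hardy_space c R) L lam) \<and>
    (\<forall>lam. eigenvalue_sequence (hardy_space c R) L lam \<longrightarrow>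
      (\<forall>n::nat. 1 \<le> n \<longrightarrow>
        (let bound = W * sqrt (real d) / (r ^ d * (1 - r\<^sup>2) powr (real d / 2))
               * real n powr ((real d - 1) / (2 * real d))
               * r powr (real d / (real d + 1) * fact d powr (1 / real d) * real n powr (1 / real d))
         in cmod (lam n) \<le> bound \<and> (W \<noteq> 0 \<longrightarrow> cmod (lam n) < bound))) \<and>
      (d = 1 \<longrightarrow> (\<forall>n::nat. 1 \<le> n \<longrightarrow>
        cmod (lam n) \<le> W / sqrt (1 - r\<^sup>2) * r powr ((real n - 1) / 2))))"
proof -
  interpret transfer c R r W I w T
    by unfold_locales (use assms in auto)
  have d: "1 \<le> d" unfolding assms(1) by (simp add: Suc_le_eq)
  show ?thesis
    unfolding assms(12)
  proof (intro conjI allI impI L_compact eigenvalue_sequence_exists)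
    fix lam :: "nat \<Rightarrow> complex" and n :: nat
    assume lam: "eigenvalue_sequence (hardy_space c R) (transfer_operator (ball c R) I w T) lam" and n: "1 \<le> n"
    note prod = eigenvalue_product_bound[OF lam n, folded assms(1)]
    let ?b = "W * sqrt (real d) / (r ^ d * (1 - r\<^sup>2) powr (real d / 2))
               * real n powr ((real d - 1) / (2 * real d))
               * r powr (real d / (real d + 1) * fact d powr (1 / real d) * real n powr (1 / real d))"
    note expl = explicit_product_bound[OF d assms(3,4) W_nonneg n]
    have "cmod (lam n) \<le> ?b"
      by (rule power_le_imp_le_pos[OF n order_trans[OF prod expl(2)] expl(1)])
    moreover have "cmod (lam n) < ?b" if "W \<noteq> 0"
    proof (rule power_less_imp_less_base[OF _ expl(1)])
      have "0 < W" using that W_nonneg by simp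
      from order.strict_trans1[OF prod expl(3)[OF this]] show "cmod (lam n) ^ n < ?b ^ n" .
    qed
    ultimately show "let bound = ?b in cmod (lam n) \<le> bound \<and> (W \<noteq> 0 \<longrightarrow> cmod (lam n) < bound)"
      unfolding Let_def by blast
    assume d1: "d = 1"
    have r2: "0 < 1 - r\<^sup>2" using power_strict_mono[of r 1 2] assms(3,4) by simp
    have "cmod (lam n) ^ n \<le> (W / sqrt (1 - r\<^sup>2) * r powr ((real n - 1) / 2)) ^ n"
      using prod unfolding d1 explicit_product_bound_1[OF assms(3,4) n] .
    then show "cmod (lam n) \<le> W / sqrt (1 - r\<^sup>2) * r powr ((real n - 1) / 2)"
      by (rule power_le_imp_le_pos[OF n]) (use W_nonneg r2 in simp)
  qed
qed

end
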